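(* Let $U:\mathbb{R}^d\to\mathbb{R}$ be three times continuously differentiable with $\nabla U(0)=0$, and suppose there are constants $0<m\le L$ and $\tilde L$ such that $$\frac m2|x-y|^2\le U(y)-U(x)-\langle\nabla U(x),y-x\rangle\le\frac L2|x-y|^2,\qquad x,y\in\mathbb{R}^d,$$ and $\|\nabla^3U\|\le\tilde L$. Let $(X_t^x)_{t\ge0}$ be the Langevin diffusion $\mathrm dX_t=-\nabla U(X_t)\mathrm dt+\sqrt2\,\mathrm dB_t$ with $X_0=x$, and let $\pi(\mathrm dx)=Z^{-1}e^{-U(x)}\mathrm dx$ be its unique stationary distribution. Let $\Gamma=(\gamma_n)_{n\ge1}$ be a non-increasing sequence with $\gamma_n>0$ for all $n$, $\lim_{n\to\infty}\gamma_n=0$, $\sum_{n\ge1}\gamma_n=+\infty$, and $$\omega:=\limsup_{n\to\infty}\frac{\gamma_n-\gamma_{n+1}}{\gamma_{n+1}^2}<+\infty,\qquad 2\omega<m .$$ Let $t_0=0$, $t_n=\sum_{i=1}^n\gamma_i$, and let $(Y_{t_n}^x)_{n\ge0}$ be the decreasing-step Poisson randomized midpoint Langevin Monte Carlo scheme (PRLMC) with step sequence $\Gamma$ started at $x$. Then, for $n\ge1$ and with a positive constant $C$, $$d_{\mathcal G}\big(\mathcal L(X_{t_n}^x),\mathcal L(Y_{t_n}^x)\big)\le C(1+|x|^2)\gamma_n .$$ Furthermore, there exists some positive constant $C$ independent of $\Gamma$ such that $$d_{\mathcal G}\big(\mathcal L(Y_{t_n}^x),\pi\big)\le C(1+|x|^2)\gamma_n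 .$$
   Context: Decreasing-step PRLMC (Poisson randomized midpoint Euler-Maruyama scheme) with a positive integer parameter $K$: $Y_{t_0}=x$ and, for $k\ge0$, $$Y_{t_{k+1}}=Y_{t_k}-\gamma_{k+1}\nabla U(Y_{t_k})+\gamma_{k+1}\sum_{i=0}^{K-1}H_{k,i}\big(\nabla U(Y_{t_k})-\nabla U(\hat Y_{t_k,i})\big)+\sqrt{2\gamma_{k+1}}\,\xi_{k+1},$$ $$\hat Y_{t_k,i}=Y_{t_k}-\frac{i\gamma_{k+1}}{K}\nabla U(Y_{t_k})+\sqrt{\frac{2i\gamma_{k+1}}{K}}\,\xi_{k,i},\qquad 0\le i\le K-1,$$ where $(H_{k,i})$ are independent Bernoulli variables with parameter $1/K$, and $(\xi_{k+1})$ and $(\xi_{k,i})$ are i.i.d. standard Gaussian vectors in $\mathbb{R}^d$, all independent of each other. $B$ is a $d$-dimensional Brownian motion; $\mathcal L(\cdot)$ denotes the law; the superscript $x$ is the initial state. For a function $f$, $\|\nabla^if\|=\sup_{x\in\mathbb{R}^d}\|\nabla^if(x)\|_{\mathrm{op}}$. The function class is $$\mathcal G=\{h\in\mathcal C^2(\mathbb{R}^d,\mathbb{R}):\ \|\nabla^ih\|<+\infty,\ i=1,2\}.$$ Let $\mathcal P_0$ be the set of probability measures $\mu$ on $\mathbb{R}^d$ with $\int h\,\mathrm d\mu<+\infty$ for every $h\in\mathcal G$ (it contains all probability measures with finite second moment). For $\mu_1,\mu_2\in\mathcal P_0$, $d_{\mathcal G}(\mu_1,\mu_2)=\sup_{h\in\mathcal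 G}\big\{\int h\,\mathrm d\mu_1-\int h\,\mathrm d\mu_2\big\}$.
   Formalization: d_G is taken over h in G with ‖∇h‖≤1 and ‖∇²h‖≤1, since over all of G it is only 0 or +∞; in the second bound C may depend on Γ when all n≥1 are covered, and C is independent of Γ only for n large enough (depending on Γ), as the uniform bound fails for tiny early steps. *)

theory Defs
  imports "HOL-Probability.Probability"
begin

section \<open>Derivatives and the class of test functions\<close>

text \<open>
  The Frechet derivative as a map into bounded linear functions. It can be iterated; the norm of
  the nested bounded linear function \<^term>\<open>fderiv (fderiv f) x\<close> (and so on) is the operator norm
  of the corresponding multilinear form. It is only meaningful at points of differentiability.
\<close>

definition fderiv :: "('a::real_normed_vector \<Rightarrow> 'b::real_normed_vector) \<Rightarrow> 'a \<Rightarrow> ('a \<Rightarrow>\<^sub>L 'b)" where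
  "fderiv f x = Blinfun (frechet_derivative f (at x))"

definition C1 :: "('a::real_normed_vector \<Rightarrow> 'b::real_normed_vector) \<Rightarrow> bool" where
  "C1 f \<longleftrightarrow> (\<forall>x. f differentiable (at x)) \<and> continuous_on UNIV (fderiv f)"

definition C2 :: "('a::real_normed_vector \<Rightarrow> 'b::real_normed_vector) \<Rightarrow> bool" where
  "C2 f \<longleftrightarrow> (\<forall>x. f differentiable (at x)) \<and> C1 (fderiv f)"

definition C3 :: "('a::real_normed_vector \<Rightarrow> 'b::real_normed_vector) \<Rightarrow> bool" where
  "C3 f \<longleftrightarrow> (\<forall>x. f differentiable (at x)) \<and> C2 (fderiv f)"

definition sup_norm :: "('a \<Rightarrow> 'b::real_normed_vector) \<Rightarrow> ereal" where
  "sup_norm F = (SUP x. ereal (norm (F x)))"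

definition grad :: "('a::real_inner \<Rightarrow> real) \<Rightarrow> 'a \<Rightarrow> 'a" where
  "grad f x = (THE D. GDERIV f x :> D)"

definition class_G :: "('a::euclidean_space \<Rightarrow> real) set" where
  "class_G = {h. C2 h \<and> sup_norm (fderiv h) < \<infinity> \<and> sup_norm (fderiv (fderiv h)) < \<infinity>}"

text \<open>
  Since \<^const>\<open>class_G\<close> is closed under negation, finiteness of \<open>\<integral>h d\<mu>\<close> from above for
  all \<open>h\<close> in the class is integrability of all of them.
\<close>

definition P0 :: "('a::euclidean_space) measure set" where
  "P0 = {\<mu>. prob_space \<mu> \<and> sets \<mu> = sets borel \<and> (\<forall>h\<in>class_G. integrable \<mu> h)}"

text \<open>
  \<^const>\<open>class_G\<close> is a vector space, so a supremum over all of it only takes the values \<open>0\<close> and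
  \<open>\<infinity>\<close>. The supremum is therefore normalised by the two seminorms defining the class.
  Off \<^const>\<open>P0\<close> the value is \<open>\<infinity>\<close>, so that a finite bound on \<open>d_G\<close> includes the fact
  that both measures belong to \<^const>\<open>P0\<close>.
\<close>

definition d_G :: "('a::euclidean_space) measure \<Rightarrow> 'a measure \<Rightarrow> ereal" where
  "d_G \<mu> \<nu> =
     (if \<mu> \<in> P0 \<and> \<nu> \<in> P0
      then (SUP h\<in>{h \<in> class_G. sup_norm (fderiv h) \<le> 1 \<and> sup_norm (fderiv (fderiv h)) \<le> 1}.
              ereal ((\<integral>x. h x \<partial>\<mu>) - (\<integral>x. h x \<partial>\<nu>)))
      else \<infinity>)"


section \<open>Brownian motion and the Langevin diffusion\<close>

definition std_gaussian :: "('a::euclidean_space) measure" where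
  "std_gaussian =
     density lborel (\<lambda>x. ennreal ((2 * pi) powr (- real DIM('a) / 2) * exp (- (norm x)\<^sup>2 / 2)))"

definition brownian_motion :: "'w measure \<Rightarrow> (real \<Rightarrow> 'w \<Rightarrow> 'a::euclidean_space) \<Rightarrow> bool" where
  "brownian_motion M B \<longleftrightarrow>
     prob_space M \<and>
     (\<forall>t\<ge>0. B t \<in> borel_measurable M) \<and>
     (AE w in M. B 0 w = 0) \<and>
     (AE w in M. continuous_on {0..} (\<lambda>t. B t w)) \<and>
     (\<forall>s t. 0 \<le> s \<and> s \<le> t \<longrightarrow>
        distr M borel (\<lambda>w. B t w - B s w) =
        distr std_gaussian borel (\<lambda>z. sqrt (t - s) *\<^sub>R z)) \<and>
     (\<forall>(n::nat) (s::nat \<Rightarrow> real). 0 \<le> s 0 \<and> (\<forall>i<n. s i \<le> s (Suc i)) \<longrightarrow>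
        prob_space.indep_vars M (\<lambda>_. borel) (\<lambda>i w. B (s (Suc i)) w - B (s i) w) {..<n})"

text \<open>
  The noise is additive, so the stochastic integral of the constant \<open>\<surd>2\<close> is \<open>\<surd>2 B\<close> and
  the stochastic differential equation is this pathwise integral equation.
\<close>

definition langevin_solution ::
    "'w measure \<Rightarrow> ('a::euclidean_space \<Rightarrow> real) \<Rightarrow> (real \<Rightarrow> 'w \<Rightarrow> 'a) \<Rightarrow> 'a \<Rightarrow> (real \<Rightarrow> 'w \<Rightarrow> 'a) \<Rightarrow> bool" where
  "langevin_solution M U B x X \<longleftrightarrow>
     (\<forall>t\<ge>0. X t \<in> borel_measurable M) \<and>
     (AE w in M. continuous_on {0..} (\<lambda>t. X t w)) \<and>
     (AE w in M. \<forall>t\<ge>0. X t w = x - integral {0..t} (\<lambda>s. grad U (X s w)) + sqrt 2 *\<^sub>R B t w)"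

definition gibbs :: "('a::euclidean_space \<Rightarrow> real) \<Rightarrow> 'a measure" where
  "gibbs U = density lborel (\<lambda>x. ennreal (exp (- U x) / (\<integral>y. exp (- U y) \<partial>lborel)))"


section \<open>The decreasing-step PRLMC scheme\<close>

text \<open>
  A step sequence is a function on \<^typ>\<open>nat\<close> whose value at \<open>0\<close> is irrelevant.
\<close>

definition step_time :: "(nat \<Rightarrow> real) \<Rightarrow> nat \<Rightarrow> real" where
  "step_time \<gamma> n = (\<Sum>i=1..n. \<gamma> i)"

definition step_omega :: "(nat \<Rightarrow> real) \<Rightarrow> ereal" where
  "step_omega \<gamma> = limsup (\<lambda>n. ereal ((\<gamma> n - \<gamma> (Suc n)) / (\<gamma> (Suc n))\<^sup>2))"

definition admissible_steps :: "real \<Rightarrow> (nat \<Rightarrow> real) \<Rightarrow> bool" where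
  "admissible_steps m \<gamma> \<longleftrightarrow>
     (\<forall>n\<ge>1. \<gamma> n > 0) \<and> (\<forall>n\<ge>1. \<gamma> (Suc n) \<le> \<gamma> n) \<and>
     \<gamma> \<longlonglongrightarrow> 0 \<and> filterlim (step_time \<gamma>) at_top sequentially \<and>
     step_omega \<gamma> < \<infinity> \<and> 2 * step_omega \<gamma> < ereal m"

text \<open>
  The driving noise: \<open>H k i\<close> (Bernoulli), \<open>\<xi> (Suc k)\<close> and \<open>\<zeta> k i\<close> (Gaussian, written
  \<open>\<xi>\<^sub>k\<^sub>,\<^sub>i\<close> in the scheme). Since they do not all have the same value type, their joint
  independence is that of the families of events they generate, as in \<open>indep_vars_def2\<close>.
\<close>

datatype noise_index = Bern nat nat | Outer nat | Inner nat nat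

definition noise_indices :: "nat \<Rightarrow> noise_index set" where
  "noise_indices K = {Bern k i |k i. i < K} \<union> {Outer (Suc k) |k. True} \<union> {Inner k i |k i. i < K}"

fun noise_events ::
    "'w measure \<Rightarrow> (nat \<Rightarrow> nat \<Rightarrow> 'w \<Rightarrow> bool) \<Rightarrow> (nat \<Rightarrow> 'w \<Rightarrow> 'a::euclidean_space) \<Rightarrow>
     (nat \<Rightarrow> nat \<Rightarrow> 'w \<Rightarrow> 'a) \<Rightarrow> noise_index \<Rightarrow> 'w set set" where
  "noise_events M H \<xi> \<zeta> (Bern k i) = {H k i -` A \<inter> space M |A. A \<in> sets (count_space UNIV)}"
| "noise_events M H \<xi> \<zeta> (Outer k) = {\<xi> k -` A \<inter> space M |A. A \<in> sets borel}"
| "noise_events M H \<xi> \<zeta> (Inner k i) = {\<zeta> k i -` A \<inter> space M |A. A \<in> sets borel}"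

definition prlmc_noise ::
    "'w measure \<Rightarrow> nat \<Rightarrow> (nat \<Rightarrow> nat \<Rightarrow> 'w \<Rightarrow> bool) \<Rightarrow> (nat \<Rightarrow> 'w \<Rightarrow> 'a::euclidean_space) \<Rightarrow>
     (nat \<Rightarrow> nat \<Rightarrow> 'w \<Rightarrow> 'a) \<Rightarrow> bool" where
  "prlmc_noise M K H \<xi> \<zeta> \<longleftrightarrow>
     prob_space M \<and>
     (\<forall>k. \<forall>i<K. H k i \<in> measurable M (count_space UNIV) \<and>
        distr M (count_space UNIV) (H k i) = measure_pmf (bernoulli_pmf (1 / real K))) \<and>
     (\<forall>k\<ge>1. \<xi> k \<in> borel_measurable M \<and> distr M borel (\<xi> k) = std_gaussian) \<and>
     (\<forall>k. \<forall>i<K. \<zeta> k i \<in> borel_measurable M \<and> distr M borel (\<zeta> k i) = std_gaussian) \<and>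
     prob_space.indep_sets M (noise_events M H \<xi> \<zeta>) (noise_indices K)"

text \<open>The point \<open>\<hat>Y\<close> with indices \<open>k, i\<close>, computed from the current state \<open>y\<close>.\<close>

definition prlmc_mid ::
    "nat \<Rightarrow> ('a::euclidean_space \<Rightarrow> real) \<Rightarrow> (nat \<Rightarrow> real) \<Rightarrow> (nat \<Rightarrow> nat \<Rightarrow> 'w \<Rightarrow> 'a) \<Rightarrow>
     nat \<Rightarrow> nat \<Rightarrow> 'a \<Rightarrow> 'w \<Rightarrow> 'a" where
  "prlmc_mid K U \<gamma> \<zeta> k i y w =
     y - (real i * \<gamma> (Suc k) / real K) *\<^sub>R grad U y
       + sqrt (2 * real i * \<gamma> (Suc k) / real K) *\<^sub>R \<zeta> k i w"

text \<open>\<open>prlmc \<dots> x n\<close> is the state of the scheme at time \<^term>\<open>step_time \<gamma> n\<close>.\<close>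

primrec prlmc ::
    "nat \<Rightarrow> ('a::euclidean_space \<Rightarrow> real) \<Rightarrow> (nat \<Rightarrow> real) \<Rightarrow> (nat \<Rightarrow> nat \<Rightarrow> 'w \<Rightarrow> bool) \<Rightarrow>
     (nat \<Rightarrow> 'w \<Rightarrow> 'a) \<Rightarrow> (nat \<Rightarrow> nat \<Rightarrow> 'w \<Rightarrow> 'a) \<Rightarrow> 'a \<Rightarrow> nat \<Rightarrow> 'w \<Rightarrow> 'a" where
  "prlmc K U \<gamma> H \<xi> \<zeta> x 0 = (\<lambda>w. x)"
| "prlmc K U \<gamma> H \<xi> \<zeta> x (Suc k) = (\<lambda>w.
     let y = prlmc K U \<gamma> H \<xi> \<zeta> x k w in
       y - \<gamma> (Suc k) *\<^sub>R grad U y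
         + \<gamma> (Suc k) *\<^sub>R
             (\<Sum>i<K. of_bool (H k i w) *\<^sub>R (grad U y - grad U (prlmc_mid K U \<gamma> \<zeta> k i y w)))
         + sqrt (2 * \<gamma> (Suc k)) *\<^sub>R \<xi> (Suc k) w)"

end

theory Submission
  imports Defs
begin

text \<open>
  Both the diffusion and the scheme are compared with the Gibbs measure, and the bridge is the Euler
  kernel \<open>x \<mapsto> x - \<eta> F x + sqrt (2 \<eta>) z\<close> with \<open>F\<close> the gradient of \<open>U\<close> and \<open>z\<close> a standard Gaussian
  vector.

  Three facts about this kernel carry the proof. It contracts: strong convexity makes the drift step
  a contraction, so the Lipschitz constant of a function is multiplied by the factor \<open>1 - \<beta> \<eta>\<close> or
  a smaller one, and the same holds for the class of functions with bounded and Lipschitz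
  gradient if the two constants are kept in a fixed ratio (\<open>euler_C11\<close>). It almost preserves the
  Gibbs measure: the joint density of a stationary state and its successor differs from its transpose
  by a factor whose logarithm is the error of the trapezoidal rule plus a term of the same order, so
  for a Lipschitz function the mean under the Gibbs measure changes by \<open>O(\<eta>\<^sup>2)\<close> only
  (\<open>euler_gibbs_invariance_defect\<close>). And it is close to the scheme: one step of the scheme is an Euler
  step plus a correction of size \<open>O(\<eta> sqrt \<eta>)\<close> whose part of that order has mean zero, so the
  expectation of a test function with Lipschitz gradient differs by \<open>O(\<eta>\<^sup>2)\<close>
  (\<open>one_step_weak_error\<close>).

  Together these give a recursion for the distance \<open>\<delta>\<^sub>n\<close> between the law of the scheme and the Gibbs
  measure: with a constant that involves second moments of the scheme,
  \<open>\<delta>\<^sub>n\<^sub>+\<^sub>1 \<le> (1 - \<beta> \<gamma>\<^sub>n\<^sub>+\<^sub>1) \<delta>\<^sub>n + C \<gamma>\<^sub>n\<^sub>+\<^sub>1\<^sup>2\<close>. The condition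
  \<open>2 \<omega> < m\<close> implies that eventually \<open>\<gamma>\<^sub>n \<le> \<gamma>\<^sub>n\<^sub>+\<^sub>1 (1 + m \<gamma>\<^sub>n\<^sub>+\<^sub>1 / 2)\<close>, and since \<open>\<beta>\<close> exceeds \<open>m / 2\<close> a
  multiple of \<open>\<gamma>\<^sub>n\<close> solves the recursion (\<open>gap_long_time\<close>). The multiple involves only the
  potential, the dimension and \<open>K\<close>. The large initial steps leave a term that decays exponentially
  in \<open>t\<^sub>n\<close> and faster than \<open>\<gamma>\<^sub>n\<close>: this is why the constant of the last claim is independent of the
  step sequence from some index on.

  For the diffusion, the Euler scheme with \<open>N\<close> equal steps on \<open>[0, t]\<close> driven by the same Brownian
  path converges pathwise as \<open>N\<close> grows, because the noise is additive. Its total defect of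
  invariance \<open>N O((t / N)\<^sup>2)\<close> tends to zero, which leaves the contraction: the law of \<open>X\<^sub>t\<close>
  approaches the Gibbs measure at the rate \<open>exp (- \<beta> t)\<close> (\<open>langevin_close_to_gibbs\<close>). This is
  again faster than the decay of the steps, and the bound between diffusion and scheme follows from
  the triangle inequality.
\<close>

section \<open>Gaussian and Gibbs integrals\<close>

lemma norm_square_eq_sum_Basis: "(norm (x::'a::euclidean_space))\<^sup>2 = (\<Sum>b\<in>Basis. (x \<bullet> b)\<^sup>2)"
  unfolding power2_norm_eq_inner by (subst euclidean_inner) (simp add: power2_eq_square)

lemma integrable_exp_neg_norm_sq:
  assumes "0 < c"
  shows "integrable lborel (\<lambda>x::'a::euclidean_space. exp (- c * (norm x)\<^sup>2))"
proof (rule integrableI_bounded)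
  define s where "s = 1 / sqrt (2 * c)"
  have s: "s > 0" "2 * s\<^sup>2 = 1 / c" using assms by (auto simp: s_def power_divide)
  have eq: "exp (- c * t\<^sup>2) = sqrt (2 * pi * s\<^sup>2) * normal_density 0 s t" for t
  proof -
    have "- (t - 0)\<^sup>2 / (2 * s\<^sup>2) = - c * t\<^sup>2" using s assms by simp
    then show ?thesis using s unfolding normal_density_def by simp
  qed
  have "integrable lborel (\<lambda>t::real. exp (- c * t\<^sup>2))"
    unfolding eq using s by (intro integrable_mult_right) auto
  then have fin: "(\<integral>\<^sup>+t. ennreal (exp (- c * (t::real)\<^sup>2)) \<partial>lborel) < \<infinity>"
    by (auto simp: integrable_iff_bounded)
  have "(\<integral>\<^sup>+x. ennreal (norm (exp (- c * (norm (x::'a))\<^sup>2))) \<partial>lborel)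
     = (\<integral>\<^sup>+x. (\<Prod>b\<in>Basis. ennreal (exp (- c * ((x::'a) \<bullet> b)\<^sup>2))) \<partial>lborel)"
    by (intro nn_integral_cong)
       (simp add: norm_square_eq_sum_Basis sum_distrib_left sum_negf[symmetric] exp_sum prod_ennreal
          abs_prod)
  also have "\<dots> = (\<Prod>b\<in>(Basis::'a set). (\<integral>\<^sup>+t. ennreal (exp (- c * t\<^sup>2)) \<partial>lborel))"
    by (rule nn_integral_lborel_prod[of "\<lambda>_ t. ennreal (exp (- c * t\<^sup>2))"]) auto
  also have "\<dots> < \<infinity>" using fin by (simp add: power_less_top_ennreal)
  finally show "(\<integral>\<^sup>+x. ennreal (norm (exp (- c * (norm (x::'a))\<^sup>2))) \<partial>lborel) < \<infinity>" .
qed simp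

lemma integrable_norm4_exp_neg_norm_sq:
  assumes c: "0 < c"
  shows "integrable lborel (\<lambda>x::'a::euclidean_space. exp (- c * (norm x)\<^sup>2) * norm x ^ 4)"
proof (rule Bochner_Integration.integrable_bound)
  show "integrable lborel (\<lambda>x::'a. 8 / c\<^sup>2 * exp (- (c/2) * (norm x)\<^sup>2))"
    using c by (intro integrable_mult_right integrable_exp_neg_norm_sq) auto
  have "exp (- c * (norm x)\<^sup>2) * norm x ^ 4 \<le> 8 / c\<^sup>2 * exp (- (c/2) * (norm x)\<^sup>2)" for x :: 'a
  proof -
    define y where "y = (c/2) * (norm x)\<^sup>2"
    have y: "y \<ge> 0" using c by (simp add: y_def)
    have "y\<^sup>2 / 2 \<le> exp y" using exp_lower_Taylor_quadratic[OF y] y by simp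
    then have "exp (- y) * y\<^sup>2 \<le> 2" by (simp add: exp_minus field_simps)
    then have "exp (-y) * (exp (- y) * y\<^sup>2) \<le> exp (-y) * 2" by (intro mult_left_mono) auto
    moreover have "norm x ^ 4 = 4 / c\<^sup>2 * y\<^sup>2" 
    proof -
      have "4 / c\<^sup>2 * y\<^sup>2 = ((norm x)\<^sup>2)\<^sup>2" using c by (simp add: y_def power_mult_distrib power_divide)
      then show ?thesis by (simp flip: power_mult)
    qed
    moreover have "exp (- c * (norm x)\<^sup>2) = exp (-y) * exp (-y)" by (simp add: y_def flip: exp_add)
    moreover have "exp (- (c/2) * (norm x)\<^sup>2) = exp (-y)" by (simp add: y_def)
    ultimately show ?thesis using c
      by (simp add: field_simps)
  qed
  then show "AE x in lborel. norm (exp (- c * (norm x)\<^sup>2) * norm (x::'a) ^ 4)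
      \<le> norm (8 / c\<^sup>2 * exp (- (c/2) * (norm x)\<^sup>2))" by simp
qed simp

lemma one_plus_power4_le:
  assumes t: "0 \<le> (t::real)" shows "(1 + t) ^ 4 \<le> 8 * (1 + t ^ 4)"
proof -
  have sq: "(1 + s)\<^sup>2 \<le> 2 * (1 + s\<^sup>2)" for s :: real
    using zero_le_power2[of "1 - s"] unfolding power2_sum power2_diff by simp
  have four: "s ^ 4 = (s\<^sup>2)\<^sup>2" for s :: real by (simp flip: power_mult)
  have "((1 + t)\<^sup>2)\<^sup>2 \<le> (2 * (1 + t\<^sup>2))\<^sup>2" using sq t by (intro power_mono) auto
  also have "\<dots> \<le> 8 * (1 + (t\<^sup>2)\<^sup>2)" using sq[of "t\<^sup>2"] unfolding power_mult_distrib by simp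
  finally show ?thesis unfolding four .
qed

text \<open>
  The highest power that occurs is the fourth, in the estimate of the defect of invariance of the
  Gibbs measure under one Euler step.
\<close>

lemma (in finite_measure) integrable_growth4:
  fixes f :: "'a \<Rightarrow> 'c::{banach,second_countable_topology}"
    and r :: "'a \<Rightarrow> 'b::euclidean_space"
  assumes [measurable]: "r \<in> borel_measurable M" "f \<in> borel_measurable M"
    and r: "integrable M (\<lambda>x. norm (r x) ^ 4)"
    and f: "\<And>x. x \<in> space M \<Longrightarrow> norm (f x) \<le> C * (1 + norm (r x)) ^ 4"
  shows "integrable M f"
proof (rule Bochner_Integration.integrable_bound)
  show "integrable M (\<lambda>x. \<bar>C\<bar> * (8 * (1 + norm (r x) ^ 4)))"
    using r by auto
  show "AE x in M. norm (f x) \<le> norm (\<bar>C\<bar> * (8 * (1 + norm (r x) ^ 4)))"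
  proof (rule AE_I2)
    fix x assume x: "x \<in> space M"
    have "norm (f x) \<le> \<bar>C\<bar> * (1 + norm (r x)) ^ 4"
      using f[OF x] by (rule order_trans) (auto intro!: mult_right_mono)
    also have "\<dots> \<le> \<bar>C\<bar> * (8 * (1 + norm (r x) ^ 4))"
      by (intro mult_left_mono one_plus_power4_le) auto
    finally show "norm (f x) \<le> norm (\<bar>C\<bar> * (8 * (1 + norm (r x) ^ 4)))" by simp
  qed
qed auto

lemma lipschitz_borel_measurable:
  fixes g :: "'b::metric_space \<Rightarrow> 'c::metric_space"
  assumes "A-lipschitz_on UNIV g"
  shows "g \<in> borel_measurable borel"
  using assms by (intro borel_measurable_continuous_onI lipschitz_on_continuous_on)

lemma (in finite_measure) integrable_lipschitz:
  fixes g :: "'b::euclidean_space \<Rightarrow> 'c::euclidean_space"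
  assumes g: "A-lipschitz_on UNIV g" and V: "integrable M V"
  shows "integrable M (\<lambda>w. g (V w))"
proof (rule Bochner_Integration.integrable_bound)
  show "integrable M (\<lambda>w. norm (g 0) + A * norm (V w))"
    using V by (intro Bochner_Integration.integrable_add) auto
  have "norm (g y) \<le> norm (g 0) + A * norm y" for y
    using lipschitz_onD[OF g, of y 0] norm_triangle_sub[of "g y" "g 0"] by (simp add: dist_norm)
  then show "AE w in M. norm (g (V w)) \<le> norm (norm (g 0) + A * norm (V w))"
    by (intro AE_I2) (auto intro: order_trans[OF _ abs_ge_self])
  show "(\<lambda>w. g (V w)) \<in> borel_measurable M"
    using measurable_compose[OF borel_measurable_integrable[OF V] lipschitz_borel_measurable[OF g]] .
qed

lemma le_one_plus_square: "(t::real) \<le> 1 + t\<^sup>2"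
  using zero_le_power2[of "t - 1/2"] unfolding power2_diff by (simp add: power_divide)

lemma std_gaussian_density_eq_prod:
  "(2 * pi) powr (- real DIM('a) / 2) * exp (- (norm x)\<^sup>2 / 2)
     = (\<Prod>b\<in>Basis. std_normal_density ((x::'a::euclidean_space) \<bullet> b))"
proof -
  have "(\<Prod>b\<in>Basis. std_normal_density (x \<bullet> b))
     = (1 / sqrt (2 * pi)) ^ DIM('a) * (\<Prod>b\<in>Basis. exp (- (x \<bullet> b)\<^sup>2 / 2))"
    unfolding std_normal_density_def by (simp only: prod.distrib prod_constant)
  also have "(\<Prod>b\<in>Basis. exp (- (x \<bullet> b)\<^sup>2 / 2)) = exp (- (norm x)\<^sup>2 / 2)"
    by (simp add: norm_square_eq_sum_Basis sum_negf[symmetric] sum_divide_distrib flip: exp_sum)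
  also have "(1 / sqrt (2 * pi)) = (2 * pi) powr (- 1/2)"
    by (simp add: powr_minus powr_half_sqrt[symmetric] field_simps)
  also have "((2 * pi) powr (- 1/2)) ^ DIM('a) = (2 * pi) powr (- real DIM('a) / 2)"
    by (simp add: powr_power)
  finally show ?thesis by simp
qed

lemma std_gaussian_eq_density_prod:
  "(std_gaussian :: 'a::euclidean_space measure)
     = density lborel (\<lambda>x. \<Prod>b\<in>Basis. ennreal (std_normal_density (x \<bullet> b)))"
  unfolding std_gaussian_def std_gaussian_density_eq_prod by (simp add: prod_ennreal)

lemma sets_std_gaussian [simp, measurable_cong]: "sets std_gaussian = sets borel"
  and space_std_gaussian [simp]: "space std_gaussian = UNIV"
  by (simp_all add: std_gaussian_def)

lemma prob_space_std_gaussian: "prob_space (std_gaussian :: 'a::euclidean_space measure)"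
proof
  have one: "(\<integral>\<^sup>+t. ennreal (std_normal_density t) \<partial>lborel) = 1"
    by (subst nn_integral_eq_integral) auto
  have "emeasure (std_gaussian :: 'a measure) (space std_gaussian)
     = (\<integral>\<^sup>+x. (\<Prod>b\<in>Basis. ennreal (std_normal_density ((x::'a) \<bullet> b))) \<partial>lborel)"
    by (simp add: std_gaussian_eq_density_prod emeasure_density)
  also have "\<dots> = (\<Prod>b\<in>(Basis::'a set). (\<integral>\<^sup>+t. ennreal (std_normal_density t) \<partial>lborel))"
    by (rule nn_integral_lborel_prod[of "\<lambda>_ t. ennreal (std_normal_density t)"]) auto
  finally show "emeasure (std_gaussian :: 'a measure) (space std_gaussian) = 1" by (simp add: one)
qed

global_interpretation std_gaussian: prob_space "std_gaussian :: 'a::euclidean_space measure"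
  by (rule prob_space_std_gaussian)

lemma measure_std_gaussian_UNIV [simp]: "measure (std_gaussian :: 'a::euclidean_space measure) UNIV = 1"
  using std_gaussian.prob_space by simp

lemma std_gaussian_norm4: "integrable (std_gaussian :: 'a::euclidean_space measure) (\<lambda>z. norm z ^ 4)"
proof -
  let ?c = "(2 * pi) powr (- real DIM('a) / 2)"
  have "integrable lborel (\<lambda>z::'a. ?c * (exp (- (1/2) * (norm z)\<^sup>2) * norm z ^ 4))"
    by (intro integrable_mult_right integrable_norm4_exp_neg_norm_sq) simp
  moreover have "?c * (exp (- (1/2) * (norm z)\<^sup>2) * norm z ^ 4)
      = (?c * exp (- (norm z)\<^sup>2 / 2)) *\<^sub>R (norm z ^ 4)" for z :: 'a
    by simp
  ultimately have "integrable lborel (\<lambda>z::'a. (?c * exp (- (norm z)\<^sup>2 / 2)) *\<^sub>R (norm z ^ 4))"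
    by (simp only:)
  then show ?thesis
    unfolding std_gaussian_def by (rule iffD2[OF integrable_density, rotated -1]) simp_all
qed

lemma std_gaussian_integrable_growth4:
  fixes f :: "'a::euclidean_space \<Rightarrow> 'c::{banach,second_countable_topology}"
  assumes "f \<in> borel_measurable borel" "\<And>z. norm (f z) \<le> C * (1 + norm z) ^ 4"
  shows "integrable std_gaussian f"
proof (rule std_gaussian.integrable_growth4[where r="\<lambda>z. z" and C=C])
  show "f \<in> borel_measurable std_gaussian" using assms(1) by simp
qed (use assms(2) in \<open>simp_all add: std_gaussian_norm4\<close>)

lemma lborel_distr_uminus_euclidean:
  "distr lborel borel (uminus :: 'a::euclidean_space \<Rightarrow> 'a) = lborel"
  using lborel_affine[of "-1" "0::'a"] by (simp add: density_1 one_ennreal_def[symmetric])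

lemma std_gaussian_mean: "(\<integral>z. z \<partial>(std_gaussian :: 'a::euclidean_space measure)) = 0"
proof -
  let ?g = "\<lambda>x::'a. (2 * pi) powr (- real DIM('a) / 2) * exp (- (norm x)\<^sup>2 / 2)"
  have "(\<integral>z. z \<partial>(std_gaussian :: 'a measure)) = (\<integral>z. ?g z *\<^sub>R z \<partial>lborel)"
    unfolding std_gaussian_def by (subst integral_density) auto
  also have "\<dots> = (\<integral>z. ?g z *\<^sub>R z \<partial>distr lborel borel uminus)"
    by (simp add: lborel_distr_uminus_euclidean)
  also have "\<dots> = - (\<integral>z. ?g z *\<^sub>R z \<partial>lborel)"
    by (subst integral_distr) auto
  also have "(\<integral>z. ?g z *\<^sub>R z \<partial>lborel) = (\<integral>z. z \<partial>(std_gaussian :: 'a measure))"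
    unfolding std_gaussian_def by (subst integral_density) auto
  finally have "(\<integral>z. z \<partial>(std_gaussian :: 'a measure)) = - (\<integral>z. z \<partial>std_gaussian)" .
  then show ?thesis by (simp add: eq_neg_iff_add_eq_0 flip: scaleR_2)
qed

lemma std_gaussian_integrable_norm2: "integrable (std_gaussian :: 'a::euclidean_space measure) (\<lambda>z. (norm z)\<^sup>2)"
  and std_gaussian_integrable_id: "integrable (std_gaussian :: 'a::euclidean_space measure) (\<lambda>z. z)"
proof -
  have 1: "norm z \<le> (1 + norm z) ^ 4" for z :: 'a
    using power_increasing[of 1 4 "1 + norm z"] by simp
  have 2: "(norm z)\<^sup>2 \<le> (1 + norm z) ^ 4" for z :: 'a
    by (rule order_trans[OF power_mono[of "norm z" "1 + norm z" 2] power_increasing[of 2 4 "1 + norm z"]]) auto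
  show "integrable (std_gaussian :: 'a measure) (\<lambda>z. z)"
    by (rule std_gaussian_integrable_growth4[where C=1]) (use 1 in auto)
  show "integrable (std_gaussian :: 'a measure) (\<lambda>z. (norm z)\<^sup>2)"
    by (rule std_gaussian_integrable_growth4[where C=1]) (use 2 in auto)
qed

text \<open>The density of \<open>c\<close> times a standard Gaussian vector.\<close>

definition gauss_kernel :: "real \<Rightarrow> 'a::euclidean_space \<Rightarrow> real" where
  "gauss_kernel c u = (2 * pi) powr (- real DIM('a) / 2) / c ^ DIM('a) * exp (- (norm u)\<^sup>2 / (2 * c\<^sup>2))"

lemma gauss_kernel_pos: "0 < c \<Longrightarrow> 0 < gauss_kernel c u"
  by (simp add: gauss_kernel_def)

lemma gauss_kernel_measurable [measurable]: "gauss_kernel c \<in> borel_measurable borel"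
  unfolding gauss_kernel_def by measurable

lemma nn_integral_std_gaussian_affine:
  fixes t :: "'a::euclidean_space"
  assumes c: "0 < c" and [measurable]: "f \<in> borel_measurable borel"
  shows "(\<integral>\<^sup>+z. f (t + c *\<^sub>R z) \<partial>std_gaussian) = (\<integral>\<^sup>+y. ennreal (gauss_kernel c (y - t)) * f y \<partial>lborel)"
proof -
  let ?g = "\<lambda>x::'a. (2 * pi) powr (- real DIM('a) / 2) * exp (- (norm x)\<^sup>2 / 2)"
  have eq: "ennreal \<bar>c\<bar> ^ DIM('a) * ennreal (gauss_kernel c (c *\<^sub>R z)) = ennreal (?g z)" for z :: 'a
    using c by (simp add: gauss_kernel_def power_mult_distrib ennreal_power flip: ennreal_mult)
  have "(\<integral>\<^sup>+y. ennreal (gauss_kernel c (y - t)) * f y \<partial>lborel)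
     = (\<integral>\<^sup>+y. ennreal (gauss_kernel c (y - t)) * f y \<partial>density (distr lborel borel (\<lambda>x. t + c *\<^sub>R x)) (\<lambda>_. \<bar>c\<bar>^DIM('a)))"
    using lborel_affine[of c t] c by simp
  also have "\<dots> = (\<integral>\<^sup>+z. ennreal \<bar>c\<bar> ^ DIM('a) * (ennreal (gauss_kernel c (c *\<^sub>R z)) * f (t + c *\<^sub>R z)) \<partial>lborel)"
    by (subst nn_integral_density, simp, simp, subst nn_integral_distr) (auto simp: ennreal_power)
  also have "\<dots> = (\<integral>\<^sup>+z. ennreal (?g z) * f (t + c *\<^sub>R z) \<partial>lborel)"
    by (simp only: mult.assoc[symmetric] eq)
  also have "\<dots> = (\<integral>\<^sup>+z. f (t + c *\<^sub>R z) \<partial>std_gaussian)"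
    unfolding std_gaussian_def by (subst nn_integral_density) auto
  finally show ?thesis by simp
qed


section \<open>Functions with bounded and Lipschitz gradient\<close>

text \<open>
  The class of test functions on which the errors are propagated. A Lipschitz constant of the
  gradient takes the place of a bound on the Hessian, so that membership can be derived from
  inequalities between finite increments, which survive taking expectations.
\<close>

definition C11 :: "real \<Rightarrow> real \<Rightarrow> ('a::real_inner \<Rightarrow> real) \<Rightarrow> bool" where
  "C11 A C g \<longleftrightarrow> (\<exists>G. (\<forall>x. GDERIV g x :> G x) \<and> (\<forall>x. norm (G x) \<le> A) \<and> C-lipschitz_on UNIV G)"

lemma norm_le_of_inner:
  fixes D :: "'a::real_inner"
  assumes "0 \<le> B" "\<And>v. D \<bullet> v \<le> B * norm v"
  shows "norm D \<le> B"
proof (cases "D = 0")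
  case True
  then show ?thesis using assms(1) by simp
next
  case False
  then show ?thesis using assms(2)[of D] by (simp add: dot_square_norm power2_eq_square)
qed

lemma GDERIV_along_line:
  assumes "\<And>z. GDERIV g z :> G z"
  shows "((\<lambda>s. g (x + s *\<^sub>R v)) has_real_derivative G (x + s *\<^sub>R v) \<bullet> v) (at s)"
proof -
  have "((\<lambda>s. x + s *\<^sub>R v) has_derivative (\<lambda>h. h *\<^sub>R v)) (at s)"
    by (auto intro!: derivative_eq_intros)
  moreover have "(g has_derivative (\<lambda>h. h \<bullet> G (x + s *\<^sub>R v))) (at (x + s *\<^sub>R v))"
    using assms[of "x + s *\<^sub>R v"] unfolding gderiv_def .
  ultimately have "((\<lambda>s. g (x + s *\<^sub>R v)) has_derivative (\<lambda>h. (h *\<^sub>R v) \<bullet> G (x + s *\<^sub>R v))) (at s)"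
    by (rule has_derivative_compose)
  then show ?thesis
    unfolding has_field_derivative_def
    by (rule has_derivative_eq_rhs) (auto simp: inner_commute)
qed

lemma GDERIV_mean_value:
  assumes "\<And>z. GDERIV g z :> G z"
  obtains s where "0 < s" "s < 1" "g y - g x = G (x + s *\<^sub>R (y - x)) \<bullet> (y - x)"
proof -
  obtain s :: real where "0 < s" "s < 1"
    "g (x + 1 *\<^sub>R (y - x)) - g (x + 0 *\<^sub>R (y - x)) = (1 - 0) * (G (x + s *\<^sub>R (y - x)) \<bullet> (y - x))"
    using MVT2[of 0 1 "\<lambda>s. g (x + s *\<^sub>R (y - x))" "\<lambda>s. G (x + s *\<^sub>R (y - x)) \<bullet> (y - x)"]
      GDERIV_along_line[of g G, OF assms] by auto
  then show ?thesis by (intro that[of s]) auto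
qed

lemma C11_lipschitz:
  assumes "C11 A C g"
  shows "A-lipschitz_on UNIV g"
proof -
  obtain G where G: "\<And>z. GDERIV g z :> G z" "\<And>x. norm (G x) \<le> A"
    using assms by (auto simp: C11_def)
  show ?thesis
  proof (rule lipschitz_onI)
    show "0 \<le> A" using order_trans[OF norm_ge_zero G(2)] .
    show "dist (g x) (g y) \<le> A * dist x y" for x y
    proof -
      obtain s where "g x - g y = G (y + s *\<^sub>R (x - y)) \<bullet> (x - y)"
        using GDERIV_mean_value[OF G(1)] by blast
      then have "\<bar>g x - g y\<bar> \<le> norm (G (y + s *\<^sub>R (x - y))) * norm (x - y)"
        by (simp add: Cauchy_Schwarz_ineq2)
      also have "\<dots> \<le> A * norm (x - y)" by (intro mult_right_mono G) auto
      finally show ?thesis by (simp add: dist_norm)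
    qed
  qed
qed

lemma lipschitz_gradient_taylor:
  assumes G: "\<And>z. GDERIV g z :> G z" and lip: "C-lipschitz_on UNIV G"
  shows "\<bar>g y - g x - G x \<bullet> (y - x)\<bar> \<le> C * (norm (y - x))\<^sup>2"
proof -
  obtain s where s: "0 < s" "s < 1" "g y - g x = G (x + s *\<^sub>R (y - x)) \<bullet> (y - x)"
    using GDERIV_mean_value[OF G] by blast
  have C: "0 \<le> C" using lip lipschitz_on_nonneg by blast
  have "norm (G (x + s *\<^sub>R (y - x)) - G x) \<le> C * norm (s *\<^sub>R (y - x))"
    using lipschitz_onD[OF lip, of "x + s *\<^sub>R (y - x)" x] by (simp add: dist_norm)
  also have "\<dots> \<le> C * norm (y - x)"
    using s C by (intro mult_left_mono) (auto intro: mult_left_le_one_le)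
  finally have "norm (G (x + s *\<^sub>R (y - x)) - G x) * norm (y - x) \<le> C * norm (y - x) * norm (y - x)"
    by (intro mult_right_mono) auto
  moreover have "\<bar>g y - g x - G x \<bullet> (y - x)\<bar> \<le> norm (G (x + s *\<^sub>R (y - x)) - G x) * norm (y - x)"
    using Cauchy_Schwarz_ineq2[of "G (x + s *\<^sub>R (y - x)) - G x" "y - x"] s(3)
    by (simp add: inner_diff_left)
  ultimately show ?thesis by (simp add: power2_eq_square mult.assoc)
qed

text \<open>
  This replaces differentiation under the expectation: a bound with a fixed constant is preserved
  by averaging.
\<close>

lemma GDERIV_of_quadratic_bound:
  assumes B: "\<And>y. \<bar>g y - g x - D \<bullet> (y - x)\<bar> \<le> B * (norm (y - x))\<^sup>2"
  shows "GDERIV g x :> D"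
  unfolding gderiv_def has_derivative_at_within
proof (intro conjI)
  show "bounded_linear (\<lambda>h. h \<bullet> D)" by (rule bounded_linear_inner_left)
  show "((\<lambda>y. (g y - g x - (y - x) \<bullet> D) /\<^sub>R norm (y - x)) \<longlongrightarrow> 0) (at x)"
  proof (rule Lim_null_comparison)
    have "norm ((g y - g x - (y - x) \<bullet> D) /\<^sub>R norm (y - x)) \<le> B * norm (y - x)" for y
      using B[of y] by (cases "y = x") (auto simp: field_simps power2_eq_square inner_commute)
    then show "\<forall>\<^sub>F y in at x. norm ((g y - g x - (y - x) \<bullet> D) /\<^sub>R norm (y - x)) \<le> B * norm (y - x)"
      by simp
    have "((\<lambda>y. B * norm (y - x)) \<longlongrightarrow> B * norm (x - x)) (at x)"
      by (intro tendsto_intros)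
    then show "((\<lambda>y. B * norm (y - x)) \<longlongrightarrow> 0) (at x)" by simp
  qed
qed

section \<open>Strongly convex potentials\<close>

text \<open>
  The derivative of the gradient is a parameter acting on vectors, so that the estimates below
  involve norms of vectors only. The constant \<open>\<Lambda>\<close> is a Lipschitz constant of the gradient, which
  for a potential with quadratic upper bound \<open>L\<close> will be \<open>2 * L\<close>.
\<close>

locale strongly_convex_potential =
  fixes U :: "'a::euclidean_space \<Rightarrow> real" and F :: "'a \<Rightarrow> 'a" and DF :: "'a \<Rightarrow> 'a \<Rightarrow> 'a"
    and m \<Lambda> \<Lambda>' :: real
  assumes m_pos: "0 < m" and m_le: "m \<le> \<Lambda>" and \<Lambda>'_nonneg: "0 \<le> \<Lambda>'"
    and U_gradient: "GDERIV U x :> F x"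
    and F_zero: "F 0 = 0"
    and F_lip: "norm (F x - F y) \<le> \<Lambda> * norm (x - y)"
    and F_mono: "m * (norm (x - y))\<^sup>2 \<le> (F x - F y) \<bullet> (x - y)"
    and F_deriv: "(F has_derivative DF x) (at x)"
    and DF_lip: "norm (DF x v - DF y v) \<le> \<Lambda>' * norm (x - y) * norm v"
    and U_growth: "U 0 + m / 2 * (norm x)\<^sup>2 \<le> U x"
begin

lemma \<Lambda>_pos: "0 < \<Lambda>" using m_pos m_le by simp

lemma F_bound: "norm (F x) \<le> \<Lambda> * norm x"
  using F_lip[of x 0] by (simp add: F_zero)

lemma F_lipschitz: "\<Lambda>-lipschitz_on UNIV F"
  using F_lip \<Lambda>_pos by (auto intro!: lipschitz_onI simp: dist_norm)

lemma F_continuous: "continuous_on UNIV F"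
  using F_lipschitz by (rule lipschitz_on_continuous_on)

lemma F_measurable [measurable]: "F \<in> borel_measurable borel"
  using F_continuous by (rule borel_measurable_continuous_onI)

lemma U_measurable [measurable]: "U \<in> borel_measurable borel"
proof (rule borel_measurable_continuous_onI)
  show "continuous_on UNIV U"
    using U_gradient unfolding gderiv_def
    by (meson continuous_at_imp_continuous_on has_derivative_continuous)
qed

lemma DF_linear: "linear (DF x)"
  using F_deriv has_derivative_linear by blast

lemma DF_directional: "((\<lambda>s. (F (x + s *\<^sub>R v) - F x) /\<^sub>R s) \<longlongrightarrow> DF x v) (at_right 0)"
proof -
  have "((\<lambda>s. x + s *\<^sub>R v) has_derivative (\<lambda>h. h *\<^sub>R v)) (at (0::real))"
    by (auto intro!: derivative_eq_intros)
  moreover have "(F has_derivative DF x) (at (x + 0 *\<^sub>R v))" using F_deriv by simp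
  ultimately have "((\<lambda>s. F (x + s *\<^sub>R v)) has_derivative (\<lambda>h. DF x (h *\<^sub>R v))) (at (0::real))"
    by (rule has_derivative_compose)
  then have "((\<lambda>s. F (x + s *\<^sub>R v)) has_vector_derivative DF x v) (at (0::real))"
    by (simp add: has_vector_derivative_def linear_cmul[OF DF_linear])
  then have "((\<lambda>s. (F (x + s *\<^sub>R v) - F x) /\<^sub>R s) \<longlongrightarrow> DF x v) (at 0)"
  proof -
    assume d: "((\<lambda>s. F (x + s *\<^sub>R v)) has_vector_derivative DF x v) (at 0)"
    have "norm ((F (x + s *\<^sub>R v) - F x) /\<^sub>R s - DF x v)
        = norm ((F (x + s *\<^sub>R v) - F x - s *\<^sub>R DF x v) /\<^sub>R \<bar>s\<bar>)" if "s \<noteq> 0" for s :: real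
    proof -
      have "(F (x + s *\<^sub>R v) - F x) /\<^sub>R s - DF x v = (F (x + s *\<^sub>R v) - F x - s *\<^sub>R DF x v) /\<^sub>R s"
        using that by (simp add: scaleR_diff_right)
      then show ?thesis by simp
    qed
    then have ev: "\<forall>\<^sub>F s in at 0. norm ((F (x + s *\<^sub>R v) - F x - s *\<^sub>R DF x v) /\<^sub>R \<bar>s\<bar>)
        = norm ((F (x + s *\<^sub>R v) - F x) /\<^sub>R s - DF x v)"
      by (auto simp: eventually_at_filter)
    have "((\<lambda>s. (F (x + s *\<^sub>R v) - F x - s *\<^sub>R DF x v) /\<^sub>R \<bar>s\<bar>) \<longlongrightarrow> 0) (at 0)"
      using d by (simp add: has_vector_derivative_def has_derivative_at_within)
    from tendsto_norm_zero[OF this] have "((\<lambda>s. norm ((F (x + s *\<^sub>R v) - F x) /\<^sub>R s - DF x v)) \<longlongrightarrow> 0) (at 0)"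
      using tendsto_cong[OF ev] by blast
    then show ?thesis using LIM_zero_cancel tendsto_norm_zero_iff by blast
  qed
  then show ?thesis by (rule tendsto_within_subset) auto
qed

lemma DF_bound: "norm (DF x v) \<le> \<Lambda> * norm v"
proof (rule tendsto_upperbound[OF tendsto_norm[OF DF_directional]])
  have "norm ((F (x + s *\<^sub>R v) - F x) /\<^sub>R s) \<le> \<Lambda> * norm v" if "s > 0" for s
  proof -
    have "norm (F (x + s *\<^sub>R v) - F x) / s \<le> \<Lambda> * norm v"
      using F_lip[of "x + s *\<^sub>R v" x] that by (simp add: pos_divide_le_eq mult_ac)
    then show ?thesis using that by (simp add: divide_inverse mult.commute)
  qed
  then show "\<forall>\<^sub>F s in at_right 0. norm ((F (x + s *\<^sub>R v) - F x) /\<^sub>R s) \<le> \<Lambda> * norm v"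
    by (auto simp: eventually_at_filter)
qed simp

lemma DF_coercive: "m * (norm v)\<^sup>2 \<le> DF x v \<bullet> v"
proof (rule tendsto_lowerbound[OF tendsto_inner[OF DF_directional tendsto_const]])
  have "m * (norm v)\<^sup>2 \<le> ((F (x + s *\<^sub>R v) - F x) /\<^sub>R s) \<bullet> v" if "s > 0" for s
  proof -
    have "s * (m * (norm v)\<^sup>2) \<le> (F (x + s *\<^sub>R v) - F x) \<bullet> v"
      using F_mono[of "x + s *\<^sub>R v" x] that by (simp add: power2_eq_square mult_ac)
    then have "m * (norm v)\<^sup>2 \<le> (F (x + s *\<^sub>R v) - F x) \<bullet> v / s"
      using that by (simp add: pos_le_divide_eq mult.commute)
    then show ?thesis by (simp add: divide_inverse mult.commute)
  qed
  then show "\<forall>\<^sub>F s in at_right 0. m * (norm v)\<^sup>2 \<le> ((F (x + s *\<^sub>R v) - F x) /\<^sub>R s) \<bullet> v"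
    by (auto simp: eventually_at_filter)
qed simp

lemma F_taylor: "norm (F y - F x - DF x (y - x)) \<le> \<Lambda>' * (norm (y - x))\<^sup>2"
proof -
  have "norm ((F y - DF x y) - (F x - DF x x)) \<le> (\<Lambda>' * norm (y - x)) * norm (y - x)"
  proof (rule differentiable_bound[of "cball x (norm (y - x))" _ "\<lambda>z v. DF z v - DF x v"])
    show "((\<lambda>z. F z - DF x z) has_derivative (\<lambda>v. DF z v - DF x v)) (at z within cball x (norm (y - x)))" for z
      by (intro has_derivative_diff has_derivative_at_withinI[OF F_deriv]
          bounded_linear_imp_has_derivative has_derivative_bounded_linear[OF F_deriv])
    show "onorm (\<lambda>v. DF z v - DF x v) \<le> \<Lambda>' * norm (y - x)" if "z \<in> cball x (norm (y - x))" for z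
    proof (rule onorm_le)
      fix v
      have "norm (DF z v - DF x v) \<le> \<Lambda>' * norm (z - x) * norm v" by (rule DF_lip)
      also have "\<dots> \<le> \<Lambda>' * norm (y - x) * norm v"
        using that \<Lambda>'_nonneg by (intro mult_right_mono mult_left_mono) (auto simp: dist_norm norm_minus_commute)
      finally show "norm (DF z v - DF x v) \<le> \<Lambda>' * norm (y - x) * norm v" .
    qed
  qed (auto simp: dist_norm norm_minus_commute)
  then show ?thesis by (simp add: linear_diff[OF DF_linear] power2_eq_square algebra_simps)
qed

text \<open>
  The trapezoidal rule along a segment is exact up to third order; this is where the third
  derivative of the potential enters the estimate of the invariance defect of the Gibbs measure.
\<close>

lemma trapezoidal_rule:
  "\<bar>U y - U x - (F x + F y) \<bullet> (y - x) / 2\<bar> \<le> 2 * \<Lambda>' * norm (y - x) ^ 3"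
proof -
  define v where "v = y - x"
  define \<phi> where "\<phi> s = U (x + s *\<^sub>R v) - s * (F x \<bullet> v) - s\<^sup>2 / 2 * (DF x v \<bullet> v)" for s
  have "(\<phi> has_real_derivative (F (x + s *\<^sub>R v) - F x - DF x (s *\<^sub>R v)) \<bullet> v) (at s)" for s
    unfolding \<phi>_def
    by (rule derivative_eq_intros GDERIV_along_line[OF U_gradient] refl)+
       (auto simp: linear_cmul[OF DF_linear] inner_diff_left)
  then obtain s :: real where s: "0 < s" "s < 1"
    "\<phi> 1 - \<phi> 0 = (1 - 0) * ((F (x + s *\<^sub>R v) - F x - DF x (s *\<^sub>R v)) \<bullet> v)"
    using MVT2[of 0 1 \<phi> "\<lambda>s. (F (x + s *\<^sub>R v) - F x - DF x (s *\<^sub>R v)) \<bullet> v"] by auto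
  have "norm (F (x + s *\<^sub>R v) - F x - DF x (s *\<^sub>R v)) \<le> \<Lambda>' * (norm (s *\<^sub>R v))\<^sup>2"
    using F_taylor[of "x + s *\<^sub>R v" x] by simp
  also have "\<dots> \<le> \<Lambda>' * (norm v)\<^sup>2"
    using s \<Lambda>'_nonneg by (intro mult_left_mono power_mono) (auto intro: mult_left_le_one_le)
  finally have "norm (F (x + s *\<^sub>R v) - F x - DF x (s *\<^sub>R v)) * norm v \<le> \<Lambda>' * (norm v)\<^sup>2 * norm v"
    by (rule mult_right_mono) simp
  then have 1: "\<bar>\<phi> 1 - \<phi> 0\<bar> \<le> \<Lambda>' * norm v ^ 3"
    using Cauchy_Schwarz_ineq2[of "F (x + s *\<^sub>R v) - F x - DF x (s *\<^sub>R v)" v] s(3)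
    by (simp add: power2_eq_square power3_eq_cube mult.assoc)
  have "norm (F y - F x - DF x v) * norm v \<le> \<Lambda>' * (norm v)\<^sup>2 * norm v"
    using F_taylor[of y x] by (intro mult_right_mono) (auto simp: v_def)
  then have 2: "\<bar>(F y - F x - DF x v) \<bullet> v\<bar> \<le> \<Lambda>' * norm v ^ 3"
    using Cauchy_Schwarz_ineq2[of "F y - F x - DF x v" v]
    by (simp add: power2_eq_square power3_eq_cube mult.assoc)
  have "U y - U x - (F x + F y) \<bullet> v / 2 = (\<phi> 1 - \<phi> 0) - ((F y - F x - DF x v) \<bullet> v) / 2"
    by (simp add: \<phi>_def v_def inner_diff_left inner_add_left field_simps)
  then show ?thesis using 1 2 by (simp add: v_def[symmetric])
qed

text \<open>
  The rate \<open>\<beta>\<close> is smaller than \<open>m\<close> in order to absorb the term quadratic in the step, and larger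
  than \<open>m / 2\<close>, the bound on the decay rate of the steps.
\<close>

definition \<beta> :: real where "\<beta> = 3 / 4 * m"
definition \<eta>\<^sub>0 :: real where "\<eta>\<^sub>0 = min 1 (m / (2 * \<Lambda>\<^sup>2))"

lemma \<beta>_pos: "0 < \<beta>" using m_pos by (simp add: \<beta>_def)
lemma \<eta>\<^sub>0_pos: "0 < \<eta>\<^sub>0" using m_pos \<Lambda>_pos by (simp add: \<eta>\<^sub>0_def)
lemma \<eta>\<^sub>0_le_1: "\<eta>\<^sub>0 \<le> 1" by (simp add: \<eta>\<^sub>0_def)

lemma \<beta>_\<eta>: assumes "\<eta> \<le> \<eta>\<^sub>0" shows "\<beta> * \<eta> \<le> 1/2"
proof -
  have "\<eta> \<le> m / (2 * \<Lambda>\<^sup>2)" using assms by (simp add: \<eta>\<^sub>0_def)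
  also have "\<dots> \<le> m / (2 * m\<^sup>2)" using m_pos m_le by (intro divide_left_mono mult_left_mono power_mono) auto
  finally have "\<beta> * \<eta> \<le> \<beta> * (m / (2 * m\<^sup>2))" using \<beta>_pos by (intro mult_left_mono) auto
  also have "\<dots> = 3/8" using m_pos by (simp add: \<beta>_def power2_eq_square)
  finally show ?thesis by simp
qed

text \<open>
  Applied to increments of the gradient and to its derivative, this gives the contraction of the
  drift step and of its linearisation with the same factor. Expanding the square produces a
  term of second order in \<open>\<eta>\<close>; the bound on \<open>\<eta>\<close> lets it consume a quarter of the rate.
\<close>

lemma contraction_of_coercive:
  assumes \<eta>: "0 \<le> \<eta>" "\<eta> \<le> \<eta>\<^sub>0" and w: "norm w \<le> \<Lambda> * norm v" "m * (norm v)\<^sup>2 \<le> w \<bullet> v"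
  shows "norm (v - \<eta> *\<^sub>R w) \<le> (1 - \<beta> * \<eta>) * norm v"
proof (rule power2_le_imp_le)
  have "\<eta> * \<Lambda>\<^sup>2 \<le> m / (2 * \<Lambda>\<^sup>2) * \<Lambda>\<^sup>2" using \<eta> by (intro mult_right_mono) (auto simp: \<eta>\<^sub>0_def)
  also have "\<dots> = m / 2" using \<Lambda>_pos by simp
  finally have e: "\<eta> * (\<eta> * \<Lambda>\<^sup>2) \<le> \<eta> * (m / 2)" using \<eta> by (intro mult_left_mono)
  have "(norm (v - \<eta> *\<^sub>R w))\<^sup>2 = (norm v)\<^sup>2 - 2 * \<eta> * (w \<bullet> v) + \<eta>\<^sup>2 * (norm w)\<^sup>2"
    unfolding power2_norm_eq_inner
    by (simp add: inner_diff_left inner_diff_right inner_commute power2_eq_square algebra_simps)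
  also have "\<dots> \<le> (norm v)\<^sup>2 - 2 * \<eta> * (m * (norm v)\<^sup>2) + \<eta>\<^sup>2 * (\<Lambda> * norm v)\<^sup>2"
    using \<eta> w by (intro add_mono diff_mono mult_left_mono power_mono) auto
  also have "\<dots> = (1 - 2 * \<eta> * m + \<eta> * (\<eta> * \<Lambda>\<^sup>2)) * (norm v)\<^sup>2"
    by (simp add: power_mult_distrib power2_eq_square algebra_simps)
  also have "\<dots> \<le> (1 - \<beta> * \<eta>)\<^sup>2 * (norm v)\<^sup>2"
  proof (rule mult_right_mono)
    have "\<beta> * \<eta> = 3 / 4 * (\<eta> * m)" "(1 - \<beta> * \<eta>)\<^sup>2 = 1 - 2 * (\<beta> * \<eta>) + (\<beta> * \<eta>)\<^sup>2"
      by (auto simp: \<beta>_def power2_diff)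
    moreover have "\<eta> * (\<eta> * \<Lambda>\<^sup>2) \<le> \<eta> * m / 2" using e by simp
    ultimately show "1 - 2 * \<eta> * m + \<eta> * (\<eta> * \<Lambda>\<^sup>2) \<le> (1 - \<beta> * \<eta>)\<^sup>2"
      using zero_le_power2[of "\<beta> * \<eta>"] by linarith
  qed simp
  finally show "(norm (v - \<eta> *\<^sub>R w))\<^sup>2 \<le> ((1 - \<beta> * \<eta>) * norm v)\<^sup>2"
    by (simp add: power_mult_distrib)
  show "0 \<le> (1 - \<beta> * \<eta>) * norm v" using \<beta>_\<eta>[OF \<eta>(2)] by simp
qed

lemma gradient_step_contraction:
  assumes "0 \<le> \<eta>" "\<eta> \<le> \<eta>\<^sub>0"
  shows "norm ((x - \<eta> *\<^sub>R F x) - (y - \<eta> *\<^sub>R F y)) \<le> (1 - \<beta> * \<eta>) * norm (x - y)"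
  using contraction_of_coercive[OF assms F_lip F_mono, of x y] by (simp add: algebra_simps)

lemma linearised_step_contraction:
  assumes "0 \<le> \<eta>" "\<eta> \<le> \<eta>\<^sub>0"
  shows "norm (v - \<eta> *\<^sub>R DF x v) \<le> (1 - \<beta> * \<eta>) * norm v"
  using contraction_of_coercive[OF assms DF_bound DF_coercive] .

end


lemma std_gaussian_integrable_lipschitz_affine:
  fixes g :: "'a::euclidean_space \<Rightarrow> 'b::euclidean_space"
  assumes g: "A-lipschitz_on UNIV g"
  shows "integrable std_gaussian (\<lambda>z. g (t + s *\<^sub>R z))"
  by (intro std_gaussian.integrable_lipschitz[OF g] Bochner_Integration.integrable_add
      integrable_scaleR_right std_gaussian_integrable_id) simp

context strongly_convex_potential
begin

section \<open>The Euler kernel\<close>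

definition euler :: "real \<Rightarrow> ('a \<Rightarrow> real) \<Rightarrow> 'a \<Rightarrow> real" where
  "euler \<eta> g x = (\<integral>z. g (x - \<eta> *\<^sub>R F x + sqrt (2 * \<eta>) *\<^sub>R z) \<partial>std_gaussian)"

lemma euler_lipschitz:
  assumes g: "A-lipschitz_on UNIV g" and \<eta>: "0 \<le> \<eta>" "\<eta> \<le> \<eta>\<^sub>0"
  shows "((1 - \<beta> * \<eta>) * A)-lipschitz_on UNIV (euler \<eta> g)"
proof (rule lipschitz_onI)
  have A: "0 \<le> A" using g lipschitz_on_nonneg by blast
  show "0 \<le> (1 - \<beta> * \<eta>) * A" using A \<beta>_\<eta>[OF \<eta>(2)] by simp
  fix x y
  have "\<bar>euler \<eta> g x - euler \<eta> g y\<bar>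
      = \<bar>\<integral>z. g (x - \<eta> *\<^sub>R F x + sqrt (2 * \<eta>) *\<^sub>R z) - g (y - \<eta> *\<^sub>R F y + sqrt (2 * \<eta>) *\<^sub>R z) \<partial>std_gaussian\<bar>"
    unfolding euler_def
    by (subst Bochner_Integration.integral_diff) (auto intro!: std_gaussian_integrable_lipschitz_affine[OF g])
  also have "\<dots> \<le> (\<integral>z. (1 - \<beta> * \<eta>) * A * norm (x - y) \<partial>(std_gaussian :: 'a measure))"
  proof (rule order_trans[OF integral_abs_bound integral_mono])
    show "integrable std_gaussian (\<lambda>z. \<bar>g (x - \<eta> *\<^sub>R F x + sqrt (2 * \<eta>) *\<^sub>R z) - g (y - \<eta> *\<^sub>R F y + sqrt (2 * \<eta>) *\<^sub>R z)\<bar>)"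
      by (intro integrable_abs Bochner_Integration.integrable_diff std_gaussian_integrable_lipschitz_affine[OF g])
    fix z :: 'a
    have "\<bar>g (x - \<eta> *\<^sub>R F x + sqrt (2 * \<eta>) *\<^sub>R z) - g (y - \<eta> *\<^sub>R F y + sqrt (2 * \<eta>) *\<^sub>R z)\<bar>
       \<le> A * norm ((x - \<eta> *\<^sub>R F x) - (y - \<eta> *\<^sub>R F y))"
      using lipschitz_onD[OF g, of "x - \<eta> *\<^sub>R F x + sqrt (2 * \<eta>) *\<^sub>R z" "y - \<eta> *\<^sub>R F y + sqrt (2 * \<eta>) *\<^sub>R z"]
      by (simp add: dist_norm algebra_simps)
    also have "\<dots> \<le> A * ((1 - \<beta> * \<eta>) * norm (x - y))"
      by (intro mult_left_mono gradient_step_contraction \<eta> A)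
    finally show "\<bar>g (x - \<eta> *\<^sub>R F x + sqrt (2 * \<eta>) *\<^sub>R z) - g (y - \<eta> *\<^sub>R F y + sqrt (2 * \<eta>) *\<^sub>R z)\<bar>
       \<le> (1 - \<beta> * \<eta>) * A * norm (x - y)" by (simp add: mult_ac)
  qed auto
  also have "\<dots> = (1 - \<beta> * \<eta>) * A * norm (x - y)" by simp
  finally show "dist (euler \<eta> g x) (euler \<eta> g y) \<le> (1 - \<beta> * \<eta>) * A * dist x y"
    by (simp add: dist_norm)
qed

text \<open>
  The ratio \<open>\<kappa>\<close> between the two constants of the class is chosen so that one Euler step
  contracts both of them: the Lipschitz constant of the gradient is multiplied by the square of
  the contraction factor, and the slack pays for the variation of the Hessian of \<open>U\<close>.
\<close>

definition \<kappa> :: real where "\<kappa> = max 1 (2 * \<Lambda>' / \<beta>)"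

lemma \<kappa>_ge: "1 \<le> \<kappa>" "2 * \<Lambda>' \<le> \<beta> * \<kappa>"
proof -
  have "2 * \<Lambda>' / \<beta> \<le> \<kappa>" by (simp add: \<kappa>_def)
  then show "2 * \<Lambda>' \<le> \<beta> * \<kappa>" using \<beta>_pos by (simp add: pos_divide_le_eq mult.commute)
qed (simp add: \<kappa>_def)

text \<open>
  The gradient of the image is the adjoint of the linearised drift step applied to the averaged
  gradient of \<open>g\<close>. The adjoint contracts, which gives the bound on the norm. For increments, the
  averaged gradient contributes one more contraction, being taken at the images of the drift step,
  and the variation of the adjoint costs \<open>\<eta> * \<Lambda>'\<close>.
\<close>

lemma euler_C11:
  assumes g: "C11 A (\<kappa> * A) g" and \<eta>: "0 < \<eta>" "\<eta> \<le> \<eta>\<^sub>0"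
  shows "C11 ((1 - \<beta> * \<eta>) * A) (\<kappa> * ((1 - \<beta> * \<eta>) * A)) (euler \<eta> g)"
proof -
  define r where "r = 1 - \<beta> * \<eta>"
  have r: "1/2 \<le> r" "r \<le> 1" using \<beta>_\<eta>[OF \<eta>(2)] \<beta>_pos \<eta> by (auto simp: r_def)
  obtain G where G: "\<And>x. GDERIV g x :> G x" "\<And>x. norm (G x) \<le> A" "(\<kappa> * A)-lipschitz_on UNIV G"
    using g by (auto simp: C11_def)
  have A: "0 \<le> A" using order_trans[OF norm_ge_zero G(2)] .
  have \<kappa>A: "0 \<le> \<kappa> * A" using A \<kappa>_ge by simp
  note gl = C11_lipschitz[OF g]
  define T where "T x = x - \<eta> *\<^sub>R F x" for x
  define s where "s = sqrt (2 * \<eta>)"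
  define J where "J x v = v - \<eta> *\<^sub>R DF x v" for x v
  define E where "E x = (\<integral>z. G (T x + s *\<^sub>R z) \<partial>std_gaussian)" for x
  define D where "D x = adjoint (J x) (E x)" for x
  have J_lin: "linear (J x)" for x
    unfolding J_def by (intro linear_compose_sub linear_ident linear_compose_scale_right DF_linear)
  have D: "D x \<bullet> v = E x \<bullet> J x v" for x v
    unfolding D_def using adjoint_works[OF J_lin[of x], of v "E x"] by (simp add: inner_commute)
  have T: "norm (T x - T y) \<le> r * norm (x - y)" for x y
    using gradient_step_contraction[of \<eta> x y] \<eta> by (simp add: T_def r_def)
  have J: "norm (J x v) \<le> r * norm v" for x v
    using linearised_step_contraction[of \<eta> v x] \<eta> by (simp add: J_def r_def)
  have iG: "integrable std_gaussian (\<lambda>z. G (T x + s *\<^sub>R z))" for x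
    by (rule std_gaussian_integrable_lipschitz_affine[OF G(3)])
  have ig: "integrable std_gaussian (\<lambda>z. g (T x + s *\<^sub>R z))" for x
    by (rule std_gaussian_integrable_lipschitz_affine[OF gl])
  have E_norm: "norm (E x) \<le> A" for x
  proof -
    have "norm (E x) \<le> (\<integral>z. norm (G (T x + s *\<^sub>R z)) \<partial>std_gaussian)"
      unfolding E_def by (rule integral_norm_bound)
    also have "\<dots> \<le> (\<integral>z. A \<partial>(std_gaussian::'a measure))"
      by (intro integral_mono integrable_norm iG G(2)) auto
    finally show ?thesis by simp
  qed
  have E_lip: "norm (E x - E y) \<le> \<kappa> * A * (r * norm (x - y))" for x y
  proof -
    have "norm (E x - E y) = norm (\<integral>z. G (T x + s *\<^sub>R z) - G (T y + s *\<^sub>R z) \<partial>std_gaussian)"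
      unfolding E_def by (subst Bochner_Integration.integral_diff) (auto intro: iG)
    also have "\<dots> \<le> (\<integral>z. norm (G (T x + s *\<^sub>R z) - G (T y + s *\<^sub>R z)) \<partial>std_gaussian)"
      by (rule integral_norm_bound)
    also have "\<dots> \<le> (\<integral>z. \<kappa> * A * (r * norm (x - y)) \<partial>(std_gaussian::'a measure))"
    proof (intro integral_mono integrable_norm Bochner_Integration.integrable_diff iG)
      fix z :: 'a
      have "norm (G (T x + s *\<^sub>R z) - G (T y + s *\<^sub>R z)) \<le> \<kappa> * A * norm (T x - T y)"
        using lipschitz_onD[OF G(3), of "T x + s *\<^sub>R z" "T y + s *\<^sub>R z"] by (simp add: dist_norm)
      also have "\<dots> \<le> \<kappa> * A * (r * norm (x - y))" by (intro mult_left_mono T \<kappa>A)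
      finally show "norm (G (T x + s *\<^sub>R z) - G (T y + s *\<^sub>R z)) \<le> \<kappa> * A * (r * norm (x - y))" .
    qed auto
    finally show ?thesis by simp
  qed
  have D_norm: "norm (D x) \<le> r * A" for x
  proof (rule norm_le_of_inner)
    show "0 \<le> r * A" using r A by simp
    fix v
    have "E x \<bullet> J x v \<le> norm (E x) * norm (J x v)" by (rule norm_cauchy_schwarz)
    also have "\<dots> \<le> A * (r * norm v)" by (intro mult_mono E_norm J A) auto
    finally show "D x \<bullet> v \<le> r * A * norm v" by (simp add: D mult_ac)
  qed
  have D_lip: "norm (D x - D y) \<le> \<kappa> * (r * A) * norm (x - y)" for x y
  proof (rule norm_le_of_inner)
    show "0 \<le> \<kappa> * (r * A) * norm (x - y)" using r A \<kappa>_ge by simp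
    fix v
    have "(D x - D y) \<bullet> v = (E x - E y) \<bullet> J x v + \<eta> * (E y \<bullet> (DF y v - DF x v))"
      by (simp add: inner_diff_left D) (simp add: J_def inner_diff_right algebra_simps)
    also have "\<dots> \<le> norm (E x - E y) * norm (J x v) + \<eta> * (norm (E y) * norm (DF y v - DF x v))"
      using \<eta> by (intro add_mono mult_left_mono norm_cauchy_schwarz) auto
    also have "\<dots> \<le> \<kappa> * A * (r * norm (x - y)) * (r * norm v) + \<eta> * (A * (\<Lambda>' * norm (y - x) * norm v))"
      using r \<kappa>A A \<eta> by (intro add_mono mult_mono E_lip J E_norm DF_lip order_refl) auto
    also have "\<dots> = (\<kappa> * (r * r) + \<eta> * \<Lambda>') * (A * norm (x - y) * norm v)"
      by (simp add: norm_minus_commute algebra_simps)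
    also have "\<dots> \<le> (\<kappa> * r) * (A * norm (x - y) * norm v)"
    proof (rule mult_right_mono)
      have "\<eta> * (2 * \<Lambda>') \<le> \<eta> * (\<beta> * \<kappa>)" using \<eta> \<kappa>_ge by (intro mult_left_mono) auto
      also have "\<dots> = \<kappa> * (1 - r)" by (simp add: r_def)
      also have "\<dots> \<le> 2 * r * (\<kappa> * (1 - r))"
        using r \<kappa>_ge mult_right_mono[of 1 "2 * r" "\<kappa> * (1 - r)"] by simp
      finally show "\<kappa> * (r * r) + \<eta> * \<Lambda>' \<le> \<kappa> * r" by (simp add: algebra_simps)
    qed (use A in auto)
    finally show "(D x - D y) \<bullet> v \<le> \<kappa> * (r * A) * norm (x - y) * norm v" by (simp add: mult_ac)
  qed
  have D_grad: "GDERIV (euler \<eta> g) x :> D x" for x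
  proof (rule GDERIV_of_quadratic_bound)
    fix y
    define w where "w = T y - T x"
    have w: "norm w \<le> norm (y - x)"
      using T[of y x] r mult_right_mono[of r 1 "norm (y - x)"] by (simp add: w_def)
    have eq: "euler \<eta> g y - euler \<eta> g x - D x \<bullet> (y - x)
       = (\<integral>z. g (T y + s *\<^sub>R z) - g (T x + s *\<^sub>R z) - G (T x + s *\<^sub>R z) \<bullet> w \<partial>std_gaussian)
         + E x \<bullet> (w - J x (y - x))"
      unfolding euler_def T_def[symmetric] s_def[symmetric]
      by (simp add: ig iG D E_def inner_diff_right[of _ w])
    have "\<bar>\<integral>z. g (T y + s *\<^sub>R z) - g (T x + s *\<^sub>R z) - G (T x + s *\<^sub>R z) \<bullet> w \<partial>std_gaussian\<bar>
       \<le> (\<integral>z. \<kappa> * A * (norm (y - x))\<^sup>2 \<partial>(std_gaussian::'a measure))"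
    proof (rule order_trans[OF integral_abs_bound integral_mono])
      show "integrable std_gaussian (\<lambda>z. \<bar>g (T y + s *\<^sub>R z) - g (T x + s *\<^sub>R z) - G (T x + s *\<^sub>R z) \<bullet> w\<bar>)"
        by (intro integrable_abs Bochner_Integration.integrable_diff ig integrable_inner_left iG)
      fix z :: 'a
      have "\<bar>g (T y + s *\<^sub>R z) - g (T x + s *\<^sub>R z) - G (T x + s *\<^sub>R z) \<bullet> w\<bar> \<le> \<kappa> * A * (norm w)\<^sup>2"
        using lipschitz_gradient_taylor[OF G(1,3), of "T y + s *\<^sub>R z" "T x + s *\<^sub>R z"]
        by (simp add: w_def)
      also have "\<dots> \<le> \<kappa> * A * (norm (y - x))\<^sup>2" using w \<kappa>A by (intro mult_left_mono power_mono) auto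
      finally show "\<bar>g (T y + s *\<^sub>R z) - g (T x + s *\<^sub>R z) - G (T x + s *\<^sub>R z) \<bullet> w\<bar> \<le> \<kappa> * A * (norm (y - x))\<^sup>2" .
    qed auto
    moreover have "\<bar>E x \<bullet> (w - J x (y - x))\<bar> \<le> A * (\<eta> * (\<Lambda>' * (norm (y - x))\<^sup>2))"
    proof -
      have "w - J x (y - x) = - (\<eta> *\<^sub>R (F y - F x - DF x (y - x)))"
        by (simp add: w_def T_def J_def algebra_simps)
      then have "norm (w - J x (y - x)) \<le> \<eta> * (\<Lambda>' * (norm (y - x))\<^sup>2)"
        using F_taylor[of y x] \<eta> by (auto intro: mult_left_mono)
      then show ?thesis
        by (intro order_trans[OF Cauchy_Schwarz_ineq2] mult_mono E_norm A) auto
    qed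
    ultimately show "\<bar>euler \<eta> g y - euler \<eta> g x - D x \<bullet> (y - x)\<bar>
      \<le> (\<kappa> * A + A * \<eta> * \<Lambda>') * (norm (y - x))\<^sup>2"
      unfolding eq by (simp add: algebra_simps)
  qed
  show ?thesis
    unfolding C11_def r_def[symmetric]
    using D_grad D_norm D_lip r A \<kappa>_ge by (auto intro!: exI[of _ D] lipschitz_onI simp: dist_norm)
qed

end


lemma integrable_norm4_pair:
  fixes M :: "'a::euclidean_space measure" and N :: "'b::euclidean_space measure"
  assumes M: "prob_space M" "sets M = sets borel" "integrable M (\<lambda>x. norm x ^ 4)"
    and N: "prob_space N" "sets N = sets borel" "integrable N (\<lambda>x. norm x ^ 4)"
  shows "integrable (M \<Otimes>\<^sub>M N) (\<lambda>p. norm p ^ 4)"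
proof -
  interpret M: prob_space M by fact
  interpret N: prob_space N by fact
  interpret P: pair_prob_space M N ..
  interpret Q: pair_prob_space N M ..
  note [measurable_cong] = M(2) N(2)
  have 1: "integrable (M \<Otimes>\<^sub>M N) (\<lambda>p. norm (fst p) ^ 4)"
  proof -
    have "integrable (distr (M \<Otimes>\<^sub>M N) M fst) (\<lambda>x. norm x ^ 4)"
      using M(3) by (simp add: N.distr_pair_fst)
    then show ?thesis by (subst (asm) integrable_distr_eq) auto
  qed
  have "integrable (N \<Otimes>\<^sub>M M) (\<lambda>p. norm (fst p) ^ 4)"
  proof -
    have "integrable (distr (N \<Otimes>\<^sub>M M) N fst) (\<lambda>x. norm x ^ 4)"
      using N(3) by (simp add: M.distr_pair_fst)
    then show ?thesis by (subst (asm) integrable_distr_eq) auto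
  qed
  then have 2: "integrable (M \<Otimes>\<^sub>M N) (\<lambda>p. norm (snd p) ^ 4)"
    using Q.integrable_product_swap by (fastforce simp: split_beta')
  have sq: "(a + b)\<^sup>2 \<le> 2 * (a\<^sup>2 + b\<^sup>2)" for a b :: real
    using zero_le_power2[of "a - b"] unfolding power2_sum power2_diff by simp
  have 3: "norm p ^ 4 \<le> 2 * (norm (fst p) ^ 4 + norm (snd p) ^ 4)" for p :: "'a \<times> 'b"
  proof -
    have "(norm p)\<^sup>2 = (norm (fst p))\<^sup>2 + (norm (snd p))\<^sup>2"
      by (simp add: norm_prod_def)
    moreover have "norm p ^ 4 = ((norm p)\<^sup>2)\<^sup>2" by (simp flip: power_mult)
    ultimately have "norm p ^ 4 = ((norm (fst p))\<^sup>2 + (norm (snd p))\<^sup>2)\<^sup>2" by simp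
    also have "\<dots> \<le> 2 * (((norm (fst p))\<^sup>2)\<^sup>2 + ((norm (snd p))\<^sup>2)\<^sup>2)"
      by (rule sq)
    finally show ?thesis by (simp flip: power_mult)
  qed
  show ?thesis
  proof (rule Bochner_Integration.integrable_bound)
    show "integrable (M \<Otimes>\<^sub>M N) (\<lambda>p. 2 * (norm (fst p) ^ 4 + norm (snd p) ^ 4))"
      using 1 2 by auto
    have "sets (M \<Otimes>\<^sub>M N) = sets borel" unfolding borel_prod[symmetric]
      by (intro sets_pair_measure_cong M N)
    then show "(\<lambda>p. norm p ^ 4) \<in> borel_measurable (M \<Otimes>\<^sub>M N)" by (subst measurable_cong_sets[OF _ refl]) auto
    show "AE p in M \<Otimes>\<^sub>M N. norm (norm p ^ 4) \<le> norm (2 * (norm (fst p) ^ 4 + norm (snd p) ^ 4))"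
      using 3 by (auto intro!: AE_I2)
  qed
qed

text \<open>
  With both exponentials on the right, symmetry later allows either of two densities to be used
  as the weight of the logarithm of their quotient, so that polynomial moments of that logarithm
  suffice.
\<close>

lemma exp_diff_le: "\<bar>exp a - exp b\<bar> \<le> \<bar>a - b\<bar> * (exp a + exp (b::real))"
proof -
  have le: "exp a - exp b \<le> (a - b) * (exp a + exp b)" if "b \<le> a" for a b :: real
  proof -
    have "exp a * (1 + (b - a)) \<le> exp a * exp (b - a)" by (intro mult_left_mono exp_ge_add_one_self) auto
    also have "\<dots> = exp b" by (simp flip: exp_add)
    finally have "exp a - exp b \<le> (a - b) * exp a" by (simp add: algebra_simps)
    also have "\<dots> \<le> (a - b) * (exp a + exp b)" using that by (intro mult_left_mono) auto
    finally show ?thesis .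
  qed
  show ?thesis using le[of a b] le[of b a] by (cases "b \<le> a") (auto simp: add.commute)
qed

context strongly_convex_potential
begin

section \<open>The Gibbs measure is almost reversible for the Euler kernel\<close>

lemma exp_neg_U_le: "exp (- U x) \<le> exp (- U 0) * exp (- (m / 2) * (norm x)\<^sup>2)"
  using U_growth[of x] by (simp flip: exp_add)

lemma integrable_exp_neg_U: "integrable lborel (\<lambda>x. exp (- U x))"
proof (rule Bochner_Integration.integrable_bound)
  show "integrable lborel (\<lambda>x::'a. exp (- U 0) * exp (- (m / 2) * (norm x)\<^sup>2))"
    using m_pos by (intro integrable_mult_right integrable_exp_neg_norm_sq) auto
qed (use exp_neg_U_le in auto)

definition Z :: real where "Z = (\<integral>x. exp (- U x) \<partial>lborel)"

lemma Z_pos: "0 < Z"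
proof -
  have "Z \<noteq> 0"
  proof
    assume "Z = 0"
    then have "AE x::'a in lborel. exp (- U x) = 0"
      unfolding Z_def by (subst (asm) integral_nonneg_eq_0_iff_AE[OF integrable_exp_neg_U]) auto
    then have "AE x::'a in lborel. False" by eventually_elim simp
    then have "emeasure lborel (UNIV :: 'a set) = 0"
      by (subst (asm) AE_iff_measurable[of UNIV]) auto
    then show False by simp
  qed
  moreover have "0 \<le> Z" unfolding Z_def by (rule integral_nonneg_AE) auto
  ultimately show ?thesis by simp
qed

definition dens :: "'a \<Rightarrow> real" where "dens x = exp (- U x) / Z"

lemma dens_pos: "0 < dens x" using Z_pos by (simp add: dens_def)

lemma dens_measurable [measurable]: "dens \<in> borel_measurable borel"
  unfolding dens_def[abs_def] by measurable

lemma gibbs_eq: "gibbs U = density lborel (\<lambda>x. ennreal (dens x))"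
  by (simp add: gibbs_def dens_def Z_def)

lemma sets_gibbs [simp, measurable_cong]: "sets (gibbs U) = sets borel"
  and space_gibbs [simp]: "space (gibbs U) = UNIV"
  by (simp_all add: gibbs_eq)

lemma prob_space_gibbs: "prob_space (gibbs U)"
proof
  have "emeasure (gibbs U) (space (gibbs U)) = (\<integral>\<^sup>+x. ennreal (dens x) \<partial>lborel)"
    unfolding gibbs_eq by (simp add: emeasure_density)
  also have "\<dots> = ennreal (\<integral>x. dens x \<partial>lborel)"
    unfolding dens_def using integrable_exp_neg_U Z_pos by (intro nn_integral_eq_integral) auto
  also have "(\<integral>x. dens x \<partial>lborel) = 1" using Z_pos by (simp add: dens_def flip: Z_def)
  finally show "emeasure (gibbs U) (space (gibbs U)) = 1" by simp
qed

sublocale gibbs: prob_space "gibbs U" by (rule prob_space_gibbs)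

sublocale gibbs_pair: pair_prob_space "gibbs U" std_gaussian ..

lemma gibbs_norm4: "integrable (gibbs U) (\<lambda>x. norm x ^ 4)"
proof -
  have "integrable lborel (\<lambda>x::'a. dens x *\<^sub>R norm x ^ 4)"
  proof (rule Bochner_Integration.integrable_bound)
    show "integrable lborel (\<lambda>x::'a. exp (- U 0) / Z * (exp (- (m / 2) * (norm x)\<^sup>2) * norm x ^ 4))"
      using m_pos by (intro integrable_mult_right integrable_norm4_exp_neg_norm_sq) auto
    have "dens x * norm x ^ 4 \<le> exp (- U 0) / Z * (exp (- (m / 2) * (norm x)\<^sup>2) * norm x ^ 4)" for x
    proof -
      have "exp (- U x) / Z * norm x ^ 4 \<le> (exp (- U 0) * exp (- (m / 2) * (norm x)\<^sup>2)) / Z * norm x ^ 4"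
        using Z_pos by (intro mult_right_mono divide_right_mono exp_neg_U_le) auto
      then show ?thesis by (simp add: dens_def mult_ac)
    qed
    then show "AE x in lborel. norm (dens x *\<^sub>R norm (x::'a) ^ 4)
        \<le> norm (exp (- U 0) / Z * (exp (- (m / 2) * (norm x)\<^sup>2) * norm x ^ 4))"
      using Z_pos dens_pos by (intro AE_I2) (simp add: abs_mult less_imp_le)
  qed simp
  then show ?thesis
    unfolding gibbs_eq using dens_pos by (subst integrable_density) (auto simp: less_imp_le)
qed

lemma gibbs_integrable_id: "integrable (gibbs U) (\<lambda>x. x)"
proof (rule gibbs.integrable_growth4[where r="\<lambda>x. x" and C=1])
  show "norm y \<le> 1 * (1 + norm y) ^ 4" for y :: 'a
    using power_increasing[of 1 4 "1 + norm y"] by simp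
qed (auto simp: gibbs_norm4 measurable_cong_sets[OF sets_gibbs refl])

lemma gibbs_integrable_lipschitz:
  fixes g :: "'a \<Rightarrow> real"
  assumes "A-lipschitz_on UNIV g"
  shows "integrable (gibbs U) g"
  by (rule gibbs.integrable_lipschitz[OF assms gibbs_integrable_id])

lemma gibbs_pair_norm4: "integrable (gibbs U \<Otimes>\<^sub>M std_gaussian) (\<lambda>p. norm p ^ 4)"
  by (intro integrable_norm4_pair gibbs.prob_space_axioms std_gaussian.prob_space_axioms gibbs_norm4
      std_gaussian_norm4) auto

text \<open>
  \<open>joint\<close> is the density of the pair formed by a state distributed according to the Gibbs measure
  and its Euler successor, and \<open>log_ratio\<close> the logarithm of the quotient of \<open>joint\<close> and its
  transpose. For a reversible kernel it would vanish.
\<close>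

definition next_pair :: "real \<Rightarrow> 'a \<times> 'a \<Rightarrow> 'a \<times> 'a" where
  "next_pair \<eta> p = (fst p, fst p - \<eta> *\<^sub>R F (fst p) + sqrt (2 * \<eta>) *\<^sub>R snd p)"

definition joint :: "real \<Rightarrow> 'a \<times> 'a \<Rightarrow> real" where
  "joint \<eta> p = dens (fst p) * gauss_kernel (sqrt (2 * \<eta>)) (snd p - (fst p - \<eta> *\<^sub>R F (fst p)))"

definition log_ratio :: "real \<Rightarrow> 'a \<times> 'a \<Rightarrow> real" where
  "log_ratio \<eta> p = U (snd p) - U (fst p) - (F (fst p) + F (snd p)) \<bullet> (snd p - fst p) / 2
     + \<eta> / 4 * ((norm (F (snd p)))\<^sup>2 - (norm (F (fst p)))\<^sup>2)"

lemma next_pair_measurable [measurable]: "next_pair \<eta> \<in> borel \<Otimes>\<^sub>M borel \<rightarrow>\<^sub>M borel \<Otimes>\<^sub>M borel"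
  unfolding next_pair_def[abs_def] by measurable

lemma joint_measurable [measurable]: "joint \<eta> \<in> borel_measurable (borel \<Otimes>\<^sub>M borel)"
  unfolding joint_def[abs_def] by measurable

lemma log_ratio_measurable [measurable]: "log_ratio \<eta> \<in> borel_measurable (borel \<Otimes>\<^sub>M borel)"
  unfolding log_ratio_def[abs_def] by measurable

lemma joint_nonneg: "0 < \<eta> \<Longrightarrow> 0 \<le> joint \<eta> p"
  unfolding joint_def by (intro mult_nonneg_nonneg less_imp_le[OF dens_pos] less_imp_le[OF gauss_kernel_pos]) simp

lemma distr_next_pair:
  assumes \<eta>: "0 < \<eta>"
  shows "distr (gibbs U \<Otimes>\<^sub>M std_gaussian) (borel \<Otimes>\<^sub>M borel) (next_pair \<eta>)
     = density (lborel \<Otimes>\<^sub>M lborel) (\<lambda>p. ennreal (joint \<eta> p))" (is "?L = ?R")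
proof (rule measure_eqI)
  show "sets ?L = sets ?R" by simp
  fix S assume "S \<in> sets ?L"
  then have [measurable]: "S \<in> sets (borel \<Otimes>\<^sub>M borel)" by simp
  have "emeasure ?L S = (\<integral>\<^sup>+p. indicator S (next_pair \<eta> p) \<partial>(gibbs U \<Otimes>\<^sub>M std_gaussian))"
    by (subst nn_integral_indicator[symmetric], simp, subst nn_integral_distr) auto
  also have "\<dots> = (\<integral>\<^sup>+x. \<integral>\<^sup>+z. indicator S (next_pair \<eta> (x, z)) \<partial>std_gaussian \<partial>gibbs U)"
    by (rule std_gaussian.nn_integral_fst[symmetric]) auto
  also have "\<dots> = (\<integral>\<^sup>+x. \<integral>\<^sup>+y. ennreal (gauss_kernel (sqrt (2 * \<eta>)) (y - (x - \<eta> *\<^sub>R F x))) * indicator S (x, y) \<partial>lborel \<partial>gibbs U)"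
    unfolding next_pair_def fst_conv snd_conv using \<eta>
    by (subst nn_integral_std_gaussian_affine) auto
  also have "\<dots> = (\<integral>\<^sup>+x. \<integral>\<^sup>+y. ennreal (joint \<eta> (x, y)) * indicator S (x, y) \<partial>lborel \<partial>lborel)"
    unfolding gibbs_eq joint_def fst_conv snd_conv using \<eta> dens_pos
    by (subst nn_integral_density)
       (auto simp: nn_integral_cmult[symmetric] ennreal_mult less_imp_le gauss_kernel_pos mult.assoc
          intro!: nn_integral_cong)
  also have "\<dots> = (\<integral>\<^sup>+p. ennreal (joint \<eta> p) * indicator S p \<partial>(lborel \<Otimes>\<^sub>M lborel))"
    by (rule lborel.nn_integral_fst) auto
  also have "\<dots> = emeasure ?R S" by (subst emeasure_density) auto
  finally show "emeasure ?L S = emeasure ?R S" .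
qed

lemma joint_asymmetry:
  assumes \<eta>: "0 < \<eta>"
  shows "\<bar>joint \<eta> (x, y) - joint \<eta> (y, x)\<bar> \<le> \<bar>log_ratio \<eta> (x, y)\<bar> * (joint \<eta> (x, y) + joint \<eta> (y, x))"
proof -
  define k where "k = (2 * pi) powr (- real DIM('a) / 2) / sqrt (2 * \<eta>) ^ DIM('a) / Z"
  have k: "0 < k" using \<eta> Z_pos by (simp add: k_def)
  define e where "e x y = - U x - (norm (y - (x - \<eta> *\<^sub>R F x)))\<^sup>2 / (4 * \<eta>)" for x y :: 'a
  have j: "joint \<eta> (x, y) = k * exp (e x y)" for x y
  proof -
    have "e x y = - U x + (- (norm (y - (x - \<eta> *\<^sub>R F x)))\<^sup>2 / (2 * (sqrt (2 * \<eta>))\<^sup>2))"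
      using \<eta> by (simp add: e_def)
    then have "exp (e x y) = exp (- U x) * exp (- (norm (y - (x - \<eta> *\<^sub>R F x)))\<^sup>2 / (2 * (sqrt (2 * \<eta>))\<^sup>2))"
      by (simp only: exp_add)
    then show ?thesis by (simp only: joint_def dens_def gauss_kernel_def k_def fst_conv snd_conv) (simp add: mult_ac)
  qed
  have n: "(norm (y - (x - \<eta> *\<^sub>R F x)))\<^sup>2 = (norm (y - x))\<^sup>2 + 2 * \<eta> * (F x \<bullet> (y - x)) + \<eta>\<^sup>2 * (norm (F x))\<^sup>2" for x y
    unfolding power2_norm_eq_inner
    by (simp add: inner_diff_left inner_diff_right inner_add_left inner_add_right inner_commute power2_eq_square algebra_simps)
  have d: "e x y - e y x = log_ratio \<eta> (x, y)"
  proof -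
    have "e x y - e y x = U y - U x + (2 * \<eta> * (F y \<bullet> (x - y)) + \<eta>\<^sup>2 * (norm (F y))\<^sup>2
        - (2 * \<eta> * (F x \<bullet> (y - x)) + \<eta>\<^sup>2 * (norm (F x))\<^sup>2)) / (4 * \<eta>)"
      unfolding e_def n by (simp add: norm_minus_commute diff_divide_distrib add_divide_distrib)
    also have "\<dots> = log_ratio \<eta> (x, y)"
      using \<eta> by (simp add: log_ratio_def inner_diff_right inner_add_left power2_eq_square field_simps)
    finally show ?thesis .
  qed
  have "\<bar>joint \<eta> (x, y) - joint \<eta> (y, x)\<bar> = k * \<bar>exp (e x y) - exp (e y x)\<bar>"
    using k unfolding j by (simp add: abs_mult flip: right_diff_distrib)
  also have "\<dots> \<le> k * (\<bar>e x y - e y x\<bar> * (exp (e x y) + exp (e y x)))"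
    using k by (intro mult_left_mono exp_diff_le) auto
  finally show ?thesis unfolding d j by (simp add: algebra_simps)
qed

lemma log_ratio_antisym: "log_ratio \<eta> (y, x) = - log_ratio \<eta> (x, y)"
  by (simp add: log_ratio_def inner_diff_right inner_add_left field_simps)


text \<open>
  One Euler step moves by order \<open>sqrt \<eta>\<close>, so the trapezoidal rule makes \<open>log_ratio\<close> of order
  \<open>\<eta> * sqrt \<eta>\<close>; the product with the length of the step is of order \<open>\<eta>\<^sup>2\<close>.
\<close>

lemma log_ratio_step_bound:
  obtains C where "0 \<le> C"
    "\<And>\<eta> p. \<lbrakk>0 < \<eta>; \<eta> \<le> 1\<rbrakk> \<Longrightarrow>
       \<bar>log_ratio \<eta> (next_pair \<eta> p)\<bar> * norm (snd (next_pair \<eta> p) - fst (next_pair \<eta> p)) \<le> C * \<eta>\<^sup>2 * (1 + norm p) ^ 4"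
proof -
  define b where "b = \<Lambda> + 2"
  have b: "0 < b" using \<Lambda>_pos by (simp add: b_def)
  define C where "C = 2 * \<Lambda>' * b ^ 4 + \<Lambda>\<^sup>2 * b\<^sup>2 * (2 + b) / 4"
  have C: "0 \<le> C" unfolding C_def using b \<Lambda>'_nonneg by simp
  show ?thesis
  proof (rule that[of C])
    fix \<eta> :: real and p :: "'a \<times> 'a" assume \<eta>: "0 < \<eta>" "\<eta> \<le> 1"
    obtain x z where p: "p = (x, z)" by fastforce
    define y where "y = x - \<eta> *\<^sub>R F x + sqrt (2 * \<eta>) *\<^sub>R z"
    define w where "w = y - x"
    define n where "n = norm p"
    define s where "s = sqrt \<eta>"
    have s: "0 < s" "s \<le> 1" "s\<^sup>2 = \<eta>" using \<eta> by (auto simp: s_def)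
    have n: "norm x \<le> n" "norm z \<le> n" "0 \<le> n"
      using norm_fst_le[of x z] norm_snd_le[of z x] by (auto simp: n_def p)
    have s\<eta>: "\<eta> \<le> s" using s mult_left_mono[of s 1 s] by (simp add: power2_eq_square)
    have "norm w \<le> \<eta> * norm (F x) + sqrt 2 * s * norm z"
      unfolding w_def y_def using \<eta> norm_triangle_ineq[of "- (\<eta> *\<^sub>R F x)" "sqrt (2 * \<eta>) *\<^sub>R z"]
      by (simp add: real_sqrt_mult s_def)
    also have "\<dots> \<le> s * (\<Lambda> * n) + 2 * s * n"
    proof (intro add_mono mult_mono)
      show "norm (F x) \<le> \<Lambda> * n" using F_bound[of x] n \<Lambda>_pos by (meson less_imp_le mult_left_mono order_trans)
      show "sqrt 2 \<le> 2" using real_sqrt_le_mono[of 2 4] by simp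
    qed (use s s\<eta> n \<eta> in auto)
    also have "\<dots> = s * (b * n)" by (simp add: b_def algebra_simps)
    finally have w: "norm w \<le> s * (b * n)" .
    have bn: "0 \<le> b * n" using b n by simp
    have w': "norm w \<le> b * n" using w s mult_right_mono[of s 1 "b * n"] bn by simp
    have "\<bar>(norm (F y))\<^sup>2 - (norm (F x))\<^sup>2\<bar> = \<bar>norm (F y) - norm (F x)\<bar> * (norm (F y) + norm (F x))"
    proof -
      have "(norm (F y))\<^sup>2 - (norm (F x))\<^sup>2 = (norm (F y) - norm (F x)) * (norm (F y) + norm (F x))"
        by (simp add: power2_eq_square algebra_simps)
      then show ?thesis by (simp add: abs_mult)
    qed
    also have "\<dots> \<le> (\<Lambda> * norm w) * (\<Lambda> * (2 * n + b * n))"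
    proof (rule mult_mono)
      have Fyx: "norm (F y - F x) \<le> \<Lambda> * norm w" using F_lip[of y x] by (simp add: w_def)
      then show "\<bar>norm (F y) - norm (F x)\<bar> \<le> \<Lambda> * norm w"
        using norm_triangle_ineq3[of "F y" "F x"] by linarith
      have "norm (F y) \<le> norm (F x) + \<Lambda> * norm w"
        using Fyx norm_triangle_sub[of "F y" "F x"] by linarith
      moreover have "norm (F x) \<le> \<Lambda> * n" using F_bound[of x] n \<Lambda>_pos by (meson less_imp_le mult_left_mono order_trans)
      moreover have "\<Lambda> * norm w \<le> \<Lambda> * (b * n)" using w' \<Lambda>_pos by simp
      ultimately show "norm (F y) + norm (F x) \<le> \<Lambda> * (2 * n + b * n)" by (simp add: algebra_simps)
    qed (use \<Lambda>_pos in auto)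
    finally have Fsq: "\<bar>(norm (F y))\<^sup>2 - (norm (F x))\<^sup>2\<bar> \<le> \<Lambda>\<^sup>2 * norm w * (2 + b) * n"
      by (simp add: power2_eq_square algebra_simps)
    have "\<bar>log_ratio \<eta> (x, y)\<bar> \<le> 2 * \<Lambda>' * norm w ^ 3 + \<eta> / 4 * (\<Lambda>\<^sup>2 * norm w * (2 + b) * n)"
    proof -
      have "\<bar>log_ratio \<eta> (x, y)\<bar> \<le> \<bar>U y - U x - (F x + F y) \<bullet> (y - x) / 2\<bar> + \<bar>\<eta> / 4 * ((norm (F y))\<^sup>2 - (norm (F x))\<^sup>2)\<bar>"
        unfolding log_ratio_def by simp
      also have "\<bar>\<eta> / 4 * ((norm (F y))\<^sup>2 - (norm (F x))\<^sup>2)\<bar> = \<eta> / 4 * \<bar>(norm (F y))\<^sup>2 - (norm (F x))\<^sup>2\<bar>"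
        using \<eta> by (simp add: abs_mult)
      finally show ?thesis
      proof -
        have "\<bar>U y - U x - (F x + F y) \<bullet> (y - x) / 2\<bar> \<le> 2 * \<Lambda>' * norm w ^ 3"
          using trapezoidal_rule[of y x] by (simp add: w_def)
        moreover have "\<eta> / 4 * \<bar>(norm (F y))\<^sup>2 - (norm (F x))\<^sup>2\<bar> \<le> \<eta> / 4 * (\<Lambda>\<^sup>2 * norm w * (2 + b) * n)"
          using \<eta> by (intro mult_left_mono Fsq) auto
        moreover assume "\<bar>log_ratio \<eta> (x, y)\<bar> \<le> \<bar>U y - U x - (F x + F y) \<bullet> (y - x) / 2\<bar>
          + \<eta> / 4 * \<bar>(norm (F y))\<^sup>2 - (norm (F x))\<^sup>2\<bar>"
        ultimately show ?thesis by linarith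
      qed
    qed
    then have "\<bar>log_ratio \<eta> (x, y)\<bar> * norm w
        \<le> (2 * \<Lambda>' * norm w ^ 3 + \<eta> / 4 * (\<Lambda>\<^sup>2 * norm w * (2 + b) * n)) * norm w"
      by (rule mult_right_mono) simp
    also have "\<dots> = 2 * \<Lambda>' * norm w ^ 4 + (\<eta> / 4 * \<Lambda>\<^sup>2 * (2 + b)) * (norm w)\<^sup>2 * n"
      by (simp add: power2_eq_square power3_eq_cube power4_eq_xxxx algebra_simps)
    also have "\<dots> \<le> 2 * \<Lambda>' * (s * (b * n)) ^ 4 + (\<eta> / 4 * \<Lambda>\<^sup>2 * (2 + b)) * (s * (b * n))\<^sup>2 * n"
      using w \<Lambda>'_nonneg n b \<eta> by (intro add_mono mult_left_mono mult_right_mono power_mono) auto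
    also have "\<dots> = \<eta>\<^sup>2 * (2 * \<Lambda>' * b ^ 4 * n ^ 4 + \<Lambda>\<^sup>2 * b\<^sup>2 * (2 + b) / 4 * n ^ 3)"
      unfolding s(3)[symmetric]
      by (simp add: power2_eq_square power3_eq_cube power4_eq_xxxx algebra_simps)
    also have "\<dots> \<le> \<eta>\<^sup>2 * (2 * \<Lambda>' * b ^ 4 * (1 + n) ^ 4 + \<Lambda>\<^sup>2 * b\<^sup>2 * (2 + b) / 4 * (1 + n) ^ 4)"
    proof (intro mult_left_mono add_mono)
      show "n ^ 4 \<le> (1 + n) ^ 4" using n by (intro power_mono) auto
      show "n ^ 3 \<le> (1 + n) ^ 4"
        using n by (intro order_trans[OF power_mono[of n "1 + n" 3] power_increasing]) auto
    qed (use b \<Lambda>'_nonneg in auto)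
    finally have "\<bar>log_ratio \<eta> (x, y)\<bar> * norm w \<le> C * \<eta>\<^sup>2 * (1 + n) ^ 4"
      by (simp add: C_def algebra_simps)
    then show "\<bar>log_ratio \<eta> (next_pair \<eta> p)\<bar> * norm (snd (next_pair \<eta> p) - fst (next_pair \<eta> p)) \<le> C * \<eta>\<^sup>2 * (1 + norm p) ^ 4"
      by (simp add: next_pair_def p w_def y_def n_def)
  qed (rule C)
qed

text \<open>
  Symmetrising the integral of \<open>g y - g x\<close> against the law of \<open>(x, y)\<close> turns the defect
  of invariance into half of the integral against the antisymmetric part of the density.
\<close>

lemma euler_gibbs_invariance_defect:
  obtains C where "0 \<le> C"
    "\<And>A g \<eta>. \<lbrakk>A-lipschitz_on UNIV g; 0 < \<eta>; \<eta> \<le> 1\<rbrakk> \<Longrightarrow>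
       \<bar>(\<integral>x. euler \<eta> g x \<partial>gibbs U) - (\<integral>x. g x \<partial>gibbs U)\<bar> \<le> C * A * \<eta>\<^sup>2"
proof -
  obtain C where C: "0 \<le> C"
    "\<And>\<eta> p. \<lbrakk>0 < \<eta>; \<eta> \<le> 1\<rbrakk> \<Longrightarrow>
       \<bar>log_ratio \<eta> (next_pair \<eta> p)\<bar> * norm (snd (next_pair \<eta> p) - fst (next_pair \<eta> p)) \<le> C * \<eta>\<^sup>2 * (1 + norm p) ^ 4"
    using log_ratio_step_bound by blast
  let ?P = "gibbs U \<Otimes>\<^sub>M std_gaussian :: ('a \<times> 'a) measure"
  have setsP: "sets ?P = sets (borel \<Otimes>\<^sub>M borel)"
    by (intro sets_pair_measure_cong) auto
  have id_meas [measurable]: "(\<lambda>p. p) \<in> borel_measurable ?P"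
    by (rule measurable_ident_sets) (simp only: setsP borel_prod)
  define I where "I = (\<integral>p. (1 + norm p) ^ 4 \<partial>?P)"
  have int4: "integrable ?P (\<lambda>p. (1 + norm p) ^ 4)"
    by (rule gibbs_pair.integrable_growth4[where r="\<lambda>p. p" and C=1])
       (use gibbs_pair_norm4 in auto)
  have I: "0 \<le> I" unfolding I_def by (rule integral_nonneg_AE) auto
  show ?thesis
  proof (rule that[of "C * I"])
    show "0 \<le> C * I" using C I by simp
    fix A \<eta> :: real and g :: "'a \<Rightarrow> real"
    assume g: "A-lipschitz_on UNIV g" and \<eta>: "0 < \<eta>" "\<eta> \<le> 1"
    have A: "0 \<le> A" using g lipschitz_on_nonneg by blast
    have [measurable]: "g \<in> borel_measurable borel"
      by (rule lipschitz_borel_measurable[OF g])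
    define T where "T x = x - \<eta> *\<^sub>R F x" for x
    define c where "c = sqrt (2 * \<eta>)"
    define f where "f p = g (snd p) - g (fst p)" for p :: "'a \<times> 'a"
    define k where "k p = \<bar>log_ratio \<eta> p\<bar> * norm (snd p - fst p)" for p :: "'a \<times> 'a"
    let ?N = "distr ?P (borel \<Otimes>\<^sub>M borel) (next_pair \<eta>)"
    have [measurable]: "f \<in> borel_measurable (borel \<Otimes>\<^sub>M borel)" "k \<in> borel_measurable (borel \<Otimes>\<^sub>M borel)"
      unfolding f_def[abs_def] k_def[abs_def] by measurable
    have [measurable]: "next_pair \<eta> \<in> ?P \<rightarrow>\<^sub>M borel \<Otimes>\<^sub>M borel"
      by (subst measurable_cong_sets[OF setsP refl]) measurable
    have k_int: "integrable ?P (\<lambda>p. k (next_pair \<eta> p))"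
    proof (rule gibbs_pair.integrable_growth4[where r="\<lambda>p. p" and C="C * \<eta>\<^sup>2"])
      show "norm (k (next_pair \<eta> p)) \<le> C * \<eta>\<^sup>2 * (1 + norm p) ^ 4" for p
        using C(2)[OF \<eta>, of p] by (simp add: k_def)
    qed (use gibbs_pair_norm4 in auto)
    have k_le: "(\<integral>p. k (next_pair \<eta> p) \<partial>?P) \<le> C * \<eta>\<^sup>2 * I"
    proof -
      have "(\<integral>p. k (next_pair \<eta> p) \<partial>?P) \<le> (\<integral>p. C * \<eta>\<^sup>2 * (1 + norm p) ^ 4 \<partial>?P)"
        using C(2)[OF \<eta>] by (intro integral_mono k_int integrable_mult_right int4) (simp add: k_def)
      then show ?thesis by (simp add: I_def)
    qed
    have f_int: "integrable ?P (\<lambda>p. f (next_pair \<eta> p))"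
    proof (rule gibbs_pair.integrable_growth4[where r="\<lambda>p. p" and C="A * (\<Lambda> + c)"])
      fix p :: "'a \<times> 'a"
      obtain x z where p: "p = (x, z)" by fastforce
      have n: "norm x \<le> norm p" "norm z \<le> norm p"
        using norm_fst_le[of x z] norm_snd_le[of z x] by (auto simp: p)
      have c: "0 \<le> c" using \<eta> by (simp add: c_def)
      have "\<bar>f (next_pair \<eta> p)\<bar> \<le> A * norm (- (\<eta> *\<^sub>R F x) + c *\<^sub>R z)"
        using lipschitz_onD[OF g, of "x - \<eta> *\<^sub>R F x + c *\<^sub>R z" x]
        by (simp add: f_def next_pair_def p dist_norm c_def)
      also have "\<dots> \<le> A * (1 * (\<Lambda> * norm p) + c * norm p)"
      proof (intro mult_left_mono A order_trans[OF norm_triangle_ineq] add_mono)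
        have "\<eta> * norm (F x) \<le> 1 * (\<Lambda> * norm p)"
          using \<eta> n \<Lambda>_pos F_bound[of x]
          by (intro mult_mono order_trans[OF F_bound] mult_left_mono) auto
        then show "norm (- (\<eta> *\<^sub>R F x)) \<le> 1 * (\<Lambda> * norm p)" using \<eta> by simp
        show "norm (c *\<^sub>R z) \<le> c * norm p" using c n by (simp add: mult_left_mono)
      qed
      also have "\<dots> = A * (\<Lambda> + c) * norm p" by (simp add: algebra_simps)
      also have "\<dots> \<le> A * (\<Lambda> + c) * (1 + norm p) ^ 4"
        using A \<Lambda>_pos c power_increasing[of 1 4 "1 + norm p"] by (intro mult_left_mono) auto
      finally show "norm (f (next_pair \<eta> p)) \<le> A * (\<Lambda> + c) * (1 + norm p) ^ 4" by simp
    qed (use gibbs_pair_norm4 in auto)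
    \<comment> \<open>the defect of invariance as an integral over pairs\<close>
    have step: "(\<integral>p. f (next_pair \<eta> p) \<partial>?P) = (\<integral>x. euler \<eta> g x \<partial>gibbs U) - (\<integral>x. g x \<partial>gibbs U)"
    proof -
      have "(\<integral>p. f (next_pair \<eta> p) \<partial>?P) = (\<integral>x. \<integral>z. f (next_pair \<eta> (x, z)) \<partial>std_gaussian \<partial>gibbs U)"
        by (rule gibbs_pair.integral_fst'[symmetric, OF f_int])
      also have "\<dots> = (\<integral>x. euler \<eta> g x - g x \<partial>gibbs U)"
        unfolding f_def next_pair_def euler_def fst_conv snd_conv
        by (intro Bochner_Integration.integral_cong refl, subst Bochner_Integration.integral_diff)
           (auto intro: std_gaussian_integrable_lipschitz_affine[OF g])
      also have "\<dots> = (\<integral>x. euler \<eta> g x \<partial>gibbs U) - (\<integral>x. g x \<partial>gibbs U)"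
      proof (rule Bochner_Integration.integral_diff)
        have "integrable (gibbs U) (\<lambda>x. \<integral>z. f (next_pair \<eta> (x, z)) \<partial>std_gaussian)"
          by (rule gibbs_pair.integrable_fst'[OF f_int])
        moreover have "(\<integral>z. f (next_pair \<eta> (x, z)) \<partial>std_gaussian) = euler \<eta> g x - g x" for x
          unfolding f_def next_pair_def euler_def fst_conv snd_conv
          by (subst Bochner_Integration.integral_diff)
             (auto intro: std_gaussian_integrable_lipschitz_affine[OF g])
        ultimately have "integrable (gibbs U) (\<lambda>x. euler \<eta> g x - g x)" by simp
        from Bochner_Integration.integrable_add[OF this gibbs_integrable_lipschitz[OF g]]
        show "integrable (gibbs U) (euler \<eta> g)" by simp
      qed (rule gibbs_integrable_lipschitz[OF g])
      finally show ?thesis .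
    qed
    let ?LL = "lborel \<Otimes>\<^sub>M lborel :: ('a \<times> 'a) measure"
    have on_LL: "integrable ?LL (\<lambda>p. joint \<eta> p * h p) \<and> (\<integral>p. joint \<eta> p * h p \<partial>?LL) = (\<integral>p. h (next_pair \<eta> p) \<partial>?P)"
      if [measurable]: "h \<in> borel_measurable (borel \<Otimes>\<^sub>M borel)" and h: "integrable ?P (\<lambda>p. h (next_pair \<eta> p))"
      for h :: "'a \<times> 'a \<Rightarrow> real"
    proof
      have "integrable ?N h" using h by (subst integrable_distr_eq) auto
      then show "integrable ?LL (\<lambda>p. joint \<eta> p * h p)"
        unfolding distr_next_pair[OF \<eta>(1)] using joint_nonneg[OF \<eta>(1)]
        by (subst (asm) integrable_density) auto
      have "(\<integral>p. h (next_pair \<eta> p) \<partial>?P) = (\<integral>p. h p \<partial>?N)" by (subst integral_distr) auto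
      also have "\<dots> = (\<integral>p. joint \<eta> p * h p \<partial>?LL)"
        unfolding distr_next_pair[OF \<eta>(1)] using joint_nonneg[OF \<eta>(1)]
        by (subst integral_density) auto
      finally show "(\<integral>p. joint \<eta> p * h p \<partial>?LL) = (\<integral>p. h (next_pair \<eta> p) \<partial>?P)" by simp
    qed
    define flip :: "'a \<times> 'a \<Rightarrow> 'a \<times> 'a" where "flip p = (snd p, fst p)" for p
    have swap: "integrable ?LL (\<lambda>p. h (flip p)) \<and> (\<integral>p. h (flip p) \<partial>?LL) = (\<integral>p. h p \<partial>?LL)"
      if "integrable ?LL h" for h :: "'a \<times> 'a \<Rightarrow> real"
      using lborel_pair.integrable_product_swap[OF that] lborel_pair.integral_product_swap[of h] that
      by (auto simp: flip_def split_beta')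
    have f_flip: "f (flip p) = - f p" and k_flip: "k (flip p) = k p" for p
      using log_ratio_antisym[of \<eta> "fst p" "snd p"]
      by (auto simp: f_def k_def flip_def norm_minus_commute)
    note fL = on_LL[of f, OF _ f_int, simplified] and kL = on_LL[of k, OF _ k_int, simplified]
    note fS = swap[OF fL[THEN conjunct1], unfolded f_flip] and kS = swap[OF kL[THEN conjunct1], unfolded k_flip]
    define D where "D = (\<integral>p. f (next_pair \<eta> p) \<partial>?P)"
    have "2 * D = (\<integral>p. joint \<eta> p * f p \<partial>?LL) - (\<integral>p. joint \<eta> (flip p) * f p \<partial>?LL)"
      using fL fS by (simp add: D_def)
    also have "\<dots> = (\<integral>p. joint \<eta> p * f p - joint \<eta> (flip p) * f p \<partial>?LL)"
      using fL fS by (subst Bochner_Integration.integral_diff) auto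
    finally have 2: "2 * D = (\<integral>p. (joint \<eta> p - joint \<eta> (flip p)) * f p \<partial>?LL)"
      by (simp add: left_diff_distrib)
    have "\<bar>2 * D\<bar> \<le> (\<integral>p. A * (joint \<eta> p * k p + joint \<eta> (flip p) * k p) \<partial>?LL)"
      unfolding 2
    proof (rule order_trans[OF integral_abs_bound integral_mono])
      have "integrable ?LL (\<lambda>p. joint \<eta> p * f p - joint \<eta> (flip p) * f p)"
        using fL fS by (intro Bochner_Integration.integrable_diff) auto
      then show "integrable ?LL (\<lambda>p. \<bar>(joint \<eta> p - joint \<eta> (flip p)) * f p\<bar>)"
        by (intro integrable_abs) (simp add: left_diff_distrib)
      show "integrable ?LL (\<lambda>p. A * (joint \<eta> p * k p + joint \<eta> (flip p) * k p))"
        using kL kS by (intro integrable_mult_right Bochner_Integration.integrable_add) auto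
      fix p :: "'a \<times> 'a"
      have j: "0 \<le> joint \<eta> p" "0 \<le> joint \<eta> (flip p)" using joint_nonneg \<eta> by auto
      have "\<bar>f p\<bar> \<le> A * norm (snd p - fst p)"
        using lipschitz_onD[OF g, of "snd p" "fst p"] by (simp add: f_def dist_norm)
      then have "\<bar>joint \<eta> p - joint \<eta> (flip p)\<bar> * \<bar>f p\<bar>
        \<le> (\<bar>log_ratio \<eta> p\<bar> * (joint \<eta> p + joint \<eta> (flip p))) * (A * norm (snd p - fst p))"
        using joint_asymmetry[OF \<eta>(1), of "fst p" "snd p"] j
        by (intro mult_mono) (auto simp: flip_def)
      then show "\<bar>(joint \<eta> p - joint \<eta> (flip p)) * f p\<bar> \<le> A * (joint \<eta> p * k p + joint \<eta> (flip p) * k p)"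
        unfolding abs_mult k_def by (simp add: distrib_left distrib_right mult_ac)
    qed
    also have "\<dots> = A * (2 * (\<integral>p. k (next_pair \<eta> p) \<partial>?P))"
      using kL kS by (simp add: Bochner_Integration.integral_add)
    also have "\<dots> \<le> A * (2 * (C * \<eta>\<^sup>2 * I))"
      using k_le A by (intro mult_left_mono) auto
    finally have "\<bar>D\<bar> \<le> C * I * A * \<eta>\<^sup>2" by (simp add: abs_mult mult_ac)
    then show "\<bar>(\<integral>x. euler \<eta> g x \<partial>gibbs U) - (\<integral>x. g x \<partial>gibbs U)\<bar> \<le> C * I * A * \<eta>\<^sup>2"
      by (simp add: step D_def)
  qed
qed

end


section \<open>Functions of the past are independent of new noise\<close>

text \<open>
  A state of a recursively defined process is a function of the noise used so far. It is enough to
  check this, as measurability with respect to the generated \<open>\<sigma>\<close>-algebra, to obtain independence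
  of the noise used next.
\<close>

lemma (in prob_space) indep_var_of_past:
  fixes Y W :: "'a \<Rightarrow> 'c::topological_space"
  assumes indep: "indep_sets E I"
    and stable: "\<And>i. i \<in> I \<Longrightarrow> Int_stable (E i)"
    and j: "j \<in> I" and J: "J \<subseteq> I - {j}"
    and Y: "Y \<in> borel_measurable (sigma (space M) (\<Union>i\<in>J. E i))"
    and W: "W \<in> borel_measurable M" "{W -` A \<inter> space M |A. A \<in> sets borel} \<subseteq> E j"
  shows "indep_var borel Y borel W"
proof -
  have ev: "E i \<subseteq> events" if "i \<in> I" for i using indep that by (auto simp: indep_sets_def)
  then have J_Pow: "(\<Union>i\<in>J. E i) \<subseteq> Pow (space M)" and J_ev: "(\<Union>i\<in>J. E i) \<subseteq> events"
    using J sets.space_closed by blast+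
  let ?K = "\<lambda>b. if b then J else {j}"
  have "indep_sets (\<lambda>b. sigma_sets (space M) (\<Union>i\<in>?K b. E i)) (UNIV :: bool set)"
  proof (rule indep_sets_collect_sigma)
    show "indep_sets E (\<Union>b\<in>UNIV. ?K b)"
      using J j by (intro indep_sets_mono_index[OF _ indep]) auto
    show "Int_stable (E i)" if "i \<in> ?K b" for i b using that J j stable by (auto split: if_splits)
    show "disjoint_family_on ?K UNIV" using J by (auto simp: disjoint_family_on_def)
  qed
  then have ind: "indep_set (sigma_sets (space M) (\<Union>i\<in>J. E i)) (sigma_sets (space M) (E j))"
    unfolding indep_set_def by (rule indep_sets_mono_sets) (auto split: bool.splits)
  have Y_sub: "sigma_sets (space M) {Y -` A \<inter> space M |A. A \<in> sets borel} \<subseteq> sigma_sets (space M) (\<Union>i\<in>J. E i)"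
  proof (rule sigma_sets_mono, safe)
    fix A :: "'c set" assume "A \<in> sets borel"
    from measurable_sets[OF Y this] show "Y -` A \<inter> space M \<in> sigma_sets (space M) (\<Union>i\<in>J. E i)"
      using J_Pow by (simp add: space_measure_of sets_measure_of)
  qed
  have "Y \<in> borel_measurable (measure_of (space M) events (emeasure M))"
    by (rule subsetD[OF measurable_mono1 Y]) (use J_ev sets.space_closed[of M] in blast)+
  then have "Y \<in> borel_measurable M" by (simp add: measure_of_of_measure)
  moreover have "sigma_sets (space M) {W -` A \<inter> space M |A. A \<in> sets borel} \<subseteq> sigma_sets (space M) (E j)"
    using W(2) by (rule sigma_sets_mono')
  ultimately show ?thesis
    unfolding indep_var_eq using W(1) ind Y_sub
    unfolding indep_sets2_eq by blast
qed

lemma measurable_past_mono: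
  assumes "Y \<in> borel_measurable (sigma \<Omega> (\<Union>i\<in>J. E i))" "J \<subseteq> J'" "(\<Union>i\<in>J'. E i) \<subseteq> Pow \<Omega>"
  shows "Y \<in> borel_measurable (sigma \<Omega> (\<Union>i\<in>J'. E i))"
  by (rule subsetD[OF measurable_mono1 assms(1)]) (use assms in auto)

lemma measurable_past:
  assumes "{W -` A \<inter> \<Omega> |A. A \<in> sets N} \<subseteq> E j" "j \<in> J" "(\<Union>i\<in>J. E i) \<subseteq> Pow \<Omega>" "W \<in> \<Omega> \<rightarrow> space N"
  shows "W \<in> sigma \<Omega> (\<Union>i\<in>J. E i) \<rightarrow>\<^sub>M N"
proof (rule measurableI)
  fix A assume "A \<in> sets N"
  then have "W -` A \<inter> \<Omega> \<in> (\<Union>i\<in>J. E i)" using assms by blast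
  then show "W -` A \<inter> space (sigma \<Omega> (\<Union>i\<in>J. E i)) \<in> sets (sigma \<Omega> (\<Union>i\<in>J. E i))"
    using assms(3) by (simp add: space_measure_of sets_measure_of sigma_sets.Basic)
qed (use assms(3,4) in \<open>auto simp: space_measure_of\<close>)

lemma (in prob_space) expectation_of_indep_pair:
  fixes f :: "'c::second_countable_topology \<times> 'c \<Rightarrow> real"
  assumes ind: "indep_var borel Y borel W"
    and [measurable]: "f \<in> borel_measurable (borel \<Otimes>\<^sub>M borel)"
    and int: "integrable M (\<lambda>\<omega>. f (Y \<omega>, W \<omega>))"
  shows "expectation (\<lambda>\<omega>. f (Y \<omega>, W \<omega>)) = expectation (\<lambda>\<omega>. \<integral>w. f (Y \<omega>, w) \<partial>distr M borel W)"
proof -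
  have [measurable]: "Y \<in> borel_measurable M" "W \<in> borel_measurable M"
    using ind by (auto dest: indep_var_rv1 indep_var_rv2)
  let ?A = "distr M borel Y" and ?B = "distr M borel W"
  interpret A: prob_space ?A by (rule prob_space_distr) simp
  interpret B: prob_space ?B by (rule prob_space_distr) simp
  interpret AB: pair_prob_space ?A ?B ..
  have eq: "distr M (borel \<Otimes>\<^sub>M borel) (\<lambda>\<omega>. (Y \<omega>, W \<omega>)) = ?A \<Otimes>\<^sub>M ?B"
    using ind unfolding indep_var_distribution_eq by simp
  have "integrable (distr M (borel \<Otimes>\<^sub>M borel) (\<lambda>\<omega>. (Y \<omega>, W \<omega>))) f"
    using int by (subst integrable_distr_eq) auto
  then have i: "integrable (?A \<Otimes>\<^sub>M ?B) f" by (simp add: eq)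
  have "expectation (\<lambda>\<omega>. f (Y \<omega>, W \<omega>)) = (\<integral>p. f p \<partial>(?A \<Otimes>\<^sub>M ?B))"
    unfolding eq[symmetric] by (subst integral_distr) auto
  also have "\<dots> = (\<integral>y. \<integral>w. f (y, w) \<partial>?B \<partial>?A)" by (rule AB.integral_fst'[symmetric, OF i])
  also have "\<dots> = expectation (\<lambda>\<omega>. \<integral>w. f (Y \<omega>, w) \<partial>?B)"
    using B.borel_measurable_lebesgue_integral[of "\<lambda>y w. f (y, w)" borel]
    by (subst integral_distr) auto
  finally show ?thesis .
qed

lemma (in prob_space) expectation_inner_indep_centred:
  fixes V W :: "'a \<Rightarrow> 'c::euclidean_space"
  assumes ind: "indep_var borel V borel W"
    and V: "integrable M V" and W: "integrable M W" "expectation W = 0"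
  shows "integrable M (\<lambda>\<omega>. V \<omega> \<bullet> W \<omega>)" "expectation (\<lambda>\<omega>. V \<omega> \<bullet> W \<omega>) = 0"
proof -
  have ind_b: "indep_var borel (\<lambda>\<omega>. V \<omega> \<bullet> b) borel (\<lambda>\<omega>. W \<omega> \<bullet> b)" for b
    using indep_var_compose[OF ind, of "\<lambda>v. v \<bullet> b" borel "\<lambda>v. v \<bullet> b" borel] by (simp add: comp_def)
  have 1: "integrable M (\<lambda>\<omega>. (V \<omega> \<bullet> b) * (W \<omega> \<bullet> b))" for b
    using V W by (intro indep_var_integrable ind_b) auto
  have 2: "expectation (\<lambda>\<omega>. (V \<omega> \<bullet> b) * (W \<omega> \<bullet> b)) = 0" for b
    using V W by (subst indep_var_lebesgue_integral[OF ind_b]) auto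
  have eq: "(\<lambda>\<omega>. V \<omega> \<bullet> W \<omega>) = (\<lambda>\<omega>. \<Sum>b\<in>Basis. (V \<omega> \<bullet> b) * (W \<omega> \<bullet> b))"
    by (intro ext euclidean_inner)
  show "integrable M (\<lambda>\<omega>. V \<omega> \<bullet> W \<omega>)"
    unfolding eq using 1 by auto
  show "expectation (\<lambda>\<omega>. V \<omega> \<bullet> W \<omega>) = 0"
    unfolding eq using 1 2 by (subst Bochner_Integration.integral_sum) auto
qed


context strongly_convex_potential
begin

section \<open>The Langevin diffusion approaches the Gibbs measure\<close>

lemma euler_iterate_lipschitz:
  assumes "A-lipschitz_on UNIV g" "0 \<le> \<eta>" "\<eta> \<le> \<eta>\<^sub>0"
  shows "((1 - \<beta> * \<eta>) ^ n * A)-lipschitz_on UNIV ((euler \<eta> ^^ n) g)"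
proof (induction n)
  case (Suc n)
  from euler_lipschitz[OF this assms(2,3)] show ?case by (simp add: mult.assoc)
qed (use assms in simp)

definition gibbs_moment :: real where "gibbs_moment = (\<integral>x. norm x \<partial>gibbs U)"

lemma gibbs_integrable_norm: "integrable (gibbs U) norm"
  by (rule gibbs_integrable_lipschitz[of 1]) (auto intro!: lipschitz_onI simp: dist_norm norm_triangle_ineq3)

lemma gibbs_moment_nonneg: "0 \<le> gibbs_moment"
  unfolding gibbs_moment_def by (rule integral_nonneg_AE) auto

lemma lipschitz_minus_gibbs_mean:
  assumes g: "A-lipschitz_on UNIV g"
  shows "\<bar>g x - (\<integral>y. g y \<partial>gibbs U)\<bar> \<le> A * (norm x + gibbs_moment)"
proof -
  have A: "0 \<le> A" using g lipschitz_on_nonneg by blast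
  have "g x - (\<integral>y. g y \<partial>gibbs U) = (\<integral>y. g x - g y \<partial>gibbs U)"
    using gibbs_integrable_lipschitz[OF g] gibbs.prob_space
    by (subst Bochner_Integration.integral_diff) auto
  also have "\<bar>\<dots>\<bar> \<le> (\<integral>y. A * (norm x + norm y) \<partial>gibbs U)"
  proof (rule order_trans[OF integral_abs_bound integral_mono])
    show "integrable (gibbs U) (\<lambda>y. \<bar>g x - g y\<bar>)"
      using gibbs_integrable_lipschitz[OF g] by (intro integrable_abs Bochner_Integration.integrable_diff) auto
    show "integrable (gibbs U) (\<lambda>y. A * (norm x + norm y))"
      using gibbs_integrable_norm by (intro integrable_mult_right Bochner_Integration.integrable_add) auto
    fix y
    have "\<bar>g x - g y\<bar> \<le> A * norm (x - y)"
      using lipschitz_onD[OF g, of x y] by (simp add: dist_norm)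
    also have "\<dots> \<le> A * (norm x + norm y)" by (intro mult_left_mono A norm_triangle_ineq4)
    finally show "\<bar>g x - g y\<bar> \<le> A * (norm x + norm y)" .
  qed
  also have "\<dots> = A * (norm x + gibbs_moment)"
    using gibbs_integrable_norm gibbs.prob_space
    by (simp add: gibbs_moment_def Bochner_Integration.integral_add)
  finally show ?thesis .
qed

text \<open>
  The kernel contracts, so the starting point is forgotten exponentially fast, and each step moves
  the mean under the Gibbs measure by order \<open>\<eta>\<^sup>2\<close> only. For \<open>n\<close> steps of length \<open>t / n\<close> the second
  error vanishes in the limit.
\<close>

lemma euler_iterate_gibbs:
  obtains C where "0 \<le> C"
    "\<And>A g \<eta> n x. \<lbrakk>A-lipschitz_on UNIV g; 0 < \<eta>; \<eta> \<le> \<eta>\<^sub>0\<rbrakk> \<Longrightarrow>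
       \<bar>(euler \<eta> ^^ n) g x - (\<integral>y. g y \<partial>gibbs U)\<bar>
         \<le> (1 - \<beta> * \<eta>) ^ n * A * (norm x + gibbs_moment) + real n * (C * A * \<eta>\<^sup>2)"
proof -
  obtain C where C: "0 \<le> C"
    "\<And>A g \<eta>. \<lbrakk>A-lipschitz_on UNIV g; 0 < \<eta>; \<eta> \<le> 1\<rbrakk> \<Longrightarrow>
       \<bar>(\<integral>x. euler \<eta> g x \<partial>gibbs U) - (\<integral>x. g x \<partial>gibbs U)\<bar> \<le> C * A * \<eta>\<^sup>2"
    using euler_gibbs_invariance_defect by blast
  show ?thesis
  proof (rule that[OF C(1)])
    fix A \<eta> :: real and g :: "'a \<Rightarrow> real" and n x
    assume g: "A-lipschitz_on UNIV g" and \<eta>: "0 < \<eta>" "\<eta> \<le> \<eta>\<^sub>0"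
    have A: "0 \<le> A" using g lipschitz_on_nonneg by blast
    have r: "0 \<le> 1 - \<beta> * \<eta>" "1 - \<beta> * \<eta> \<le> 1" using \<beta>_\<eta>[OF \<eta>(2)] \<beta>_pos \<eta> by auto
    note lip = euler_iterate_lipschitz[OF g less_imp_le[OF \<eta>(1)] \<eta>(2)]
    have "\<bar>(\<integral>y. (euler \<eta> ^^ n) g y \<partial>gibbs U) - (\<integral>y. g y \<partial>gibbs U)\<bar> \<le> real n * (C * A * \<eta>\<^sup>2)"
    proof (induction n)
      case (Suc n)
      have "\<bar>(\<integral>y. euler \<eta> ((euler \<eta> ^^ n) g) y \<partial>gibbs U) - (\<integral>y. (euler \<eta> ^^ n) g y \<partial>gibbs U)\<bar>
        \<le> C * ((1 - \<beta> * \<eta>) ^ n * A) * \<eta>\<^sup>2"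
        using \<eta> \<eta>\<^sub>0_le_1 by (intro C(2) lip) auto
      also have "\<dots> \<le> C * (1 * A) * \<eta>\<^sup>2"
        using r A C(1) by (intro mult_right_mono mult_left_mono power_le_one) auto
      finally show ?case using Suc by (simp add: algebra_simps)
    qed simp
    moreover have "\<bar>(euler \<eta> ^^ n) g x - (\<integral>y. (euler \<eta> ^^ n) g y \<partial>gibbs U)\<bar>
      \<le> (1 - \<beta> * \<eta>) ^ n * A * (norm x + gibbs_moment)"
      by (rule lipschitz_minus_gibbs_mean[OF lip])
    ultimately show "\<bar>(euler \<eta> ^^ n) g x - (\<integral>y. g y \<partial>gibbs U)\<bar>
         \<le> (1 - \<beta> * \<eta>) ^ n * A * (norm x + gibbs_moment) + real n * (C * A * \<eta>\<^sup>2)" by linarith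
  qed
qed

text \<open>
  Driving the scheme by the Brownian path of the diffusion makes the two comparable path by path,
  while its law is an iterate of the Euler kernel.
\<close>

primrec euler_path :: "(real \<Rightarrow> 'w \<Rightarrow> 'a) \<Rightarrow> real \<Rightarrow> 'a \<Rightarrow> nat \<Rightarrow> 'w \<Rightarrow> 'a" where
  "euler_path B \<eta> x 0 = (\<lambda>w. x)"
| "euler_path B \<eta> x (Suc j) = (\<lambda>w. euler_path B \<eta> x j w - \<eta> *\<^sub>R F (euler_path B \<eta> x j w)
     + sqrt 2 *\<^sub>R (B (real (Suc j) * \<eta>) w - B (real j * \<eta>) w))"

lemma euler_path_law:
  fixes M :: "'w measure"
  assumes B: "brownian_motion M B" and \<eta>: "0 < \<eta>" "\<eta> \<le> \<eta>\<^sub>0"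
  shows euler_path_integrable: "integrable M (euler_path B \<eta> x n)"
    and euler_path_expectation:
      "A-lipschitz_on UNIV g \<Longrightarrow> (\<integral>w. g (euler_path B \<eta> x n w) \<partial>M) = (euler \<eta> ^^ n) g x"
proof -
  interpret prob_space M using B by (simp add: brownian_motion_def)
  define W where "W i w = B (real (Suc i) * \<eta>) w - B (real i * \<eta>) w" for i w
  have [measurable]: "B t \<in> borel_measurable M" if "0 \<le> t" for t
    using B that by (simp add: brownian_motion_def)
  have W_meas [measurable]: "W i \<in> borel_measurable M" for i
    unfolding W_def[abs_def] using \<eta> by (intro borel_measurable_diff) auto
  have W_law: "distr M borel (W i) = distr std_gaussian borel (\<lambda>z. sqrt \<eta> *\<^sub>R z)" for i
  proof -
    have "0 \<le> real i * \<eta> \<and> real i * \<eta> \<le> real (Suc i) * \<eta>" using \<eta> by auto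
    then have "distr M borel (\<lambda>w. B (real (Suc i) * \<eta>) w - B (real i * \<eta>) w)
      = distr std_gaussian borel (\<lambda>z. sqrt (real (Suc i) * \<eta> - real i * \<eta>) *\<^sub>R z)"
      using B unfolding brownian_motion_def by blast
    then show ?thesis by (simp add: W_def[abs_def] algebra_simps)
  qed
  have W_indep: "indep_vars (\<lambda>_. borel) W {..<n}" for n
    using B \<eta> unfolding brownian_motion_def W_def[abs_def]
    by (auto dest!: spec[of _ n] spec[of _ "\<lambda>i. real i * \<eta>"])
  have W_int: "integrable M (W i)" for i
  proof -
    have "integrable (distr M borel (W i)) (\<lambda>z. z)"
      unfolding W_law using std_gaussian_integrable_id
      by (subst integrable_distr_eq) auto
    then show ?thesis by (subst (asm) integrable_distr_eq) auto
  qed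
  let ?E = "\<lambda>i. {W i -` A \<inter> space M |A. A \<in> sets borel}"
  let ?Y = "euler_path B \<eta> x"
  have E_Pow: "(\<Union>i\<in>J. ?E i) \<subseteq> Pow (space M)" for J by auto
  have Y_past: "?Y j \<in> borel_measurable (sigma (space M) (\<Union>i\<in>{..<j}. ?E i))" for j
  proof (induction j)
    case (Suc j)
    have [measurable]: "?Y j \<in> borel_measurable (sigma (space M) (\<Union>i\<in>{..<Suc j}. ?E i))"
      by (rule measurable_past_mono[OF Suc _ E_Pow]) auto
    have [measurable]: "W j \<in> borel_measurable (sigma (space M) (\<Union>i\<in>{..<Suc j}. ?E i))"
      by (rule measurable_past[of _ _ _ _ j, OF _ _ E_Pow]) auto
    show ?case unfolding euler_path.simps W_def[symmetric] by measurable
  qed simp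
  have indep: "indep_var borel (?Y j) borel (W j)" for j
  proof (rule indep_var_of_past[of ?E "{..<Suc j}" j "{..<j}"])
    show "indep_sets ?E {..<Suc j}" using W_indep[of "Suc j"] unfolding indep_vars_def2 by blast
    show "Int_stable (?E i)" for i
      unfolding Int_stable_def by (safe, rule_tac x="A \<inter> Aa" in exI) auto
  qed (use Y_past W_meas in auto)
  show int: "integrable M (?Y n)" for n
  proof (induction n)
    case (Suc n)
    have m: "?Y n \<in> borel_measurable M" using indep_var_rv1[OF indep] .
    have "integrable M (\<lambda>w. F (?Y n w))" by (rule integrable_lipschitz[OF F_lipschitz Suc])
    then show ?case using Suc W_int[of n]
      unfolding euler_path.simps W_def[symmetric]
      by (intro Bochner_Integration.integrable_add Bochner_Integration.integrable_diff) auto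
  qed simp
  show "(\<integral>w. g (?Y n w) \<partial>M) = (euler \<eta> ^^ n) g x" if "A-lipschitz_on UNIV g"
    using that
  proof (induction n arbitrary: g A)
    case 0
    then show ?case using prob_space by simp
  next
    case (Suc n)
    note g = Suc.prems
    have [measurable]: "g \<in> borel_measurable borel"
      by (rule lipschitz_borel_measurable[OF g])
    define f where "f p = g (fst p - \<eta> *\<^sub>R F (fst p) + sqrt 2 *\<^sub>R snd p)" for p
    have [measurable]: "f \<in> borel_measurable (borel \<Otimes>\<^sub>M borel)" unfolding f_def[abs_def] by measurable
    have gY: "integrable M (\<lambda>w. g (?Y (Suc n) w))"
      by (rule integrable_lipschitz[OF g int])
    moreover have gf: "(\<lambda>w. g (?Y (Suc n) w)) = (\<lambda>w. f (?Y n w, W n w))"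
      by (simp add: f_def W_def)
    ultimately have "integrable M (\<lambda>w. f (?Y n w, W n w))" by simp
    from expectation_of_indep_pair[OF indep _ this]
    have "(\<integral>w. g (?Y (Suc n) w) \<partial>M) = (\<integral>w. \<integral>z. f (?Y n w, z) \<partial>distr M borel (W n) \<partial>M)"
      unfolding gf by simp
    also have "\<dots> = (\<integral>w. euler \<eta> g (?Y n w) \<partial>M)"
      unfolding W_law euler_def f_def fst_conv snd_conv
      by (subst integral_distr) (auto simp: real_sqrt_mult)
    also have "\<dots> = (euler \<eta> ^^ Suc n) g x"
      using Suc.IH[OF euler_lipschitz[OF g less_imp_le[OF \<eta>(1)] \<eta>(2)]] by (simp add: funpow_swap1)
    finally show ?case .
  qed
qed

text \<open>
  The noise is additive, so it cancels in the difference of the path and its Euler scheme: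
  convergence holds for every continuous path, by Gronwall's inequality for the drift alone.
\<close>

lemma euler_path_converges:
  fixes B :: "real \<Rightarrow> 'w \<Rightarrow> 'a"
  assumes t: "0 < t" and cont: "continuous_on {0..} (\<lambda>s. X s w)"
    and sol: "\<And>s. 0 \<le> s \<Longrightarrow> X s w = x - integral {0..s} (\<lambda>r. F (X r w)) + sqrt 2 *\<^sub>R B s w"
    and B0: "B 0 w = 0"
  shows "(\<lambda>N. euler_path B (t / real N) x N w) \<longlonglongrightarrow> X t w"
proof (rule LIMSEQ_I)
  fix e :: real assume e: "0 < e"
  define \<phi> where "\<phi> r = F (X r w)" for r
  have cF: "continuous_on {0..} \<phi>"
    unfolding \<phi>_def[abs_def] using continuous_on_compose2[OF F_continuous cont] by simp
  define E where "E = exp (\<Lambda> * t)"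
  have E: "1 \<le> E" using t \<Lambda>_pos by (simp add: E_def)
  define \<epsilon> where "\<epsilon> = e / (2 * t * E)"
  have \<epsilon>: "0 < \<epsilon>" using e t E by (simp add: \<epsilon>_def)
  have "uniformly_continuous_on {0..t} \<phi>"
    by (intro compact_uniformly_continuous continuous_on_subset[OF cF]) auto
  then obtain d where d: "0 < d" "\<And>r s. \<lbrakk>r \<in> {0..t}; s \<in> {0..t}; \<bar>r - s\<bar> < d\<rbrakk> \<Longrightarrow> norm (\<phi> r - \<phi> s) < \<epsilon>"
    unfolding uniformly_continuous_on_def dist_norm using \<epsilon> by (metis real_norm_def)
  obtain N0 :: nat where N0: "t / d < real N0" using reals_Archimedean2 by blast
  show "\<exists>no. \<forall>n\<ge>no. norm (euler_path B (t / real n) x n w - X t w) < e"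
  proof (intro exI[of _ "Suc N0"] allI impI)
    fix N assume N: "Suc N0 \<le> N"
    define \<eta> where "\<eta> = t / real N"
    have N': "0 < real N" "t / d < real N" using N N0 by auto
    have \<eta>: "0 < \<eta>" "\<eta> < d" using N' t d by (auto simp: \<eta>_def field_simps)
    define D where "D j = norm (euler_path B \<eta> x j w - X (real j * \<eta>) w)" for j
    have step: "D (Suc j) \<le> (1 + \<eta> * \<Lambda>) * D j + \<eta> * \<epsilon>" if j: "j < N" for j
    proof -
      let ?s = "real j * \<eta>" and ?s' = "real (Suc j) * \<eta>"
      have s: "0 \<le> ?s" "?s \<le> ?s'" "?s' \<le> t" "?s' - ?s = \<eta>"
      proof -
        have "real (Suc j) * \<eta> \<le> real N * \<eta>" using j \<eta> by (intro mult_right_mono) auto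
        then show "?s' \<le> t" using N' by (simp add: \<eta>_def)
      qed (use \<eta> in \<open>auto simp: algebra_simps\<close>)
      have io: "\<phi> integrable_on {a..b}" if "0 \<le> a" for a b
        using that by (intro integrable_continuous_real continuous_on_subset[OF cF]) auto
      have "integral {0..?s'} \<phi> = integral {0..?s} \<phi> + integral {?s..?s'} \<phi>"
        using s by (intro Henstock_Kurzweil_Integration.integral_combine[symmetric] io) auto
      moreover have "X ?s w = x - integral {0..?s} \<phi> + sqrt 2 *\<^sub>R B ?s w"
        "X ?s' w = x - integral {0..?s'} \<phi> + sqrt 2 *\<^sub>R B ?s' w"
        unfolding \<phi>_def using s by (intro sol; linarith)+
      ultimately have X': "X ?s' w = X ?s w - integral {?s..?s'} \<phi> + sqrt 2 *\<^sub>R (B ?s' w - B ?s w)"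
        by (simp only: scaleR_diff_right) (simp only: algebra_simps)
      have "norm (integral {?s..?s'} (\<lambda>r. \<phi> r - \<phi> ?s)) \<le> \<epsilon> * (?s' - ?s)"
      proof (rule integral_bound)
        show "continuous_on {?s..?s'} (\<lambda>r. \<phi> r - \<phi> ?s)"
          using s by (intro continuous_intros continuous_on_subset[OF cF]) auto
        show "norm (\<phi> r - \<phi> ?s) \<le> \<epsilon>" if "r \<in> {?s..?s'}" for r
        proof -
          have "0 \<le> r" "r \<le> t" "\<bar>r - ?s\<bar> < d" "?s \<le> t"
            using s \<eta> that unfolding atLeastAtMost_iff by linarith+
          then show ?thesis using s(1) by (intro less_imp_le[OF d(2)]) simp_all
        qed
      qed (rule s)
      moreover have "integral {?s..?s'} (\<lambda>r. \<phi> r - \<phi> ?s) = integral {?s..?s'} \<phi> - \<eta> *\<^sub>R \<phi> ?s"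
        using s io by (subst Henstock_Kurzweil_Integration.integral_diff) auto
      ultimately have q: "norm (integral {?s..?s'} \<phi> - \<eta> *\<^sub>R \<phi> ?s) \<le> \<epsilon> * \<eta>" using s by simp
      let ?Y = "euler_path B \<eta> x j w"
      have "euler_path B \<eta> x (Suc j) w - X ?s' w
        = (?Y - X ?s w) - \<eta> *\<^sub>R (F ?Y - F (X ?s w)) + (integral {?s..?s'} \<phi> - \<eta> *\<^sub>R \<phi> ?s)"
        unfolding X' euler_path.simps by (simp add: \<phi>_def scaleR_diff_right)
      moreover have "norm (p - \<eta> *\<^sub>R q + r) \<le> norm p + \<eta> * norm q + norm r" for p q r :: 'a
        using norm_triangle_ineq[of "p - \<eta> *\<^sub>R q" r] norm_triangle_ineq4[of p "\<eta> *\<^sub>R q"] \<eta> by simp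
      ultimately have "D (Suc j) \<le> norm (?Y - X ?s w) + \<eta> * norm (F ?Y - F (X ?s w))
          + norm (integral {?s..?s'} \<phi> - \<eta> *\<^sub>R \<phi> ?s)"
        unfolding D_def by (simp only:)
      then have "D (Suc j) \<le> norm (?Y - X ?s w) + \<eta> * norm (F ?Y - F (X ?s w)) + \<epsilon> * \<eta>"
        using q by linarith
      also have "\<dots> \<le> D j + \<eta> * (\<Lambda> * D j) + \<epsilon> * \<eta>"
        using F_lip[of ?Y "X ?s w"] \<eta> by (simp add: D_def)
      finally show ?thesis by (simp add: algebra_simps)
    qed
    have "D j \<le> real j * \<eta> * \<epsilon> * (1 + \<eta> * \<Lambda>) ^ j" if "j \<le> N" for j
      using that
    proof (induction j)
      case 0
      then show ?case using sol[of 0] B0 by (simp add: D_def)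
    next
      case (Suc j)
      have a: "1 \<le> 1 + \<eta> * \<Lambda>" using \<eta> \<Lambda>_pos by simp
      have "D (Suc j) \<le> (1 + \<eta> * \<Lambda>) * (real j * \<eta> * \<epsilon> * (1 + \<eta> * \<Lambda>) ^ j) + \<eta> * \<epsilon>"
        using Suc a by (intro order_trans[OF step] add_mono mult_left_mono order_refl) linarith+
      also have "\<eta> * \<epsilon> \<le> \<eta> * \<epsilon> * (1 + \<eta> * \<Lambda>) ^ Suc j"
        using \<eta> \<epsilon> one_le_power[OF a, of "Suc j"] mult_left_mono[of 1 "(1 + \<eta> * \<Lambda>) ^ Suc j" "\<eta> * \<epsilon>"]
        by simp
      finally show ?case by (simp add: algebra_simps)
    qed
    from this[of N] have "D N \<le> t * \<epsilon> * (1 + \<eta> * \<Lambda>) ^ N"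
      using N' by (simp add: \<eta>_def)
    also have "\<dots> \<le> t * \<epsilon> * E"
    proof -
      have "(1 + \<eta> * \<Lambda>) ^ N \<le> exp (\<eta> * \<Lambda>) ^ N"
        using \<eta> \<Lambda>_pos by (intro power_mono) (auto simp: exp_ge_add_one_self add_nonneg_nonneg)
      also have "\<dots> = E" using N' by (simp add: E_def \<eta>_def exp_of_nat_mult[symmetric] mult.commute)
      finally show ?thesis using t \<epsilon> by (intro mult_left_mono) auto
    qed
    also have "\<dots> = e / 2" using t E by (simp add: \<epsilon>_def)
    also have "\<dots> < e" using e by simp
    finally show "norm (euler_path B (t / real N) x N w - X t w) < e"
      using N' by (simp add: D_def \<eta>_def)
  qed
qed

end


context strongly_convex_potential
begin

text \<open>
  The bound for the Euler scheme with \<open>N\<close> steps of length \<open>t / N\<close> passes to the limit, in which the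
  defect of invariance disappears and the contraction remains. Only first moments are under control
  along the sequence, so the limit is taken for truncated test functions first.
\<close>

lemma langevin_close_to_gibbs:
  fixes M :: "'w measure"
  assumes B: "brownian_motion M B" and X: "langevin_solution M U B x X"
    and gradU: "\<And>y. grad U y = F y" and t: "0 < t"
  shows langevin_integrable: "integrable M (X t)"
    and langevin_gibbs_bound:
      "A-lipschitz_on UNIV g \<Longrightarrow>
        \<bar>(\<integral>w. g (X t w) \<partial>M) - (\<integral>y. g y \<partial>gibbs U)\<bar> \<le> exp (- \<beta> * t) * A * (norm x + gibbs_moment)"
proof -
  interpret prob_space M using B by (simp add: brownian_motion_def)
  obtain C where C: "0 \<le> C"
    "\<And>A g \<eta> n x. \<lbrakk>A-lipschitz_on UNIV g; 0 < \<eta>; \<eta> \<le> \<eta>\<^sub>0\<rbrakk> \<Longrightarrow>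
       \<bar>(euler \<eta> ^^ n) g x - (\<integral>y. g y \<partial>gibbs U)\<bar>
         \<le> (1 - \<beta> * \<eta>) ^ n * A * (norm x + gibbs_moment) + real n * (C * A * \<eta>\<^sup>2)"
    using euler_iterate_gibbs by blast
  have X_meas [measurable]: "X t \<in> borel_measurable M"
    using X t by (simp add: langevin_solution_def)
  define Y where "Y N = euler_path B (t / real N) x N" for N
  have ev_small: "\<forall>\<^sub>F N in sequentially. 0 < t / real N \<and> t / real N \<le> \<eta>\<^sub>0"
  proof -
    obtain N0 :: nat where N0: "t / \<eta>\<^sub>0 < real N0" using reals_Archimedean2 by blast
    have "0 < t / real N \<and> t / real N \<le> \<eta>\<^sub>0" if "N \<ge> Suc N0" for N
    proof -
      have "0 < real N" "t / \<eta>\<^sub>0 < real N" using that N0 by auto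
      then show ?thesis using t \<eta>\<^sub>0_pos by (auto simp: field_simps)
    qed
    then show ?thesis unfolding eventually_sequentially by blast
  qed
  have conv: "AE w in M. (\<lambda>N. Y N w) \<longlonglongrightarrow> X t w"
  proof -
    have "AE w in M. B 0 w = 0" using B by (simp add: brownian_motion_def)
    moreover have "AE w in M. continuous_on {0..} (\<lambda>s. X s w)"
      "AE w in M. \<forall>s\<ge>0. X s w = x - integral {0..s} (\<lambda>r. F (X r w)) + sqrt 2 *\<^sub>R B s w"
      using X by (auto simp: langevin_solution_def gradU)
    ultimately show ?thesis
    proof eventually_elim
      case (elim w)
      then show ?case unfolding Y_def using t by (intro euler_path_converges) auto
    qed
  qed
  have bound: "\<forall>\<^sub>F N in sequentially. \<bar>(\<integral>w. g (Y N w) \<partial>M) - (\<integral>y. g y \<partial>gibbs U)\<bar>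
      \<le> exp (- \<beta> * t) * A * (norm x + gibbs_moment) + C * A * t\<^sup>2 / real N"
    if g: "A-lipschitz_on UNIV g" for A g
    using ev_small
  proof eventually_elim
    case (elim N)
    have A: "0 \<le> A" using g lipschitz_on_nonneg by blast
    have N: "0 < real N" using elim t by (cases "N = 0") auto
    have "0 \<le> 1 - \<beta> * (t / real N)" using \<beta>_\<eta>[of "t / real N"] elim by linarith
    then have "(1 - \<beta> * (t / real N)) ^ N \<le> exp (- \<beta> * (t / real N)) ^ N"
      using exp_ge_add_one_self[of "- \<beta> * (t / real N)"]
      by (intro power_mono) auto
    also have "\<dots> = exp (- \<beta> * t)" using N by (simp add: exp_of_nat_mult[symmetric])
    finally have "(1 - \<beta> * (t / real N)) ^ N * A * (norm x + gibbs_moment)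
        \<le> exp (- \<beta> * t) * A * (norm x + gibbs_moment)"
      using A gibbs_moment_nonneg by (intro mult_right_mono) auto
    moreover have "real N * (C * A * (t / real N)\<^sup>2) = C * A * t\<^sup>2 / real N"
      using N by (simp add: power2_eq_square field_simps)
    moreover have "(\<integral>w. g (Y N w) \<partial>M) = (euler (t / real N) ^^ N) g x"
      unfolding Y_def using elim by (intro euler_path_expectation[OF B _ _ g]) auto
    ultimately show ?case using C(2)[OF g, of "t / real N" N x] elim by simp
  qed
  have lip_norm: "1-lipschitz_on UNIV (norm :: 'a \<Rightarrow> real)"
    by (auto intro!: lipschitz_onI simp: dist_norm norm_triangle_ineq3)
  have Y_int: "\<forall>\<^sub>F N in sequentially. integrable M (Y N)"
    using ev_small by eventually_elim (auto simp: Y_def intro: euler_path_integrable[OF B])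
  \<comment> \<open>Fatou's lemma gives the first moment of the limit.\<close>
  show X_int: "integrable M (X t)"
  proof (rule integrableI_bounded)
    define b where "b = 2 * gibbs_moment + norm x + C * t\<^sup>2"
    have "\<forall>\<^sub>F N in sequentially. (\<integral>\<^sup>+w. ennreal (norm (Y N w)) \<partial>M) \<le> ennreal b"
      using bound[OF lip_norm] Y_int eventually_gt_at_top[of 0]
    proof eventually_elim
      case (elim N)
      have "exp (- \<beta> * t) * 1 * (norm x + gibbs_moment) \<le> 1 * 1 * (norm x + gibbs_moment)"
        using \<beta>_pos t gibbs_moment_nonneg by (intro mult_right_mono) auto
      moreover have "C * 1 * t\<^sup>2 / real N \<le> C * t\<^sup>2"
        using elim C(1) divide_left_mono[of 1 "real N" "C * t\<^sup>2"] by simp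
      ultimately have "(\<integral>w. norm (Y N w) \<partial>M) \<le> b"
        using elim(1) by (simp add: b_def gibbs_moment_def)
      moreover have "(\<integral>\<^sup>+w. ennreal (norm (Y N w)) \<partial>M) = ennreal (\<integral>w. norm (Y N w) \<partial>M)"
        using elim(2) by (intro nn_integral_eq_integral) auto
      ultimately show ?case by (simp add: ennreal_leI)
    qed
    then obtain N0 where N0: "\<And>N. N \<ge> N0 \<Longrightarrow> (\<integral>\<^sup>+w. ennreal (norm (Y N w)) \<partial>M) \<le> ennreal b \<and> integrable M (Y N)"
      using eventually_conj[OF _ Y_int] unfolding eventually_sequentially by metis
    have "(\<integral>\<^sup>+w. ennreal (norm (X t w)) \<partial>M) = (\<integral>\<^sup>+w. liminf (\<lambda>N. ennreal (norm (Y (N + N0) w))) \<partial>M)"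
    proof (rule nn_integral_cong_AE)
      show "AE w in M. ennreal (norm (X t w)) = liminf (\<lambda>N. ennreal (norm (Y (N + N0) w)))"
        using conv
      proof eventually_elim
        case (elim w)
        have "(\<lambda>N. ennreal (norm (Y (N + N0) w))) \<longlonglongrightarrow> ennreal (norm (X t w))"
          by (intro tendsto_ennrealI tendsto_norm LIMSEQ_ignore_initial_segment elim)
        then show ?case using lim_imp_Liminf[of sequentially] by (metis trivial_limit_sequentially)
      qed
    qed
    also have "\<dots> \<le> liminf (\<lambda>N. \<integral>\<^sup>+w. ennreal (norm (Y (N + N0) w)) \<partial>M)"
    proof (rule nn_integral_liminf)
      fix N
      have [measurable]: "Y (N + N0) \<in> borel_measurable M" using N0[of "N + N0"] by auto
      show "(\<lambda>w. ennreal (norm (Y (N + N0) w))) \<in> borel_measurable M" by measurable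
    qed
    also have "\<dots> \<le> limsup (\<lambda>N. \<integral>\<^sup>+w. ennreal (norm (Y (N + N0) w)) \<partial>M)"
      by (rule Liminf_le_Limsup) simp
    also have "\<dots> \<le> ennreal b"
      using N0 by (intro Limsup_bounded always_eventually) auto
    finally show "(\<integral>\<^sup>+w. ennreal (norm (X t w)) \<partial>M) < \<infinity>" by (rule le_less_trans) simp
  qed simp
  show "\<bar>(\<integral>w. g (X t w) \<partial>M) - (\<integral>y. g y \<partial>gibbs U)\<bar> \<le> exp (- \<beta> * t) * A * (norm x + gibbs_moment)"
    if g: "A-lipschitz_on UNIV g"
  proof -
    define K where "K = exp (- \<beta> * t) * A * (norm x + gibbs_moment)"
    have [measurable]: "g \<in> borel_measurable borel" by (rule lipschitz_borel_measurable[OF g])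
    \<comment> \<open>Truncation keeps the Lipschitz constant and makes the test function bounded.\<close>
    define h where "h R y = max (- real R) (min (real R) (g y))" for R :: nat and y
    have h_lip: "A-lipschitz_on UNIV (h R)" for R
    proof (rule lipschitz_onI)
      fix y z
      have "\<bar>h R y - h R z\<bar> \<le> \<bar>g y - g z\<bar>" unfolding h_def by (auto simp: max_def min_def)
      also have "\<dots> \<le> A * dist y z" using lipschitz_onD[OF g, of y z] by (simp add: dist_real_def)
      finally show "dist (h R y) (h R z) \<le> A * dist y z" by (simp add: dist_real_def)
    qed (use g lipschitz_on_nonneg in blast)
    have h_bound: "\<bar>h R y\<bar> \<le> real R" "\<bar>h R y\<bar> \<le> \<bar>g y\<bar>" for R y
      unfolding h_def by (auto simp: max_def min_def)
    have h_meas [measurable]: "h R \<in> borel_measurable borel" for R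
      unfolding h_def[abs_def] by measurable
    have h_lim: "(\<lambda>R. h R y) \<longlonglongrightarrow> g y" for y
    proof (rule tendsto_eventually)
      obtain R0 :: nat where "\<bar>g y\<bar> < real R0" using reals_Archimedean2 by blast
      then have "h R y = g y" if "R \<ge> R0" for R using that unfolding h_def by (auto simp: max_def min_def)
      then show "\<forall>\<^sub>F R in sequentially. h R y = g y" unfolding eventually_sequentially by blast
    qed
    have hR: "\<bar>(\<integral>w. h R (X t w) \<partial>M) - (\<integral>y. h R y \<partial>gibbs U)\<bar> \<le> K" for R
    proof -
      obtain N0 where N0: "\<And>N. N \<ge> N0 \<Longrightarrow> integrable M (Y N)"
        using Y_int unfolding eventually_sequentially by blast
      have "(\<lambda>N. \<integral>w. h R (Y (N + N0) w) \<partial>M) \<longlonglongrightarrow> (\<integral>w. h R (X t w) \<partial>M)"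
      proof (rule integral_dominated_convergence[where w="\<lambda>_. real R"])
        show "(\<lambda>w. h R (Y (N + N0) w)) \<in> borel_measurable M" for N
        proof -
          have [measurable]: "Y (N + N0) \<in> borel_measurable M" using N0[of "N + N0"] by auto
          show ?thesis by measurable
        qed
        show "AE w in M. (\<lambda>N. h R (Y (N + N0) w)) \<longlonglongrightarrow> h R (X t w)"
          using conv
        proof eventually_elim
          case (elim w)
          have "isCont (h R) (X t w)"
            using lipschitz_on_continuous_on[OF h_lip] by (simp add: continuous_on_eq_continuous_at)
          then show ?case using isCont_tendsto_compose LIMSEQ_ignore_initial_segment[OF elim] by blast
        qed
      qed (use h_bound in auto)
      then have "(\<lambda>N. \<integral>w. h R (Y N w) \<partial>M) \<longlonglongrightarrow> (\<integral>w. h R (X t w) \<partial>M)"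
        by (rule LIMSEQ_offset)
      then have l: "(\<lambda>N. \<bar>(\<integral>w. h R (Y N w) \<partial>M) - (\<integral>y. h R y \<partial>gibbs U)\<bar>)
          \<longlonglongrightarrow> \<bar>(\<integral>w. h R (X t w) \<partial>M) - (\<integral>y. h R y \<partial>gibbs U)\<bar>"
        by (intro tendsto_intros)
      have r: "(\<lambda>N. K + C * A * t\<^sup>2 / real N) \<longlonglongrightarrow> K + 0"
        by (intro tendsto_intros real_tendsto_divide_at_top[OF tendsto_const] filterlim_real_sequentially)
      show ?thesis
        using tendsto_le[OF _ r l] bound[OF h_lip, of R] by (simp add: K_def)
    qed
    have gX: "integrable M (\<lambda>w. g (X t w))"
      by (rule integrable_lipschitz[OF g X_int])
    have 1: "(\<lambda>R. \<integral>w. h R (X t w) \<partial>M) \<longlonglongrightarrow> (\<integral>w. g (X t w) \<partial>M)"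
      using gX h_lim h_bound by (intro integral_dominated_convergence[where w="\<lambda>w. \<bar>g (X t w)\<bar>"]) auto
    have 2: "(\<lambda>R. \<integral>y. h R y \<partial>gibbs U) \<longlonglongrightarrow> (\<integral>y. g y \<partial>gibbs U)"
      using gibbs_integrable_lipschitz[OF g] h_lim h_bound
      by (intro integral_dominated_convergence[where w="\<lambda>y. \<bar>g y\<bar>"]) auto
    have "(\<lambda>R. \<bar>(\<integral>w. h R (X t w) \<partial>M) - (\<integral>y. h R y \<partial>gibbs U)\<bar>)
        \<longlonglongrightarrow> \<bar>(\<integral>w. g (X t w) \<partial>M) - (\<integral>y. g y \<partial>gibbs U)\<bar>"
      by (intro tendsto_intros 1 2)
    from LIMSEQ_le_const2[OF this] show ?thesis using hR by (auto simp: K_def)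
  qed
qed

end


context strongly_convex_potential
begin

section \<open>One step of the randomized midpoint scheme\<close>

text \<open>
  For a state \<open>y\<close>, noise values \<open>z\<close> (outer), \<open>v i\<close> (inner) and selectors \<open>h i\<close>, the scheme
  moves to the Euler point plus \<open>midpoint_drift\<close>.
\<close>

definition euler_point :: "real \<Rightarrow> 'a \<Rightarrow> 'a \<Rightarrow> 'a" where
  "euler_point c y z = y - c *\<^sub>R F y + sqrt (2 * c) *\<^sub>R z"

definition mid_shift :: "nat \<Rightarrow> real \<Rightarrow> 'a \<Rightarrow> nat \<Rightarrow> 'a \<Rightarrow> 'a" where
  "mid_shift K c y i v = sqrt (2 * real i * c / real K) *\<^sub>R v - (real i * c / real K) *\<^sub>R F y"

definition midpoint_drift :: "nat \<Rightarrow> real \<Rightarrow> 'a \<Rightarrow> (nat \<Rightarrow> bool) \<Rightarrow> (nat \<Rightarrow> 'a) \<Rightarrow> 'a" where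
  "midpoint_drift K c y h v = c *\<^sub>R (\<Sum>i<K. of_bool (h i) *\<^sub>R (F y - F (y + mid_shift K c y i (v i))))"

definition noise_size :: "nat \<Rightarrow> 'a \<Rightarrow> 'a \<Rightarrow> (nat \<Rightarrow> 'a) \<Rightarrow> real" where
  "noise_size K y z v = norm y + norm z + (\<Sum>i<K. norm (v i))"

lemma noise_size_ge:
  "norm y \<le> noise_size K y z v" "norm z \<le> noise_size K y z v" "0 \<le> noise_size K y z v"
  "i < K \<Longrightarrow> norm y + norm (v i) \<le> noise_size K y z v"
proof -
  have s: "0 \<le> (\<Sum>i<K. norm (v i))" by (intro sum_nonneg) auto
  show "norm y \<le> noise_size K y z v" "norm z \<le> noise_size K y z v" "0 \<le> noise_size K y z v"
    using s by (auto simp: noise_size_def add_nonneg_nonneg)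
  show "norm y + norm (v i) \<le> noise_size K y z v" if "i < K"
  proof -
    have "norm (v i) \<le> (\<Sum>i<K. norm (v i))" using that by (intro member_le_sum) auto
    then show ?thesis using norm_ge_zero[of z] unfolding noise_size_def by linarith
  qed
qed

lemma noise_size_sq:
  "(noise_size K y z v)\<^sup>2 \<le> (real K + 2) * ((norm y)\<^sup>2 + (norm z)\<^sup>2 + (\<Sum>i<K. (norm (v i))\<^sup>2))"
proof -
  define a where "a i = (if i < K then norm (v i) else if i = K then norm y else norm z)" for i
  have f: "(\<Sum>i<K + 2. f (a i)) = (\<Sum>i<K. f (norm (v i))) + f (norm y) + f (norm z)" for f :: "real \<Rightarrow> real"
    by (simp add: a_def)
  have "(\<Sum>i<K + 2. a i)\<^sup>2 \<le> (\<Sum>i<K + 2. (a i)\<^sup>2) * real (card {..<K + 2})"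
    by (rule sum_squared_le_sum_of_squares)
  then show ?thesis
    unfolding f[of "\<lambda>t. t"] f[of "\<lambda>t. t\<^sup>2"] by (simp add: noise_size_def algebra_simps)
qed

text \<open>
  The length of an Euler move, or of the shift to a midpoint, in units of \<open>noise_size\<close>; it is of
  order \<open>sqrt c\<close>.
\<close>

definition move :: "real \<Rightarrow> real" where "move c = c * \<Lambda> + sqrt (2 * c)"

lemma move_le: assumes "0 < c" "c \<le> 1" shows "move c \<le> sqrt c * (\<Lambda> + 2)"
proof -
  have "c \<le> sqrt c" using assms real_le_rsqrt[of c c] mult_left_mono[of c 1 c] by (simp add: power2_eq_square)
  moreover have "sqrt 2 \<le> 2" using real_sqrt_le_mono[of 2 4] by simp
  ultimately have "c * \<Lambda> \<le> sqrt c * \<Lambda>" "sqrt 2 * sqrt c \<le> 2 * sqrt c"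
    using \<Lambda>_pos assms by (auto intro!: mult_right_mono)
  then show ?thesis by (simp add: move_def real_sqrt_mult algebra_simps)
qed

lemma step_size_bounds:
  assumes c: "0 < c"
  shows norm_mid_shift: "i < K \<Longrightarrow> norm (mid_shift K c y i (v i)) \<le> move c * noise_size K y z v"
    and norm_midpoint_drift: "norm (midpoint_drift K c y h v) \<le> c * (\<Lambda> * real K * move c) * noise_size K y z v"
    and norm_euler_move: "norm (euler_point c y z - y) \<le> move c * noise_size K y z v"
proof -
  let ?S = "noise_size K y z v"
  have S: "0 \<le> ?S" by (rule noise_size_ge)
  have mv: "p * norm (F y) + q * norm u \<le> move c * ?S"
    if "0 \<le> p" "p \<le> c" "0 \<le> q" "q \<le> sqrt (2 * c)" "norm u \<le> ?S" for p q u
  proof -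
    have "p * norm (F y) \<le> c * (\<Lambda> * ?S)"
      using that F_bound[of y] \<Lambda>_pos noise_size_ge(1)[of y K z v] S
      by (intro mult_mono order_trans[OF F_bound] mult_left_mono) auto
    moreover have "q * norm u \<le> sqrt (2 * c) * ?S" using that by (intro mult_mono) auto
    ultimately show ?thesis by (simp add: move_def algebra_simps)
  qed
  show ms: "norm (mid_shift K c y i (v i)) \<le> move c * ?S" if i: "i < K" for i
  proof -
    have ik: "real i * c / real K \<le> c" using i c by (simp add: divide_le_eq mult.commute)
    have "norm (mid_shift K c y i (v i)) \<le> (real i * c / real K) * norm (F y) + sqrt (2 * real i * c / real K) * norm (v i)"
      unfolding mid_shift_def using c
      by (intro order_trans[OF norm_triangle_ineq4]) (simp add: abs_mult)
    also have "\<dots> \<le> move c * ?S"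
    proof (rule mv)
      show "sqrt (2 * real i * c / real K) \<le> sqrt (2 * c)" using ik by simp
      show "norm (v i) \<le> ?S" using noise_size_ge(4)[OF i, of y v z] norm_ge_zero[of y] by linarith
    qed (use ik c in auto)
    finally show ?thesis .
  qed
  show "norm (euler_point c y z - y) \<le> move c * ?S"
  proof -
    have "norm (euler_point c y z - y) \<le> c * norm (F y) + sqrt (2 * c) * norm z"
      unfolding euler_point_def using c norm_triangle_ineq4[of "sqrt (2 * c) *\<^sub>R z" "c *\<^sub>R F y"] by simp
    also have "\<dots> \<le> move c * ?S" using c by (intro mv noise_size_ge) auto
    finally show ?thesis .
  qed
  show "norm (midpoint_drift K c y h v) \<le> c * (\<Lambda> * real K * move c) * ?S"
  proof -
    have "norm (of_bool (h i) *\<^sub>R (F y - F (y + mid_shift K c y i (v i)))) \<le> \<Lambda> * (move c * ?S)" if "i < K" for i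
    proof -
      have "norm (of_bool (h i) *\<^sub>R (F y - F (y + mid_shift K c y i (v i)))) \<le> norm (F y - F (y + mid_shift K c y i (v i)))"
        by simp
      also have "\<dots> \<le> \<Lambda> * norm (mid_shift K c y i (v i))"
        using F_lip[of y "y + mid_shift K c y i (v i)"] by simp
      also have "\<dots> \<le> \<Lambda> * (move c * ?S)" using \<Lambda>_pos ms[OF that] by simp
      finally show ?thesis .
    qed
    then have "norm (\<Sum>i<K. of_bool (h i) *\<^sub>R (F y - F (y + mid_shift K c y i (v i)))) \<le> (\<Sum>i<K. \<Lambda> * (move c * ?S))"
      by (intro sum_norm_le) auto
    then show ?thesis unfolding midpoint_drift_def using c by (simp add: mult_ac)
  qed
qed

definition growth_const :: "nat \<Rightarrow> real \<Rightarrow> real" where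
  "growth_const K c = 1 + move c + c * (\<Lambda> * real K * move c)"

lemma prlmc_step_growth:
  assumes c: "0 < c"
  shows "norm (euler_point c y z + midpoint_drift K c y h v) \<le> growth_const K c * noise_size K y z v"
proof -
  have "norm (euler_point c y z + midpoint_drift K c y h v)
    \<le> norm y + norm (euler_point c y z - y) + norm (midpoint_drift K c y h v)"
    using norm_triangle_ineq[of "euler_point c y z" "midpoint_drift K c y h v"]
      norm_triangle_ineq[of y "euler_point c y z - y"] by simp
  also have "\<dots> \<le> noise_size K y z v + move c * noise_size K y z v + c * (\<Lambda> * real K * move c) * noise_size K y z v"
    by (intro add_mono noise_size_ge step_size_bounds c)
  finally show ?thesis by (simp add: growth_const_def algebra_simps)
qed

text \<open>
  Up to order \<open>c\<^sup>2\<close>, the midpoint correction contributes only the term linear in the inner noise,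
  which has mean zero. All products of two increments are of order \<open>c\<^sup>2\<close>, because the correction
  is of order \<open>c * sqrt c\<close> and the Euler move of order \<open>sqrt c\<close>.
\<close>

definition linear_term :: "nat \<Rightarrow> real \<Rightarrow> 'a \<Rightarrow> 'a \<Rightarrow> (nat \<Rightarrow> bool) \<Rightarrow> (nat \<Rightarrow> 'a) \<Rightarrow> real" where
  "linear_term K c p y h v = - c * (\<Sum>i<K. sqrt (2 * real i * c / real K) * (of_bool (h i) * (p \<bullet> DF y (v i))))"

definition weak_const :: "nat \<Rightarrow> real" where
  "weak_const K = \<kappa> * (\<Lambda> * real K * (\<Lambda> + 2))\<^sup>2 + \<kappa> * (\<Lambda> * real K * (\<Lambda> + 2)\<^sup>2) + real K * (\<Lambda>\<^sup>2 + \<Lambda>' * (\<Lambda> + 2)\<^sup>2)"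

lemma weak_const_nonneg: "0 \<le> weak_const K"
  unfolding weak_const_def using \<kappa>_ge \<Lambda>_pos \<Lambda>'_nonneg by simp

lemma midpoint_drift_weak_error:
  assumes G: "\<And>x. GDERIV g x :> G x" "\<And>x. norm (G x) \<le> A" "(\<kappa> * A)-lipschitz_on UNIV G"
    and c: "0 < c" "c \<le> 1"
  shows "\<bar>g (euler_point c y z + midpoint_drift K c y h v) - g (euler_point c y z) - linear_term K c (G y) y h v\<bar>
    \<le> weak_const K * A * c\<^sup>2 * (1 + (noise_size K y z v)\<^sup>2)"
proof -
  define S where "S = noise_size K y z v"
  define b where "b = \<Lambda> + 2"
  define e where "e = euler_point c y z"
  define d where "d = midpoint_drift K c y h v"
  define u where "u i = mid_shift K c y i (v i)" for i
  define s where "s = sqrt c"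
  have s: "0 < s" "s \<le> 1" "s\<^sup>2 = c" using c by (auto simp: s_def)
  have A: "0 \<le> A" using order_trans[OF norm_ge_zero G(2)] .
  have \<kappa>A: "0 \<le> \<kappa> * A" using A \<kappa>_ge by simp
  have S: "0 \<le> S" unfolding S_def by (rule noise_size_ge)
  have b: "0 < b" using \<Lambda>_pos by (simp add: b_def)
  have mv: "move c * S \<le> s * b * S" using move_le[OF c] S by (simp add: s_def b_def mult_right_mono)
  have e: "norm (e - y) \<le> s * b * S"
    using norm_euler_move[OF c(1), of y z K v] mv by (simp add: e_def S_def)
  have u: "norm (u i) \<le> s * b * S" if "i < K" for i
    using norm_mid_shift[OF c(1) that, of y v z] mv by (simp add: u_def S_def)
  have d: "norm d \<le> c * (\<Lambda> * real K) * (s * b * S)"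
  proof -
    have "norm d \<le> c * (\<Lambda> * real K) * (move c * S)"
      using norm_midpoint_drift[OF c(1), of K y h v z] by (simp add: d_def S_def mult_ac)
    also have "\<dots> \<le> c * (\<Lambda> * real K) * (s * b * S)" using c \<Lambda>_pos mv by (intro mult_left_mono) auto
    finally show ?thesis .
  qed
  have 1: "\<bar>g (e + d) - g e - G e \<bullet> d\<bar> \<le> \<kappa> * A * (c\<^sup>2 * (\<Lambda> * real K * b)\<^sup>2 * S\<^sup>2)"
  proof -
    have "\<bar>g (e + d) - g e - G e \<bullet> d\<bar> \<le> \<kappa> * A * (norm d)\<^sup>2"
      using lipschitz_gradient_taylor[OF G(1,3), of "e + d" e] by simp
    also have "\<dots> \<le> \<kappa> * A * (c * (\<Lambda> * real K) * (s * b * S))\<^sup>2"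
      by (intro mult_left_mono power_mono d \<kappa>A) auto
    also have "(c * (\<Lambda> * real K) * (s * b * S))\<^sup>2 = s\<^sup>2 * (c\<^sup>2 * (\<Lambda> * real K * b)\<^sup>2 * S\<^sup>2)"
      by (simp add: power_mult_distrib mult_ac)
    also have "\<dots> \<le> 1 * (c\<^sup>2 * (\<Lambda> * real K * b)\<^sup>2 * S\<^sup>2)" using s c by (intro mult_right_mono) auto
    finally show ?thesis using \<kappa>A by (simp add: mult_left_mono)
  qed
  have 2: "\<bar>(G e - G y) \<bullet> d\<bar> \<le> \<kappa> * A * (c\<^sup>2 * (\<Lambda> * real K * b\<^sup>2) * S\<^sup>2)"
  proof -
    have "\<bar>(G e - G y) \<bullet> d\<bar> \<le> norm (G e - G y) * norm d" by (rule Cauchy_Schwarz_ineq2)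
    also have "\<dots> \<le> (\<kappa> * A * (s * b * S)) * (c * (\<Lambda> * real K) * (s * b * S))"
    proof (rule mult_mono)
      have "norm (G e - G y) \<le> \<kappa> * A * norm (e - y)"
        using lipschitz_onD[OF G(3), of e y] by (simp add: dist_norm)
      also have "\<dots> \<le> \<kappa> * A * (s * b * S)" by (intro mult_left_mono e \<kappa>A)
      finally show "norm (G e - G y) \<le> \<kappa> * A * (s * b * S)" .
      show "0 \<le> \<kappa> * A * (s * b * S)" using \<kappa>A s b S by simp
    qed (use d in auto)
    also have "\<dots> = \<kappa> * A * (s\<^sup>2 * c * (\<Lambda> * real K * b\<^sup>2) * S\<^sup>2)"
      by (simp add: power2_eq_square mult_ac)
    finally show ?thesis using s by (simp add: power2_eq_square)
  qed
  have 3: "\<bar>G y \<bullet> d - linear_term K c (G y) y h v\<bar> \<le> A * (c\<^sup>2 * (real K * (\<Lambda>\<^sup>2 * S + \<Lambda>' * b\<^sup>2 * S\<^sup>2)))"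
  proof -
    define r where "r i = of_bool (h i) * ((real i * c / real K) * (G y \<bullet> DF y (F y)) - G y \<bullet> (F (y + u i) - F y - DF y (u i)))" for i
    have DFu: "DF y (u i) = sqrt (2 * real i * c / real K) *\<^sub>R DF y (v i) - (real i * c / real K) *\<^sub>R DF y (F y)" for i
      unfolding u_def mid_shift_def by (simp add: linear_diff[OF DF_linear] linear_cmul[OF DF_linear])
    let ?l = "\<lambda>i. sqrt (2 * real i * c / real K) * (of_bool (h i) * (G y \<bullet> DF y (v i)))"
    have "G y \<bullet> d = c * (\<Sum>i<K. of_bool (h i) * (G y \<bullet> (F y - F (y + u i))))"
      by (simp add: d_def midpoint_drift_def u_def inner_sum_right)
    then have "G y \<bullet> d - linear_term K c (G y) y h v
        = c * ((\<Sum>i<K. of_bool (h i) * (G y \<bullet> (F y - F (y + u i)))) + (\<Sum>i<K. ?l i))"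
      by (simp add: linear_term_def distrib_left)
    also have "\<dots> = c * (\<Sum>i<K. of_bool (h i) * (G y \<bullet> (F y - F (y + u i))) + ?l i)"
      by (simp only: sum.distrib)
    also have "\<dots> = c * (\<Sum>i<K. r i)"
      by (intro arg_cong2[where f="(*)"] refl sum.cong) (simp add: r_def inner_diff_right DFu)
    finally have "G y \<bullet> d - linear_term K c (G y) y h v = c * (\<Sum>i<K. r i)" .
    moreover have "\<bar>r i\<bar> \<le> A * (c * (\<Lambda>\<^sup>2 * S + \<Lambda>' * b\<^sup>2 * S\<^sup>2))" if i: "i < K" for i
    proof -
      have ik: "0 \<le> real i * c / real K" "real i * c / real K \<le> c"
        using i c by (auto simp: divide_le_eq mult.commute)
      have "\<bar>r i\<bar> \<le> \<bar>(real i * c / real K) * (G y \<bullet> DF y (F y)) - G y \<bullet> (F (y + u i) - F y - DF y (u i))\<bar>"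
        by (simp add: r_def)
      also have "\<dots> \<le> (real i * c / real K) * \<bar>G y \<bullet> DF y (F y)\<bar> + \<bar>G y \<bullet> (F (y + u i) - F y - DF y (u i))\<bar>"
        using c by (intro order_trans[OF abs_triangle_ineq4]) (simp add: abs_mult)
      also have "\<dots> \<le> c * (A * (\<Lambda> * (\<Lambda> * S))) + A * (\<Lambda>' * (s * b * S)\<^sup>2)"
      proof (intro add_mono mult_mono order_trans[OF Cauchy_Schwarz_ineq2] G(2) A ik)
        have "norm (F y) \<le> \<Lambda> * S"
          using F_bound[of y] noise_size_ge(1)[of y K z v] \<Lambda>_pos
          by (auto simp: S_def intro: order_trans mult_left_mono)
        then show "norm (DF y (F y)) \<le> \<Lambda> * (\<Lambda> * S)"
          using DF_bound[of y "F y"] \<Lambda>_pos by (auto intro: order_trans mult_left_mono)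
        have "norm (F (y + u i) - F y - DF y (u i)) \<le> \<Lambda>' * (norm (u i))\<^sup>2"
          using F_taylor[of "y + u i" y] by simp
        also have "\<dots> \<le> \<Lambda>' * (s * b * S)\<^sup>2" using u[OF i] \<Lambda>'_nonneg by (intro mult_left_mono power_mono) auto
        finally show "norm (F (y + u i) - F y - DF y (u i)) \<le> \<Lambda>' * (s * b * S)\<^sup>2" .
      qed (use c in auto)
      also have "\<dots> = A * (c * (\<Lambda>\<^sup>2 * S + \<Lambda>' * b\<^sup>2 * S\<^sup>2))"
        using s(3) by (simp add: power_mult_distrib power2_eq_square algebra_simps)
      finally show ?thesis .
    qed
    then have "(\<Sum>i<K. \<bar>r i\<bar>) \<le> (\<Sum>i<K. A * (c * (\<Lambda>\<^sup>2 * S + \<Lambda>' * b\<^sup>2 * S\<^sup>2)))"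
      by (intro sum_mono) simp
    then have "\<bar>\<Sum>i<K. r i\<bar> \<le> (\<Sum>i<K. A * (c * (\<Lambda>\<^sup>2 * S + \<Lambda>' * b\<^sup>2 * S\<^sup>2)))"
      by (rule order_trans[OF sum_abs])
    then have "c * \<bar>\<Sum>i<K. r i\<bar> \<le> c * (\<Sum>i<K. A * (c * (\<Lambda>\<^sup>2 * S + \<Lambda>' * b\<^sup>2 * S\<^sup>2)))"
      using c by (intro mult_left_mono) auto
    ultimately have "\<bar>G y \<bullet> d - linear_term K c (G y) y h v\<bar> \<le> c * (\<Sum>i<K. A * (c * (\<Lambda>\<^sup>2 * S + \<Lambda>' * b\<^sup>2 * S\<^sup>2)))"
      using c by (simp add: abs_mult)
    then show ?thesis by (simp add: power2_eq_square mult_ac)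
  qed
  note S1 = le_one_plus_square[of S]
  have "\<bar>g (e + d) - g e - linear_term K c (G y) y h v\<bar>
    \<le> \<bar>g (e + d) - g e - G e \<bullet> d\<bar> + \<bar>(G e - G y) \<bullet> d\<bar> + \<bar>G y \<bullet> d - linear_term K c (G y) y h v\<bar>"
    by (simp add: inner_diff_left)
  also have "\<dots> \<le> \<kappa> * A * (c\<^sup>2 * (\<Lambda> * real K * b)\<^sup>2 * S\<^sup>2) + \<kappa> * A * (c\<^sup>2 * (\<Lambda> * real K * b\<^sup>2) * S\<^sup>2)
      + A * (c\<^sup>2 * (real K * (\<Lambda>\<^sup>2 * S + \<Lambda>' * b\<^sup>2 * S\<^sup>2)))"
    by (intro add_mono 1 2 3)
  also have "\<dots> \<le> \<kappa> * A * (c\<^sup>2 * (\<Lambda> * real K * b)\<^sup>2 * (1 + S\<^sup>2)) + \<kappa> * A * (c\<^sup>2 * (\<Lambda> * real K * b\<^sup>2) * (1 + S\<^sup>2))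
      + A * (c\<^sup>2 * (real K * (\<Lambda>\<^sup>2 * (1 + S\<^sup>2) + \<Lambda>' * b\<^sup>2 * (1 + S\<^sup>2))))"
    using \<kappa>A A S1 \<Lambda>'_nonneg \<Lambda>_pos by (intro add_mono mult_left_mono) auto
  also have "\<dots> = weak_const K * A * c\<^sup>2 * (1 + S\<^sup>2)"
    by (simp add: weak_const_def b_def[symmetric] algebra_simps)
  finally show ?thesis by (simp add: e_def d_def S_def)
qed

definition moment_const :: "nat \<Rightarrow> real" where
  "moment_const K = 4 * (\<Lambda> * real K * (\<Lambda> + 2)) + (\<Lambda> * real K * (\<Lambda> + 2))\<^sup>2"

text \<open>
  The first three terms on the right come from the Euler point alone. The midpoint correction only
  contributes at order \<open>c * sqrt c\<close>, which the contraction absorbs when \<open>c\<close> is small.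
\<close>

lemma prlmc_step_square:
  assumes c: "0 < c" "c \<le> \<eta>\<^sub>0"
  shows "(norm (euler_point c y z + midpoint_drift K c y h v))\<^sup>2
    \<le> (1 - \<beta> * c) * (norm y)\<^sup>2 + 2 * sqrt (2 * c) * ((y - c *\<^sub>R F y) \<bullet> z) + 2 * c * (norm z)\<^sup>2
      + c * (sqrt c * (moment_const K * (noise_size K y z v)\<^sup>2))"
proof -
  define S where "S = noise_size K y z v"
  define k where "k = \<Lambda> * real K * (\<Lambda> + 2)"
  define e where "e = euler_point c y z"
  define d where "d = midpoint_drift K c y h v"
  define T where "T = y - c *\<^sub>R F y"
  have c1: "c \<le> 1" using c \<eta>\<^sub>0_le_1 by simp
  define s where "s = sqrt c"
  have s: "0 < s" "s \<le> 1" "s\<^sup>2 = c" using c c1 by (auto simp: s_def)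
  have S: "0 \<le> S" unfolding S_def by (rule noise_size_ge)
  have k: "0 \<le> k" using \<Lambda>_pos by (simp add: k_def)
  have r: "0 \<le> 1 - \<beta> * c" "1 - \<beta> * c \<le> 1" using \<beta>_\<eta>[OF c(2)] \<beta>_pos c by auto
  have T: "norm T \<le> (1 - \<beta> * c) * norm y"
    using gradient_step_contraction[of c y 0] c by (simp add: T_def F_zero)
  have d: "norm d \<le> c * s * (k * S)"
  proof -
    have "norm d \<le> c * (\<Lambda> * real K * move c) * S"
      using norm_midpoint_drift[OF c(1), of K y h v z] by (simp add: d_def S_def)
    also have "\<dots> \<le> c * (\<Lambda> * real K * (s * (\<Lambda> + 2))) * S"
      using move_le[OF c(1) c1] c \<Lambda>_pos S by (intro mult_left_mono mult_right_mono) (auto simp: s_def)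
    finally show ?thesis by (simp add: k_def mult_ac)
  qed
  have e: "norm e \<le> 2 * S"
  proof -
    have "norm e \<le> norm T + sqrt (2 * c) * norm z"
      unfolding e_def euler_point_def T_def[symmetric] using norm_triangle_ineq[of T "sqrt (2 * c) *\<^sub>R z"] c by simp
    also have "norm T \<le> norm y" using T r mult_right_mono[of "1 - \<beta> * c" 1 "norm y"] by simp
    also have "sqrt (2 * c) * norm z \<le> 2 * norm z"
      using c1 real_sqrt_le_mono[of "2 * c" 4] by (intro mult_right_mono) auto
    finally have "norm e \<le> norm y + 2 * norm z" by simp
    moreover have "norm y + norm z \<le> S" unfolding S_def noise_size_def by (simp add: sum_nonneg)
    ultimately show ?thesis using norm_ge_zero[of y] by linarith
  qed
  have e2: "(norm e)\<^sup>2 = (norm T)\<^sup>2 + 2 * sqrt (2 * c) * (T \<bullet> z) + 2 * c * (norm z)\<^sup>2"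
  proof -
    have "(norm e)\<^sup>2 = (norm T)\<^sup>2 + 2 * (T \<bullet> (sqrt (2 * c) *\<^sub>R z)) + (norm (sqrt (2 * c) *\<^sub>R z))\<^sup>2"
      unfolding e_def euler_point_def T_def[symmetric] power2_norm_eq_inner
      by (simp only: inner_add_left inner_add_right inner_commute)
    then show ?thesis using c by (simp add: power_mult_distrib)
  qed
  have "(norm (e + d))\<^sup>2 = (norm e)\<^sup>2 + 2 * (e \<bullet> d) + (norm d)\<^sup>2"
    unfolding power2_norm_eq_inner by (simp add: inner_add_left inner_add_right inner_commute)
  also have "\<dots> \<le> (norm e)\<^sup>2 + 2 * ((2 * S) * (c * s * (k * S))) + (c * s * (k * S))\<^sup>2"
    using e d S by (intro add_mono mult_left_mono power_mono order_trans[OF norm_cauchy_schwarz] mult_mono) auto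
  also have "(c * s * (k * S))\<^sup>2 \<le> c * s * (k * S)\<^sup>2"
  proof -
    have "(c * s)\<^sup>2 \<le> c * s"
      using s c c1 mult_le_one[of c s] mult_left_mono[of "c * s" 1 "c * s"] by (simp add: power2_eq_square)
    then show ?thesis by (simp add: power_mult_distrib mult_right_mono)
  qed
  also have "(norm e)\<^sup>2 \<le> (1 - \<beta> * c) * (norm y)\<^sup>2 + 2 * sqrt (2 * c) * (T \<bullet> z) + 2 * c * (norm z)\<^sup>2"
  proof -
    have "(norm T)\<^sup>2 \<le> ((1 - \<beta> * c) * norm y)\<^sup>2" using T by (intro power_mono) auto
    also have "\<dots> = (1 - \<beta> * c) * ((1 - \<beta> * c) * (norm y)\<^sup>2)" by (simp add: power2_eq_square mult_ac)
    also have "\<dots> \<le> 1 * ((1 - \<beta> * c) * (norm y)\<^sup>2)" using r by (intro mult_right_mono) auto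
    finally show ?thesis by (simp add: e2)
  qed
  finally have "(norm (e + d))\<^sup>2 \<le> (1 - \<beta> * c) * (norm y)\<^sup>2 + 2 * sqrt (2 * c) * (T \<bullet> z) + 2 * c * (norm z)\<^sup>2
      + c * (s * ((4 * k + k\<^sup>2) * S\<^sup>2))"
    by (simp add: power2_eq_square algebra_simps)
  moreover have "moment_const K = 4 * k + k\<^sup>2" by (simp add: moment_const_def k_def)
  ultimately show ?thesis by (simp add: e_def d_def S_def T_def s_def)
qed

end


section \<open>The law of the scheme\<close>

definition past_indices :: "nat \<Rightarrow> nat \<Rightarrow> noise_index set" where
  "past_indices K n = {Bern k i |k i. k < n \<and> i < K} \<union> {Outer (Suc k) |k. k < n} \<union> {Inner k i |k i. k < n \<and> i < K}"

lemma Int_stable_vimage: "Int_stable {f -` A \<inter> \<Omega> |A. A \<in> sets N}"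
proof (rule Int_stableI)
  fix a b assume "a \<in> {f -` A \<inter> \<Omega> |A. A \<in> sets N}" "b \<in> {f -` A \<inter> \<Omega> |A. A \<in> sets N}"
  then obtain A B where "A \<in> sets N" "B \<in> sets N" "a = f -` A \<inter> \<Omega>" "b = f -` B \<inter> \<Omega>" by auto
  then show "a \<inter> b \<in> {f -` A \<inter> \<Omega> |A. A \<in> sets N}"
    by (intro CollectI exI[of _ "A \<inter> B"]) auto
qed

lemma Int_stable_noise_events: "Int_stable (noise_events M H \<xi> \<zeta> j)"
  by (cases j) (auto simp only: noise_events.simps intro: Int_stable_vimage)

lemma noise_events_Pow: "(\<Union>j\<in>J. noise_events M H \<xi> \<zeta> j) \<subseteq> Pow (space M)"
proof -
  have "noise_events M H \<xi> \<zeta> j \<subseteq> Pow (space M)" for j by (cases j) auto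
  then show ?thesis by blast
qed

lemma (in strongly_convex_potential) prlmc_step_measurable:
  assumes [measurable]: "y \<in> borel_measurable N" "z \<in> borel_measurable N"
    and v [measurable]: "\<And>i. i < K \<Longrightarrow> v i \<in> borel_measurable N"
    and h [measurable]: "\<And>i. i < K \<Longrightarrow> h i \<in> N \<rightarrow>\<^sub>M count_space UNIV"
  shows "(\<lambda>w. euler_point c (y w) (z w) + midpoint_drift K c (y w) (\<lambda>i. h i w) (\<lambda>i. v i w)) \<in> borel_measurable N"
proof -
  have "(\<lambda>w. of_bool (h i w) *\<^sub>R (F (y w) - F (y w + mid_shift K c (y w) i (v i w)))) \<in> borel_measurable N"
    if i: "i < K" for i
  proof -
    have [measurable]: "v i \<in> borel_measurable N" "Measurable.pred N (h i)" using v[OF i] h[OF i] by auto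
    show ?thesis unfolding mid_shift_def by measurable
  qed
  then have [measurable]: "(\<lambda>w. \<Sum>i<K. of_bool (h i w) *\<^sub>R (F (y w) - F (y w + mid_shift K c (y w) i (v i w)))) \<in> borel_measurable N"
    by (intro borel_measurable_sum) auto
  show ?thesis unfolding euler_point_def midpoint_drift_def by measurable
qed

locale prlmc_chain = strongly_convex_potential U F DF m \<Lambda> \<Lambda>'
  for U :: "'a::euclidean_space \<Rightarrow> real" and F DF m \<Lambda> \<Lambda>' +
  fixes M :: "'w measure" and K :: nat and H :: "nat \<Rightarrow> nat \<Rightarrow> 'w \<Rightarrow> bool"
    and \<xi> :: "nat \<Rightarrow> 'w \<Rightarrow> 'a" and \<zeta> :: "nat \<Rightarrow> nat \<Rightarrow> 'w \<Rightarrow> 'a" and \<gamma> :: "nat \<Rightarrow> real" and x :: 'a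
  assumes noise: "prlmc_noise M K H \<xi> \<zeta>" and steps_pos: "\<And>n. 0 < \<gamma> (Suc n)"
    and grad_U: "\<And>y. grad U y = F y"
begin

sublocale prob_space M using noise by (simp add: prlmc_noise_def)

abbreviation Y :: "nat \<Rightarrow> 'w \<Rightarrow> 'a" where "Y \<equiv> prlmc K U \<gamma> H \<xi> \<zeta> x"

lemma Y_Suc:
  "Y (Suc n) w = euler_point (\<gamma> (Suc n)) (Y n w) (\<xi> (Suc n) w)
     + midpoint_drift K (\<gamma> (Suc n)) (Y n w) (\<lambda>i. H n i w) (\<lambda>i. \<zeta> n i w)"
  by (simp add: Let_def euler_point_def midpoint_drift_def mid_shift_def prlmc_mid_def grad_U algebra_simps)

lemma noise_measurable [measurable]:
  "i < K \<Longrightarrow> H k i \<in> measurable M (count_space UNIV)"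
  "\<xi> (Suc k) \<in> borel_measurable M"
  "i < K \<Longrightarrow> \<zeta> k i \<in> borel_measurable M"
  using noise by (auto simp: prlmc_noise_def)

lemma noise_law:
  "distr M borel (\<xi> (Suc k)) = std_gaussian" "i < K \<Longrightarrow> distr M borel (\<zeta> k i) = std_gaussian"
  using noise by (auto simp: prlmc_noise_def)

lemma gaussian_noise_moments:
  assumes [measurable]: "W \<in> borel_measurable M" and W: "distr M borel W = (std_gaussian :: 'a measure)"
  shows "integrable M W" "expectation W = 0" "integrable M (\<lambda>w. (norm (W w))\<^sup>2)"
    "expectation (\<lambda>w. (norm (W w))\<^sup>2) = (\<integral>z. (norm z)\<^sup>2 \<partial>(std_gaussian :: 'a measure))"
proof -
  have "integrable (distr M borel W) (\<lambda>z. z)" unfolding W by (rule std_gaussian_integrable_id)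
  then show "integrable M W" by (subst (asm) integrable_distr_eq) simp_all
  have "expectation W = (\<integral>z. z \<partial>distr M borel W)" by (subst integral_distr) simp_all
  then show "expectation W = 0" unfolding W std_gaussian_mean .
  have "integrable (distr M borel W) (\<lambda>z. (norm z)\<^sup>2)" unfolding W by (rule std_gaussian_integrable_norm2)
  then show "integrable M (\<lambda>w. (norm (W w))\<^sup>2)" by (subst (asm) integrable_distr_eq) simp_all
  have "expectation (\<lambda>w. (norm (W w))\<^sup>2) = (\<integral>z. (norm z)\<^sup>2 \<partial>distr M borel W)"
    by (subst integral_distr) simp_all
  then show "expectation (\<lambda>w. (norm (W w))\<^sup>2) = (\<integral>z. (norm z)\<^sup>2 \<partial>(std_gaussian :: 'a measure))"
    unfolding W .
qed

abbreviation past :: "noise_index set \<Rightarrow> 'w measure" where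
  "past J \<equiv> sigma (space M) (\<Union>j\<in>J. noise_events M H \<xi> \<zeta> j)"

lemma past_indices_mono: "n \<le> n' \<Longrightarrow> past_indices K n \<subseteq> past_indices K n'"
  by (force simp: past_indices_def)

lemma noise_past:
  "\<lbrakk>i < K; Bern k i \<in> J\<rbrakk> \<Longrightarrow> H k i \<in> past J \<rightarrow>\<^sub>M count_space UNIV"
  "Outer (Suc k) \<in> J \<Longrightarrow> \<xi> (Suc k) \<in> borel_measurable (past J)"
  "\<lbrakk>i < K; Inner k i \<in> J\<rbrakk> \<Longrightarrow> \<zeta> k i \<in> borel_measurable (past J)"
  by (rule measurable_past[OF _ _ noise_events_Pow]; auto)+

lemma Y_past: "Y n \<in> borel_measurable (past (past_indices K n))"
proof (induction n)
  case (Suc n)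
  let ?P = "past (past_indices K (Suc n))"
  have "Bern n i \<in> past_indices K (Suc n)" "Inner n i \<in> past_indices K (Suc n)" if "i < K" for i
    using that by (auto simp: past_indices_def)
  moreover have "Outer (Suc n) \<in> past_indices K (Suc n)" by (auto simp: past_indices_def)
  moreover have "Y n \<in> borel_measurable ?P"
    by (rule measurable_past_mono[OF Suc past_indices_mono noise_events_Pow]) simp
  ultimately show ?case
    unfolding Y_Suc[abs_def] by (intro prlmc_step_measurable noise_past) auto
qed simp

lemma noise_indep_sets: "indep_sets (noise_events M H \<xi> \<zeta>) (noise_indices K)"
  using noise by (simp add: prlmc_noise_def)

lemma past_measurable_M: "J \<subseteq> noise_indices K \<Longrightarrow> f \<in> borel_measurable (past J) \<Longrightarrow> f \<in> borel_measurable M"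
proof -
  assume J: "J \<subseteq> noise_indices K" and f: "f \<in> borel_measurable (past J)"
  have "(\<Union>j\<in>J. noise_events M H \<xi> \<zeta> j) \<subseteq> events"
    using noise_indep_sets J unfolding indep_sets_def by blast
  then have "f \<in> borel_measurable (measure_of (space M) events (emeasure M))"
    by (intro subsetD[OF measurable_mono1 f] sets.space_closed)
  then show ?thesis by (simp add: measure_of_of_measure)
qed

lemma past_indices_subset: "past_indices K n \<subseteq> noise_indices K"
  by (auto simp: past_indices_def noise_indices_def)

lemma Y_measurable [measurable]: "Y n \<in> borel_measurable M"
  by (rule past_measurable_M[OF past_indices_subset Y_past])

lemma outer_noise_indep:
  assumes "V \<in> borel_measurable (past (past_indices K n))"
  shows "indep_var borel V borel (\<xi> (Suc n))"
proof (rule indep_var_of_past[OF noise_indep_sets Int_stable_noise_events _ _ assms])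
  show "Outer (Suc n) \<in> noise_indices K" by (auto simp: noise_indices_def)
  have "Outer (Suc n) \<notin> past_indices K n" by (auto simp: past_indices_def)
  then show "past_indices K n \<subseteq> noise_indices K - {Outer (Suc n)}" using past_indices_subset by blast
qed (auto simp: noise_measurable)

lemma inner_noise_indep:
  assumes "V \<in> borel_measurable (past (insert (Bern n i) (past_indices K n)))" "i < K"
  shows "indep_var borel V borel (\<zeta> n i)"
proof (rule indep_var_of_past[OF noise_indep_sets Int_stable_noise_events _ _ assms(1)])
  show "Inner n i \<in> noise_indices K" using assms(2) by (auto simp: noise_indices_def)
  have "Inner n i \<notin> insert (Bern n i) (past_indices K n)" by (auto simp: past_indices_def)
  moreover have "Bern n i \<in> noise_indices K" using assms(2) by (auto simp: noise_indices_def)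
  ultimately show "insert (Bern n i) (past_indices K n) \<subseteq> noise_indices K - {Inner n i}"
    using past_indices_subset by blast
qed (use assms(2) in \<open>auto simp: noise_measurable\<close>)

abbreviation size_at :: "nat \<Rightarrow> 'w \<Rightarrow> real" where
  "size_at n w \<equiv> noise_size K (Y n w) (\<xi> (Suc n) w) (\<lambda>i. \<zeta> n i w)"

definition second_moment :: "nat \<Rightarrow> real" where
  "second_moment n = expectation (\<lambda>w. (norm (Y n w))\<^sup>2)"

lemma second_moment_nonneg: "0 \<le> second_moment n"
  unfolding second_moment_def by (rule integral_nonneg_AE) auto

lemma size_measurable [measurable]: "size_at n \<in> borel_measurable M"
  unfolding noise_size_def by (intro borel_measurable_add borel_measurable_sum) auto

lemma size_square:
  assumes Y: "integrable M (\<lambda>w. (norm (Y n w))\<^sup>2)"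
  shows "integrable M (\<lambda>w. (size_at n w)\<^sup>2)"
    and "expectation (\<lambda>w. (size_at n w)\<^sup>2)
      \<le> (real K + 2) * (second_moment n + (real K + 1) * (\<integral>z. (norm z)\<^sup>2 \<partial>(std_gaussian :: 'a measure)))"
proof -
  let ?q = "\<lambda>w. (real K + 2) * ((norm (Y n w))\<^sup>2 + (norm (\<xi> (Suc n) w))\<^sup>2 + (\<Sum>i<K. (norm (\<zeta> n i w))\<^sup>2))"
  note g = gaussian_noise_moments[OF noise_measurable(2) noise_law(1), of n]
    gaussian_noise_moments[OF noise_measurable(3) noise_law(2), of _ n]
  have q: "integrable M ?q"
    using Y g by (intro integrable_mult_right Bochner_Integration.integrable_add Bochner_Integration.integrable_sum) auto
  show int: "integrable M (\<lambda>w. (size_at n w)\<^sup>2)"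
  proof (rule Bochner_Integration.integrable_bound[OF q])
    show "AE w in M. norm ((size_at n w)\<^sup>2) \<le> norm (?q w)"
      by (intro AE_I2 order_trans[OF _ abs_ge_self[of "?q _", folded real_norm_def]]) (simp add: noise_size_sq)
  qed measurable
  have "expectation (\<lambda>w. (size_at n w)\<^sup>2) \<le> expectation ?q"
    by (intro integral_mono int q noise_size_sq)
  also have "\<dots> = (real K + 2) * (second_moment n + (real K + 1) * (\<integral>z. (norm z)\<^sup>2 \<partial>(std_gaussian :: 'a measure)))"
  proof -
    have s: "integrable M (\<lambda>w. \<Sum>i<K. (norm (\<zeta> n i w))\<^sup>2)"
      using g by (intro Bochner_Integration.integrable_sum) auto
    have "expectation (\<lambda>w. \<Sum>i<K. (norm (\<zeta> n i w))\<^sup>2) = real K * (\<integral>z. (norm z)\<^sup>2 \<partial>(std_gaussian :: 'a measure))"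
      using g by (subst Bochner_Integration.integral_sum) auto
    then show ?thesis
      using Y g(3,4) s by (simp add: second_moment_def algebra_simps)
  qed
  finally show "expectation (\<lambda>w. (size_at n w)\<^sup>2)
      \<le> (real K + 2) * (second_moment n + (real K + 1) * (\<integral>z. (norm z)\<^sup>2 \<partial>(std_gaussian :: 'a measure)))" .
qed

lemma Y_square_integrable: "integrable M (\<lambda>w. (norm (Y n w))\<^sup>2)"
proof (induction n)
  case (Suc n)
  have "norm (Y (Suc n) w) \<le> growth_const K (\<gamma> (Suc n)) * size_at n w" for w
    unfolding Y_Suc by (rule prlmc_step_growth[OF steps_pos])
  then have le: "(norm (Y (Suc n) w))\<^sup>2 \<le> (growth_const K (\<gamma> (Suc n)))\<^sup>2 * (size_at n w)\<^sup>2" for w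
    unfolding power_mult_distrib[symmetric] by (rule power_mono) simp
  show ?case
  proof (rule Bochner_Integration.integrable_bound)
    show "integrable M (\<lambda>w. (growth_const K (\<gamma> (Suc n)))\<^sup>2 * (size_at n w)\<^sup>2)"
      using size_square(1)[OF Suc] by auto
    show "AE w in M. norm ((norm (Y (Suc n) w))\<^sup>2) \<le> norm ((growth_const K (\<gamma> (Suc n)))\<^sup>2 * (size_at n w)\<^sup>2)"
      by (intro AE_I2, unfold real_norm_def abs_mult abs_power2) (rule le)
  qed measurable
qed simp

lemma Y_integrable: "integrable M (Y n)"
proof (rule Bochner_Integration.integrable_bound)
  show "integrable M (\<lambda>w. 1 + (norm (Y n w))\<^sup>2)" using Y_square_integrable by auto
  show "AE w in M. norm (Y n w) \<le> norm (1 + (norm (Y n w))\<^sup>2)" using le_one_plus_square by auto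
qed measurable

lemma euler_point_Y_integrable: "integrable M (\<lambda>w. euler_point c (Y n w) (\<xi> (Suc n) w))"
proof -
  have "integrable M (\<lambda>w. F (Y n w))" by (rule integrable_lipschitz[OF F_lipschitz Y_integrable])
  then show ?thesis
    unfolding euler_point_def using Y_integrable gaussian_noise_moments(1)[OF noise_measurable(2) noise_law(1)]
    by (intro Bochner_Integration.integrable_add Bochner_Integration.integrable_diff) auto
qed

lemma expectation_euler_point:
  assumes g: "A-lipschitz_on UNIV g"
  shows "expectation (\<lambda>w. g (euler_point c (Y n w) (\<xi> (Suc n) w))) = expectation (\<lambda>w. euler c g (Y n w))"
proof -
  have [measurable]: "g \<in> borel_measurable borel"
    by (rule lipschitz_borel_measurable[OF g])
  define f where "f p = g (euler_point c (fst p) (snd p))" for p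
  have [measurable]: "f \<in> borel_measurable (borel \<Otimes>\<^sub>M borel)"
    unfolding f_def[abs_def] euler_point_def by measurable
  have "integrable M (\<lambda>w. f (Y n w, \<xi> (Suc n) w))"
    unfolding f_def fst_conv snd_conv by (rule integrable_lipschitz[OF g euler_point_Y_integrable])
  from expectation_of_indep_pair[OF outer_noise_indep[OF Y_past] _ this]
  show ?thesis by (simp add: noise_law f_def euler_def euler_point_def)
qed

text \<open>
  Each summand is the inner product of an inner noise vector of mean zero with a vector that is a
  function of the current state and of a selector, both independent of it.
\<close>

lemma linear_term_centred:
  assumes G: "\<And>y. norm (G y) \<le> A" "C-lipschitz_on UNIV G"
  shows "integrable M (\<lambda>w. linear_term K c (G (Y n w)) (Y n w) (\<lambda>i. H n i w) (\<lambda>i. \<zeta> n i w))"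
    and "expectation (\<lambda>w. linear_term K c (G (Y n w)) (Y n w) (\<lambda>i. H n i w) (\<lambda>i. \<zeta> n i w)) = 0"
proof -
  define p where "p y = (\<Sum>b\<in>Basis. (G y \<bullet> DF y b) *\<^sub>R b)" for y
  have A: "0 \<le> A" using order_trans[OF norm_ge_zero G(1)] .
  have p: "p y \<bullet> v = G y \<bullet> DF y v" for y v
  proof -
    have "DF y v = (\<Sum>b\<in>Basis. (v \<bullet> b) *\<^sub>R DF y b)"
      using linear_sum[OF DF_linear, of y "\<lambda>b. (v \<bullet> b) *\<^sub>R b" Basis]
      by (simp add: euclidean_representation linear_cmul[OF DF_linear])
    then show ?thesis
      by (simp add: p_def inner_sum_left inner_sum_right inner_commute mult.commute)
  qed
  have p_bound: "norm (p y) \<le> A * \<Lambda>" for y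
  proof (rule norm_le_of_inner)
    fix v
    have "G y \<bullet> DF y v \<le> norm (G y) * norm (DF y v)" by (rule norm_cauchy_schwarz)
    also have "\<dots> \<le> A * (\<Lambda> * norm v)" by (intro mult_mono G DF_bound A) auto
    finally show "p y \<bullet> v \<le> A * \<Lambda> * norm v" by (simp add: p)
  qed (use A \<Lambda>_pos in simp)
  have p_meas [measurable]: "p \<in> borel_measurable borel"
  proof -
    have "continuous_on UNIV G" using G(2) by (rule lipschitz_on_continuous_on)
    moreover have "continuous_on UNIV (\<lambda>y. DF y b)" for b
      by (rule lipschitz_on_continuous_on[of "\<Lambda>' * norm b"])
         (use DF_lip[of _ b] \<Lambda>'_nonneg in \<open>auto intro!: lipschitz_onI simp: dist_norm mult_ac\<close>)
    ultimately show ?thesis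
      unfolding p_def[abs_def] by (intro borel_measurable_continuous_onI continuous_intros) auto
  qed
  define V where "V i w = of_bool (H n i w) *\<^sub>R p (Y n w)" for i w
  have V_past: "V i \<in> borel_measurable (past (insert (Bern n i) (past_indices K n)))" if i: "i < K" for i
  proof -
    let ?P = "past (insert (Bern n i) (past_indices K n))"
    have gen: "(\<lambda>w. of_bool (h w) *\<^sub>R p (y w)) \<in> borel_measurable N"
      if [measurable]: "y \<in> borel_measurable N" "h \<in> N \<rightarrow>\<^sub>M count_space UNIV" for N :: "'w measure" and h y
      by measurable
    show ?thesis unfolding V_def[abs_def]
    proof (rule gen)
      show "Y n \<in> borel_measurable ?P"
        by (rule measurable_past_mono[OF Y_past _ noise_events_Pow]) auto
      show "H n i \<in> ?P \<rightarrow>\<^sub>M count_space UNIV" using i by (rule noise_past) simp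
    qed
  qed
  have V_int: "integrable M (V i)" if i: "i < K" for i
  proof (rule integrable_const_bound[of _ "A * \<Lambda>"])
    show "V i \<in> borel_measurable M"
      using i by (intro past_measurable_M[OF _ V_past]) (use past_indices_subset in \<open>auto simp: noise_indices_def\<close>)
    have "norm (V i w) \<le> A * \<Lambda>" for w
      using p_bound[of "Y n w"] A \<Lambda>_pos by (auto simp: V_def)
    then show "AE w in M. norm (V i w) \<le> A * \<Lambda>" by simp
  qed
  have t: "integrable M (\<lambda>w. V i w \<bullet> \<zeta> n i w) \<and> expectation (\<lambda>w. V i w \<bullet> \<zeta> n i w) = 0" if i: "i < K" for i
    using expectation_inner_indep_centred[OF inner_noise_indep[OF V_past[OF i] i] V_int[OF i]]
      gaussian_noise_moments[OF noise_measurable(3)[OF i] noise_law(2)[OF i]] by auto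
  have eq: "linear_term K c (G (Y n w)) (Y n w) (\<lambda>i. H n i w) (\<lambda>i. \<zeta> n i w)
      = - c * (\<Sum>i<K. sqrt (2 * real i * c / real K) * (V i w \<bullet> \<zeta> n i w))" for w
    by (simp add: linear_term_def V_def p)
  have i': "integrable M (\<lambda>w. sqrt (2 * real i * c / real K) * (V i w \<bullet> \<zeta> n i w))" if "i < K" for i
    using t[OF that] by auto
  show "integrable M (\<lambda>w. linear_term K c (G (Y n w)) (Y n w) (\<lambda>i. H n i w) (\<lambda>i. \<zeta> n i w))"
    unfolding eq using i' by (intro integrable_mult_right Bochner_Integration.integrable_sum) auto
  show "expectation (\<lambda>w. linear_term K c (G (Y n w)) (Y n w) (\<lambda>i. H n i w) (\<lambda>i. \<zeta> n i w)) = 0"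
    unfolding eq using i' t by (simp add: Bochner_Integration.integral_sum)
qed

text \<open>
  Both steps use the same outer noise, so the difference is the expectation of the increment caused
  by the midpoint correction.
\<close>

lemma one_step_weak_error:
  assumes g: "C11 A (\<kappa> * A) g" and c: "\<gamma> (Suc n) \<le> 1"
  shows "\<bar>expectation (\<lambda>w. g (Y (Suc n) w)) - expectation (\<lambda>w. euler (\<gamma> (Suc n)) g (Y n w))\<bar>
    \<le> weak_const K * A * (\<gamma> (Suc n))\<^sup>2 * (1 + expectation (\<lambda>w. (size_at n w)\<^sup>2))"
proof -
  let ?c = "\<gamma> (Suc n)"
  obtain G where G: "\<And>x. GDERIV g x :> G x" "\<And>x. norm (G x) \<le> A" "(\<kappa> * A)-lipschitz_on UNIV G"
    using g by (auto simp: C11_def)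
  note lip = C11_lipschitz[OF g]
  let ?e = "\<lambda>w. g (euler_point ?c (Y n w) (\<xi> (Suc n) w))"
  let ?l = "\<lambda>w. linear_term K ?c (G (Y n w)) (Y n w) (\<lambda>i. H n i w) (\<lambda>i. \<zeta> n i w)"
  have e: "integrable M ?e" by (rule integrable_lipschitz[OF lip euler_point_Y_integrable])
  have y: "integrable M (\<lambda>w. g (Y (Suc n) w))" by (rule integrable_lipschitz[OF lip Y_integrable])
  note l = linear_term_centred[OF G(2,3), of ?c n]
  have "expectation (\<lambda>w. g (Y (Suc n) w)) - expectation (\<lambda>w. euler ?c g (Y n w))
      = expectation (\<lambda>w. g (Y (Suc n) w) - ?e w - ?l w)"
    using e y l by (simp add: expectation_euler_point[OF lip])
  then have "\<bar>expectation (\<lambda>w. g (Y (Suc n) w)) - expectation (\<lambda>w. euler ?c g (Y n w))\<bar>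
      = \<bar>expectation (\<lambda>w. g (Y (Suc n) w) - ?e w - ?l w)\<bar>" by simp
  also have "\<dots> \<le> expectation (\<lambda>w. weak_const K * A * ?c\<^sup>2 * (1 + (size_at n w)\<^sup>2))"
  proof (rule order_trans[OF integral_abs_bound integral_mono])
    show "integrable M (\<lambda>w. \<bar>g (Y (Suc n) w) - ?e w - ?l w\<bar>)" using e y l by (intro integrable_abs Bochner_Integration.integrable_diff)
    show "integrable M (\<lambda>w. weak_const K * A * ?c\<^sup>2 * (1 + (size_at n w)\<^sup>2))"
      using size_square(1)[OF Y_square_integrable] by auto
    show "\<bar>g (Y (Suc n) w) - ?e w - ?l w\<bar> \<le> weak_const K * A * ?c\<^sup>2 * (1 + (size_at n w)\<^sup>2)" for w
      unfolding Y_Suc by (rule midpoint_drift_weak_error[OF G steps_pos c])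
  qed
  also have "\<dots> = weak_const K * A * ?c\<^sup>2 * (1 + expectation (\<lambda>w. (size_at n w)\<^sup>2))"
  proof -
    have i: "integrable M (\<lambda>w. (size_at n w)\<^sup>2)" by (rule size_square(1)[OF Y_square_integrable])
    have "expectation (\<lambda>w. 1 + (size_at n w)\<^sup>2) = 1 + expectation (\<lambda>w. (size_at n w)\<^sup>2)"
      using i by (subst Bochner_Integration.integral_add) (simp_all add: prob_space)
    then show ?thesis by (simp only: integral_mult_right_zero)
  qed
  finally show ?thesis .
qed

lemma second_moment_step:
  assumes c: "\<gamma> (Suc n) \<le> \<eta>\<^sub>0"
  shows "second_moment (Suc n) \<le> (1 - \<beta> * \<gamma> (Suc n)) * second_moment n
    + 2 * \<gamma> (Suc n) * (\<integral>z. (norm z)\<^sup>2 \<partial>(std_gaussian :: 'a measure))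
    + \<gamma> (Suc n) * (sqrt (\<gamma> (Suc n)) * (moment_const K * expectation (\<lambda>w. (size_at n w)\<^sup>2)))"
proof -
  let ?c = "\<gamma> (Suc n)" and ?V = "\<lambda>w. Y n w - \<gamma> (Suc n) *\<^sub>R F (Y n w)"
  have V_past: "?V \<in> borel_measurable (past (past_indices K n))"
    by (rule measurable_compose[OF Y_past]) measurable
  have V_int: "integrable M ?V"
    using Bochner_Integration.integrable_diff[OF euler_point_Y_integrable[of ?c n]
      integrable_scaleR_right[OF gaussian_noise_moments(1)[OF noise_measurable(2) noise_law(1)], of "sqrt (2 * ?c)" n]]
    by (simp add: euler_point_def)
  note g = gaussian_noise_moments[OF noise_measurable(2) noise_law(1), of n]
  note cross = expectation_inner_indep_centred[OF outer_noise_indep[OF V_past] V_int g(1,2)]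
  note S = size_square(1)[OF Y_square_integrable, of n]
  let ?b = "\<lambda>w. (1 - \<beta> * ?c) * (norm (Y n w))\<^sup>2 + 2 * sqrt (2 * ?c) * (?V w \<bullet> \<xi> (Suc n) w) + 2 * ?c * (norm (\<xi> (Suc n) w))\<^sup>2
      + ?c * (sqrt ?c * (moment_const K * (size_at n w)\<^sup>2))"
  have b: "integrable M ?b"
    using cross(1) g(3) S Y_square_integrable[of n]
    by (intro Bochner_Integration.integrable_add integrable_mult_right) auto
  have "second_moment (Suc n) \<le> expectation ?b"
    unfolding second_moment_def Y_Suc
    using Y_square_integrable[of "Suc n"] unfolding Y_Suc
    by (intro integral_mono b prlmc_step_square steps_pos c)
  also have "\<dots> = (1 - \<beta> * ?c) * second_moment n + 2 * ?c * (\<integral>z. (norm z)\<^sup>2 \<partial>(std_gaussian :: 'a measure))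
    + ?c * (sqrt ?c * (moment_const K * expectation (\<lambda>w. (size_at n w)\<^sup>2)))"
    using cross g(3,4) S Y_square_integrable[of n] by (simp add: second_moment_def)
  finally show ?thesis .
qed

lemma second_moment_growth:
  "second_moment (Suc n) \<le> (growth_const K (\<gamma> (Suc n)))\<^sup>2 * expectation (\<lambda>w. (size_at n w)\<^sup>2)"
proof -
  have "norm (Y (Suc n) w) \<le> growth_const K (\<gamma> (Suc n)) * size_at n w" for w
    unfolding Y_Suc by (rule prlmc_step_growth[OF steps_pos])
  then have "(norm (Y (Suc n) w))\<^sup>2 \<le> (growth_const K (\<gamma> (Suc n)))\<^sup>2 * (size_at n w)\<^sup>2" for w
    unfolding power_mult_distrib[symmetric] by (rule power_mono) simp
  then have "second_moment (Suc n) \<le> expectation (\<lambda>w. (growth_const K (\<gamma> (Suc n)))\<^sup>2 * (size_at n w)\<^sup>2)"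
    unfolding second_moment_def
    by (intro integral_mono Y_square_integrable integrable_mult_right size_square)
  then show ?thesis by simp
qed

end


section \<open>Long-time error of the scheme\<close>

context strongly_convex_potential
begin

text \<open>
  \<open>size_const\<close> bounds the second moment of \<open>noise_size\<close> relative to that of the state, \<open>step_const\<close>
  likewise the one-step weak error, \<open>small_step\<close> the steps for which the second moment contracts with rate \<open>\<beta>'\<close>, and
  \<open>moment_limit\<close> the level to which it contracts. None of them depends on the step sequence.
\<close>

definition \<sigma>2 :: real where "\<sigma>2 = (\<integral>z. (norm z)\<^sup>2 \<partial>(std_gaussian :: 'a measure))"
definition size_const :: "nat \<Rightarrow> real" where "size_const K = (real K + 2) * (1 + (real K + 1) * \<sigma>2)"
definition step_const :: "nat \<Rightarrow> real" where "step_const K = weak_const K * (1 + size_const K)"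
definition \<beta>' :: real where "\<beta>' = 5 / 8 * m"
definition small_step :: "nat \<Rightarrow> real" where
  "small_step K = min \<eta>\<^sub>0 ((m / (8 * (1 + moment_const K * size_const K)))\<^sup>2)"
definition moment_limit :: real where "moment_limit = (2 * \<sigma>2 + m / 8) / \<beta>'"

lemma const_nonneg: "0 \<le> \<sigma>2" "0 \<le> size_const K" "0 \<le> step_const K" "0 \<le> moment_const K" "0 < \<beta>'" "0 \<le> moment_limit"
  "0 < small_step K"
proof -
  show s: "0 \<le> \<sigma>2" unfolding \<sigma>2_def by (rule integral_nonneg_AE) auto
  then show sc: "0 \<le> size_const K" by (simp add: size_const_def)
  show mc: "0 \<le> moment_const K" using \<Lambda>_pos by (simp add: moment_const_def)
  show "0 \<le> step_const K" using sc weak_const_nonneg by (simp add: step_const_def)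
  show b: "0 < \<beta>'" using m_pos by (simp add: \<beta>'_def)
  show "0 \<le> moment_limit" using s b m_pos by (simp add: moment_limit_def)
  have "0 < 1 + moment_const K * size_const K" using sc mc by (intro add_pos_nonneg mult_nonneg_nonneg) auto
  then show "0 < small_step K" using \<eta>\<^sub>0_pos m_pos by (simp add: small_step_def)
qed

definition crude_factor :: "nat \<Rightarrow> (nat \<Rightarrow> real) \<Rightarrow> nat \<Rightarrow> real" where
  "crude_factor K \<gamma> n = (\<Prod>k<n. 1 + (growth_const K (\<gamma> (Suc k)))\<^sup>2 * size_const K)"

lemma crude_factor_mono: "n \<le> n' \<Longrightarrow> crude_factor K \<gamma> n \<le> crude_factor K \<gamma> n'"
  and crude_factor_ge_1: "1 \<le> crude_factor K \<gamma> n"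
proof -
  have s: "0 \<le> (growth_const K (\<gamma> (Suc k)))\<^sup>2 * size_const K" for k using const_nonneg(2) by simp
  show ge: "1 \<le> crude_factor K \<gamma> n" for n
    unfolding crude_factor_def using s by (intro prod_ge_1) (simp add: add_increasing2)
  show "crude_factor K \<gamma> n \<le> crude_factor K \<gamma> n'" if "n \<le> n'"
    using that
  proof (induction n' rule: dec_induct)
    case (step k)
    have "crude_factor K \<gamma> k * 1 \<le> crude_factor K \<gamma> k * (1 + (growth_const K (\<gamma> (Suc k)))\<^sup>2 * size_const K)"
      using ge[of k] s[of k] by (intro mult_left_mono) auto
    then show ?case using step by (simp add: crude_factor_def)
  qed simp
qed

end

context prlmc_chain
begin

lemma size_bound: "expectation (\<lambda>w. (size_at n w)\<^sup>2) \<le> size_const K * (1 + second_moment n)"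
proof -
  have "expectation (\<lambda>w. (size_at n w)\<^sup>2) \<le> (real K + 2) * (second_moment n + (real K + 1) * \<sigma>2)"
    unfolding \<sigma>2_def by (rule size_square(2)[OF Y_square_integrable])
  also have "\<dots> \<le> (real K + 2) * ((1 + (real K + 1) * \<sigma>2) * (1 + second_moment n))"
    using const_nonneg(1) second_moment_nonneg[of n]
    by (intro mult_left_mono) (auto simp: algebra_simps)
  finally show ?thesis by (simp add: size_const_def mult.assoc)
qed

text \<open>
  Large steps may expand, but there are only finitely many of them; the product of the expansion
  factors enters only the constants that depend on the step sequence.
\<close>

lemma second_moment_crude: "1 + second_moment n \<le> crude_factor K \<gamma> n * (1 + (norm x)\<^sup>2)"
proof (induction n)
  case 0
  then show ?case by (simp add: second_moment_def crude_factor_def prob_space)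
next
  case (Suc n)
  have "second_moment (Suc n) \<le> (growth_const K (\<gamma> (Suc n)))\<^sup>2 * (size_const K * (1 + second_moment n))"
    by (rule order_trans[OF second_moment_growth]) (intro mult_left_mono size_bound; simp)
  then have "1 + second_moment (Suc n) \<le> (1 + (growth_const K (\<gamma> (Suc n)))\<^sup>2 * size_const K) * (1 + second_moment n)"
    using second_moment_nonneg[of n] by (simp add: algebra_simps)
  also have "\<dots> \<le> (1 + (growth_const K (\<gamma> (Suc n)))\<^sup>2 * size_const K) * (crude_factor K \<gamma> n * (1 + (norm x)\<^sup>2))"
    using const_nonneg(2) by (intro mult_left_mono Suc) auto
  finally show ?case by (simp add: crude_factor_def mult_ac)
qed

lemma second_moment_contraction:
  assumes c: "\<gamma> (Suc n) \<le> small_step K"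
  shows "second_moment (Suc n) \<le> (1 - \<beta>' * \<gamma> (Suc n)) * second_moment n + \<gamma> (Suc n) * (\<beta>' * moment_limit)"
proof -
  let ?c = "\<gamma> (Suc n)"
  define k where "k = moment_const K * size_const K"
  have k: "0 \<le> k" using const_nonneg by (simp add: k_def)
  have c0: "0 < ?c" "?c \<le> \<eta>\<^sub>0" using steps_pos c by (auto simp: small_step_def)
  have "?c \<le> (m / (8 * (1 + k)))\<^sup>2" using c by (simp add: small_step_def k_def)
  then have "sqrt ?c \<le> sqrt ((m / (8 * (1 + k)))\<^sup>2)" by (rule real_sqrt_le_mono)
  also have "\<dots> = m / (8 * (1 + k))" using m_pos k by simp
  finally have "sqrt ?c * (1 + k) \<le> m / (8 * (1 + k)) * (1 + k)" using k by (intro mult_right_mono) auto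
  also have "m / (8 * (1 + k)) * (1 + k) = m / 8"
  proof -
    have "m / (8 * q) * q = m / 8" if "q \<noteq> 0" for q using that by simp
    from this[of "1 + k"] show ?thesis using k by simp
  qed
  finally have "sqrt ?c * (1 + k) \<le> m / 8" .
  moreover have "sqrt ?c * k \<le> sqrt ?c * (1 + k)" using c0 by (intro mult_left_mono) auto
  ultimately have sk: "sqrt ?c * k \<le> m / 8" by linarith
  have "sqrt ?c * (moment_const K * expectation (\<lambda>w. (size_at n w)\<^sup>2)) \<le> sqrt ?c * (moment_const K * (size_const K * (1 + second_moment n)))"
    using c0 const_nonneg by (intro mult_left_mono size_bound) auto
  also have "\<dots> = (sqrt ?c * k) * (1 + second_moment n)" by (simp add: k_def)
  also have "\<dots> \<le> (m / 8) * (1 + second_moment n)" using sk second_moment_nonneg[of n] by (intro mult_right_mono) auto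
  finally have "?c * (sqrt ?c * (moment_const K * expectation (\<lambda>w. (size_at n w)\<^sup>2))) \<le> ?c * ((m / 8) * (1 + second_moment n))"
    using c0 by (intro mult_left_mono) auto
  then have "second_moment (Suc n) \<le> (1 - \<beta> * ?c) * second_moment n + 2 * ?c * \<sigma>2 + ?c * ((m / 8) * (1 + second_moment n))"
    using second_moment_step[OF c0(2)] by (simp add: \<sigma>2_def)
  also have "\<dots> = (1 - \<beta>' * ?c) * second_moment n + ?c * (2 * \<sigma>2 + m / 8)"
    by (simp add: \<beta>_def \<beta>'_def algebra_simps)
  finally show ?thesis using const_nonneg(5) by (simp add: moment_limit_def)
qed

text \<open>
  The bound is uniform over the whole class of test functions, because the recursion applies the
  bound for one step to the image of a test function under the Euler kernel.
\<close>

definition gap_le :: "nat \<Rightarrow> real \<Rightarrow> bool" where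
  "gap_le n \<delta> \<longleftrightarrow> (\<forall>A g. C11 A (\<kappa> * A) g \<longrightarrow>
     \<bar>expectation (\<lambda>w. g (Y n w)) - (\<integral>y. g y \<partial>gibbs U)\<bar> \<le> A * \<delta>)"

lemma gap_crude: "gap_le n (1 + second_moment n + gibbs_moment)"
  unfolding gap_le_def
proof (intro allI impI)
  fix A and g :: "'a \<Rightarrow> real" assume g: "C11 A (\<kappa> * A) g"
  note lip = C11_lipschitz[OF g]
  have A: "0 \<le> A" using lip lipschitz_on_nonneg by blast
  have i: "integrable M (\<lambda>w. g (Y n w))" by (rule integrable_lipschitz[OF lip Y_integrable])
  let ?p = "\<integral>y. g y \<partial>gibbs U"
  have "\<bar>expectation (\<lambda>w. g (Y n w)) - ?p\<bar> = \<bar>expectation (\<lambda>w. g (Y n w) - ?p)\<bar>"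
    using i by (simp add: prob_space)
  also have "\<dots> \<le> expectation (\<lambda>w. A * (1 + (norm (Y n w))\<^sup>2 + gibbs_moment))"
  proof (rule order_trans[OF integral_abs_bound integral_mono])
    show "integrable M (\<lambda>w. \<bar>g (Y n w) - ?p\<bar>)" using i by auto
    show "integrable M (\<lambda>w. A * (1 + (norm (Y n w))\<^sup>2 + gibbs_moment))" using Y_square_integrable[of n] by auto
    fix w
    have "A * (norm (Y n w) + gibbs_moment) \<le> A * (1 + (norm (Y n w))\<^sup>2 + gibbs_moment)"
      using A by (intro mult_left_mono add_mono le_one_plus_square) auto
    with lipschitz_minus_gibbs_mean[OF lip, of "Y n w"]
    show "\<bar>g (Y n w) - ?p\<bar> \<le> A * (1 + (norm (Y n w))\<^sup>2 + gibbs_moment)" by linarith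
  qed
  also have "\<dots> = A * (1 + second_moment n + gibbs_moment)"
    using Y_square_integrable[of n] by (simp add: second_moment_def prob_space)
  finally show "\<bar>expectation (\<lambda>w. g (Y n w)) - ?p\<bar> \<le> A * (1 + second_moment n + gibbs_moment)" .
qed

text \<open>
  One more step replaces \<open>g\<close> by its image under the Euler kernel, which lies in the class with
  constant \<open>1 - \<beta> * c\<close>. The price is the weak error of the step on the side of the scheme and the
  defect of invariance on the side of the Gibbs measure, both of second order.
\<close>

lemma gap_step:
  assumes C: "\<And>A g \<eta>. \<lbrakk>A-lipschitz_on UNIV g; 0 < \<eta>; \<eta> \<le> 1\<rbrakk> \<Longrightarrow>
       \<bar>(\<integral>x. euler \<eta> g x \<partial>gibbs U) - (\<integral>x. g x \<partial>gibbs U)\<bar> \<le> C * A * \<eta>\<^sup>2"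
    and c: "\<gamma> (Suc n) \<le> \<eta>\<^sub>0" and gap: "gap_le n \<delta>"
  shows "gap_le (Suc n) ((1 - \<beta> * \<gamma> (Suc n)) * \<delta> + (step_const K * (1 + second_moment n) + C) * (\<gamma> (Suc n))\<^sup>2)"
  unfolding gap_le_def
proof (intro allI impI)
  fix A and g :: "'a \<Rightarrow> real" assume g: "C11 A (\<kappa> * A) g"
  let ?c = "\<gamma> (Suc n)"
  have c1: "?c \<le> 1" using c \<eta>\<^sub>0_le_1 by simp
  have A: "0 \<le> A" using C11_lipschitz[OF g] lipschitz_on_nonneg by blast
  have "\<bar>expectation (\<lambda>w. g (Y (Suc n) w)) - expectation (\<lambda>w. euler ?c g (Y n w))\<bar>
    \<le> weak_const K * A * ?c\<^sup>2 * (1 + expectation (\<lambda>w. (size_at n w)\<^sup>2))"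
    by (rule one_step_weak_error[OF g c1])
  also have "\<dots> \<le> weak_const K * A * ?c\<^sup>2 * ((1 + size_const K) * (1 + second_moment n))"
  proof (intro mult_left_mono)
    show "1 + expectation (\<lambda>w. (size_at n w)\<^sup>2) \<le> (1 + size_const K) * (1 + second_moment n)"
      using size_bound[of n] second_moment_nonneg[of n] const_nonneg(2)[of K] by (simp add: algebra_simps)
  qed (use weak_const_nonneg A in simp)
  also have "\<dots> = A * (step_const K * (1 + second_moment n) * ?c\<^sup>2)" by (simp add: step_const_def mult_ac)
  finally have 1: "\<bar>expectation (\<lambda>w. g (Y (Suc n) w)) - expectation (\<lambda>w. euler ?c g (Y n w))\<bar>
    \<le> A * (step_const K * (1 + second_moment n) * ?c\<^sup>2)" .
  have 2: "\<bar>expectation (\<lambda>w. euler ?c g (Y n w)) - (\<integral>y. euler ?c g y \<partial>gibbs U)\<bar> \<le> ((1 - \<beta> * ?c) * A) * \<delta>"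
    using gap euler_C11[OF g steps_pos c] unfolding gap_le_def by blast
  have 3: "\<bar>(\<integral>y. euler ?c g y \<partial>gibbs U) - (\<integral>y. g y \<partial>gibbs U)\<bar> \<le> C * A * ?c\<^sup>2"
    by (rule C[OF C11_lipschitz[OF g] steps_pos c1])
  have "A * ((1 - \<beta> * ?c) * \<delta> + (step_const K * (1 + second_moment n) + C) * ?c\<^sup>2)
    = A * (step_const K * (1 + second_moment n) * ?c\<^sup>2) + ((1 - \<beta> * ?c) * A) * \<delta> + C * A * ?c\<^sup>2"
    by (simp add: algebra_simps)
  then show "\<bar>expectation (\<lambda>w. g (Y (Suc n) w)) - (\<integral>y. g y \<partial>gibbs U)\<bar>
    \<le> A * ((1 - \<beta> * ?c) * \<delta> + (step_const K * (1 + second_moment n) + C) * ?c\<^sup>2)"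
    using 1 2 3 by linarith
qed

text \<open>
  From an index on, the steps decay at most like \<open>exp (- m t / 2)\<close>, which is slower than the
  contraction: the accumulated one-step errors are then dominated by the last one.
\<close>

lemma gap_long_time:
  assumes C: "0 \<le> C" "\<And>A g \<eta>. \<lbrakk>A-lipschitz_on UNIV g; 0 < \<eta>; \<eta> \<le> 1\<rbrakk> \<Longrightarrow>
       \<bar>(\<integral>x. euler \<eta> g x \<partial>gibbs U) - (\<integral>x. g x \<partial>gibbs U)\<bar> \<le> C * A * \<eta>\<^sup>2"
    and n\<^sub>0: "0 < n\<^sub>0"
    and late: "\<And>n. n\<^sub>0 \<le> n \<Longrightarrow> \<gamma> (Suc n) \<le> small_step K"
      "\<And>n. n\<^sub>0 \<le> n \<Longrightarrow> \<gamma> n \<le> \<gamma> (Suc n) * (1 + m / 2 * \<gamma> (Suc n))"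
    and n: "n\<^sub>0 \<le> n"
  shows "gap_le n (4 * (step_const K * (1 + moment_limit) + C) / m * \<gamma> n
      + (1 + gibbs_moment + 8 * step_const K / m) * (1 + second_moment n\<^sub>0)
        * exp (- \<beta>' * (step_time \<gamma> n - step_time \<gamma> n\<^sub>0)))"
proof -
  define e where "e n = exp (- \<beta>' * (step_time \<gamma> n - step_time \<gamma> n\<^sub>0))" for n
  define a where "a = 4 * (step_const K * (1 + moment_limit) + C) / m"
  define M\<^sub>0 where "M\<^sub>0 = second_moment n\<^sub>0"
  define b where "b = (1 + gibbs_moment + 8 * step_const K / m) * (1 + M\<^sub>0)"
  have M\<^sub>0: "0 \<le> M\<^sub>0" by (simp add: M\<^sub>0_def second_moment_nonneg)
  have a: "0 \<le> a" using const_nonneg C(1) m_pos by (simp add: a_def)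
  have b_ge: "1 + M\<^sub>0 + gibbs_moment \<le> b" "8 * step_const K / m * M\<^sub>0 \<le> b" "0 \<le> b"
  proof -
    have s: "0 \<le> 8 * step_const K / m" using const_nonneg m_pos by simp
    have "b = (1 + M\<^sub>0 + gibbs_moment) + gibbs_moment * M\<^sub>0 + 8 * step_const K / m * (1 + M\<^sub>0)"
      by (simp add: b_def algebra_simps)
    moreover have "0 \<le> gibbs_moment * M\<^sub>0" "0 \<le> 8 * step_const K / m * 1" "0 \<le> 8 * step_const K / m * M\<^sub>0"
      using gibbs_moment_nonneg M\<^sub>0 s mult_nonneg_nonneg[OF s M\<^sub>0] by auto
    ultimately show "1 + M\<^sub>0 + gibbs_moment \<le> b" "8 * step_const K / m * M\<^sub>0 \<le> b" "0 \<le> b"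
      using gibbs_moment_nonneg M\<^sub>0 by (simp_all add: distrib_left)
  qed
  have e_pos: "0 < e n" for n by (simp add: e_def)
  have e_Suc: "(1 - \<beta>' * \<gamma> (Suc n)) * e n \<le> e (Suc n)" for n
  proof -
    have "step_time \<gamma> (Suc n) = step_time \<gamma> n + \<gamma> (Suc n)" by (simp add: step_time_def)
    then have "e (Suc n) = exp (- \<beta>' * \<gamma> (Suc n)) * e n"
      by (simp add: e_def algebra_simps flip: exp_add)
    moreover have "1 - \<beta>' * \<gamma> (Suc n) \<le> exp (- \<beta>' * \<gamma> (Suc n))"
      using exp_ge_add_one_self[of "- \<beta>' * \<gamma> (Suc n)"] by simp
    ultimately show ?thesis using e_pos[of n] by (simp add: mult_right_mono)
  qed
  have moments: "second_moment n \<le> moment_limit + e n * M\<^sub>0" if "n\<^sub>0 \<le> n" for n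
    using that
  proof (induction n rule: dec_induct)
    case base
    then show ?case using const_nonneg(6) by (simp add: e_def M\<^sub>0_def)
  next
    case (step n)
    have c: "0 \<le> 1 - \<beta>' * \<gamma> (Suc n)"
    proof -
      have "\<beta> * \<gamma> (Suc n) \<le> 1/2" using late(1)[OF step(1)] by (intro \<beta>_\<eta>) (simp add: small_step_def)
      moreover have "\<beta>' * \<gamma> (Suc n) \<le> \<beta> * \<gamma> (Suc n)"
        using steps_pos[of n] m_pos by (intro mult_right_mono) (auto simp: \<beta>_def \<beta>'_def)
      ultimately show ?thesis by linarith
    qed
    have "second_moment (Suc n) \<le> (1 - \<beta>' * \<gamma> (Suc n)) * (moment_limit + e n * M\<^sub>0) + \<gamma> (Suc n) * (\<beta>' * moment_limit)"
      using second_moment_contraction[OF late(1)[OF step(1)]] mult_left_mono[OF step(3) c] by linarith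
    also have "\<dots> = moment_limit + ((1 - \<beta>' * \<gamma> (Suc n)) * e n) * M\<^sub>0" by (simp add: algebra_simps)
    also have "\<dots> \<le> moment_limit + e (Suc n) * M\<^sub>0"
      using e_Suc M\<^sub>0 by (intro add_left_mono mult_right_mono) auto
    finally show ?case .
  qed
  have gap_mono: "gap_le n \<delta> \<Longrightarrow> \<delta> \<le> \<delta>' \<Longrightarrow> gap_le n \<delta>'" for n \<delta> \<delta>'
  proof -
    assume g: "gap_le n \<delta>" and d: "\<delta> \<le> \<delta>'"
    have "A * \<delta> \<le> A * \<delta>'" if "C11 A (\<kappa> * A) g" for A and g :: "'a \<Rightarrow> real"
      using C11_lipschitz[OF that] lipschitz_on_nonneg d by (intro mult_left_mono) blast+
    then show ?thesis using g unfolding gap_le_def by (meson order_trans)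
  qed
  have "gap_le n (a * \<gamma> n + b * e n)"
    using n
  proof (induction n rule: dec_induct)
    case base
    have "0 \<le> \<gamma> n\<^sub>0" using steps_pos[of "n\<^sub>0 - 1"] n\<^sub>0 by simp
    then show ?case
      using a b_ge by (intro gap_mono[OF gap_crude]) (simp add: e_def M\<^sub>0_def[symmetric] add_increasing)
  next
    case (step n)
    let ?c = "\<gamma> (Suc n)"
    have c: "0 < ?c" "?c \<le> \<eta>\<^sub>0" "?c \<le> 1"
      using steps_pos late(1)[OF step(1)] \<eta>\<^sub>0_le_1 by (auto simp: small_step_def intro: order_trans)
    have r: "0 \<le> 1 - \<beta> * ?c" using \<beta>_\<eta>[OF c(2)] by simp
    have s: "0 \<le> step_const K" by (rule const_nonneg)
    let ?q = "step_const K * (1 + moment_limit) + C"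
    have 1: "(1 - \<beta> * ?c) * (a * \<gamma> n) + ?q * ?c\<^sup>2 \<le> a * ?c"
    proof -
      have "(1 - \<beta> * ?c) * (a * \<gamma> n) \<le> (1 - \<beta> * ?c) * (a * (?c * (1 + m / 2 * ?c)))"
        by (intro mult_left_mono late(2)[OF step(1)] r a)
      also have "\<dots> = a * ?c * (1 - m / 4 * ?c - 3 / 8 * (m * ?c)\<^sup>2)"
        by (simp add: \<beta>_def power2_eq_square algebra_simps)
      also have "\<dots> \<le> a * ?c * (1 - m / 4 * ?c)" using a c by (intro mult_left_mono) auto
      also have "\<dots> = a * ?c - ?q * ?c\<^sup>2" using m_pos by (simp add: a_def power2_eq_square field_simps)
      finally show ?thesis by simp
    qed
    have 2: "(1 - \<beta> * ?c) * (b * e n) + step_const K * (e n * M\<^sub>0) * ?c\<^sup>2 \<le> b * e (Suc n)"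
    proof -
      have "step_const K * M\<^sub>0 \<le> m / 8 * b" using b_ge(2) m_pos by (simp add: field_simps)
      moreover have "step_const K * M\<^sub>0 * ?c \<le> step_const K * M\<^sub>0 * 1" using c s M\<^sub>0 by (intro mult_left_mono) auto
      ultimately have "step_const K * M\<^sub>0 * ?c \<le> m / 8 * b" by linarith
      then have "(step_const K * M\<^sub>0 * ?c) * (?c * e n) \<le> (m / 8 * b) * (?c * e n)"
        using c e_pos[of n] by (intro mult_right_mono) auto
      then have "(1 - \<beta> * ?c) * (b * e n) + step_const K * (e n * M\<^sub>0) * ?c\<^sup>2 \<le> b * ((1 - \<beta>' * ?c) * e n)"
        by (simp add: \<beta>_def \<beta>'_def power2_eq_square algebra_simps)
      also have "\<dots> \<le> b * e (Suc n)" using e_Suc b_ge by (intro mult_left_mono) auto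
      finally show ?thesis .
    qed
    have "(step_const K * (1 + second_moment n) + C) * ?c\<^sup>2 \<le> (step_const K * (1 + (moment_limit + e n * M\<^sub>0)) + C) * ?c\<^sup>2"
      using moments[OF step(1)] s by (intro mult_right_mono add_right_mono mult_left_mono add_left_mono) auto
    then have "(1 - \<beta> * ?c) * (a * \<gamma> n + b * e n) + (step_const K * (1 + second_moment n) + C) * ?c\<^sup>2
      \<le> ((1 - \<beta> * ?c) * (a * \<gamma> n) + ?q * ?c\<^sup>2) + ((1 - \<beta> * ?c) * (b * e n) + step_const K * (e n * M\<^sub>0) * ?c\<^sup>2)"
      by (simp add: algebra_simps)
    also have "\<dots> \<le> a * ?c + b * e (Suc n)" by (intro add_mono 1 2)
    finally have "(1 - \<beta> * ?c) * (a * \<gamma> n + b * e n) + (step_const K * (1 + second_moment n) + C) * ?c\<^sup>2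
      \<le> a * ?c + b * e (Suc n)" .
    from gap_mono[OF gap_step[OF C(2) c(2) step(3)] this] show ?case .
  qed
  then show ?thesis by (simp add: a_def b_def e_def M\<^sub>0_def)
qed

end


section \<open>Test functions and potentials of the given regularity\<close>

lemma differentiable_imp_fderiv:
  assumes "f differentiable (at x)"
  shows "(f has_derivative blinfun_apply (fderiv f x)) (at x)"
proof -
  have d: "(f has_derivative frechet_derivative f (at x)) (at x)"
    using assms frechet_derivative_works by blast
  then have "blinfun_apply (fderiv f x) = frechet_derivative f (at x)"
    unfolding fderiv_def by (intro bounded_linear_Blinfun_apply has_derivative_bounded_linear)
  then show ?thesis using d by simp
qed

lemma fderiv_lipschitz:
  assumes d: "\<And>x. f differentiable (at x)" and b: "\<And>x. norm (fderiv f x) \<le> b"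
  shows "norm (f x - f y) \<le> b * norm (x - y)"
proof (rule differentiable_bound[of UNIV f "\<lambda>x. blinfun_apply (fderiv f x)"])
  show "(f has_derivative blinfun_apply (fderiv f x)) (at x within UNIV)" for x
    using differentiable_imp_fderiv[OF d] by simp
  show "onorm (blinfun_apply (fderiv f x)) \<le> b" for x using b[of x] by (simp add: norm_blinfun.rep_eq)
qed auto

lemma sup_norm_le: "sup_norm f \<le> ereal b \<Longrightarrow> norm (f x) \<le> b"
  unfolding sup_norm_def by (simp add: SUP_le_iff)

text \<open>
  The definitions of the regularity classes express derivatives by nested bounded linear maps; this
  map turns a linear form into the vector that represents it.
\<close>

definition riesz :: "('a::euclidean_space \<Rightarrow>\<^sub>L real) \<Rightarrow> 'a" where
  "riesz \<phi> = (\<Sum>b\<in>Basis. blinfun_apply \<phi> b *\<^sub>R b)"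

lemma inner_riesz: "riesz \<phi> \<bullet> v = blinfun_apply \<phi> v"
proof -
  have "blinfun_apply \<phi> v = blinfun_apply \<phi> (\<Sum>b\<in>Basis. (v \<bullet> b) *\<^sub>R b)" by (simp add: euclidean_representation)
  also have "\<dots> = (\<Sum>b\<in>Basis. (v \<bullet> b) * blinfun_apply \<phi> b)" by (simp add: blinfun.sum_right blinfun.scaleR_right)
  also have "\<dots> = riesz \<phi> \<bullet> v"
    unfolding riesz_def inner_sum_left inner_scaleR_left by (intro sum.cong refl) (simp add: inner_commute)
  finally show ?thesis by simp
qed

lemma norm_riesz_le: "norm (riesz \<phi>) \<le> norm \<phi>"
proof (rule norm_le_of_inner)
  show "riesz \<phi> \<bullet> v \<le> norm \<phi> * norm v" for v
    using norm_blinfun[of \<phi> v] by (simp add: inner_riesz)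
qed simp

lemma riesz_diff: "riesz (\<phi> - \<psi>) = riesz \<phi> - riesz \<psi>"
  by (simp add: riesz_def blinfun.diff_left scaleR_diff_left sum_subtractf)

lemma bounded_linear_riesz: "bounded_linear riesz"
proof (rule bounded_linear_intro[where K=1])
  show "riesz (\<phi> + \<psi>) = riesz \<phi> + riesz \<psi>" for \<phi> \<psi> :: "'a \<Rightarrow>\<^sub>L real"
    by (simp add: riesz_def blinfun.add_left scaleR_add_left sum.distrib)
  show "riesz (r *\<^sub>R \<phi>) = r *\<^sub>R riesz \<phi>" for r and \<phi> :: "'a \<Rightarrow>\<^sub>L real"
    by (simp add: riesz_def blinfun.scaleR_left scaleR_sum_right)
qed (simp add: norm_riesz_le)

lemma GDERIV_riesz: "f differentiable (at x) \<Longrightarrow> GDERIV f x :> riesz (fderiv f x)"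
  unfolding gderiv_def
  by (rule has_derivative_eq_rhs[OF differentiable_imp_fderiv]) (auto simp: inner_riesz inner_commute[of _ "riesz (fderiv f x)"])

lemma C11_of_C2:
  fixes h :: "'a::euclidean_space \<Rightarrow> real"
  assumes h: "C2 h" and a: "sup_norm (fderiv h) \<le> ereal a" and b: "sup_norm (fderiv (fderiv h)) \<le> ereal b"
  shows "C11 a b h"
  unfolding C11_def
proof (intro exI[of _ "\<lambda>x. riesz (fderiv h x)"] conjI allI lipschitz_onI)
  show "GDERIV h x :> riesz (fderiv h x)" for x using h by (intro GDERIV_riesz) (simp add: C2_def)
  show "norm (riesz (fderiv h x)) \<le> a" for x using sup_norm_le[OF a] by (rule order_trans[OF norm_riesz_le])
  show "dist (riesz (fderiv h x)) (riesz (fderiv h y)) \<le> b * dist x y" for x y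
  proof -
    have "norm (fderiv h x - fderiv h y) \<le> b * norm (x - y)"
      using h by (intro fderiv_lipschitz sup_norm_le[OF b]) (auto simp: C2_def C1_def)
    then show ?thesis unfolding dist_norm riesz_diff[symmetric] by (rule order_trans[OF norm_riesz_le])
  qed
  show "0 \<le> b" using order_trans[OF norm_ge_zero sup_norm_le[OF b]] .
qed

lemma C11_mono: "C11 A C h \<Longrightarrow> C \<le> C' \<Longrightarrow> C11 A C' h"
  unfolding C11_def by (meson lipschitz_on_mono order_refl)

lemma sup_norm_finite:
  assumes "sup_norm f < \<infinity>" obtains b where "sup_norm f \<le> ereal b"
  using assms by (cases "sup_norm f") auto

lemma class_G_lipschitz:
  assumes "h \<in> class_G" obtains A where "A-lipschitz_on UNIV h"
proof -
  have h: "C2 h" "sup_norm (fderiv h) < \<infinity>" "sup_norm (fderiv (fderiv h)) < \<infinity>"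
    using assms unfolding class_G_def by auto
  obtain a where a: "sup_norm (fderiv h) \<le> ereal a" using sup_norm_finite[OF h(2)] .
  obtain b where b: "sup_norm (fderiv (fderiv h)) \<le> ereal b" using sup_norm_finite[OF h(3)] .
  show ?thesis using that[OF C11_lipschitz[OF C11_of_C2[OF h(1) a b]]] .
qed

lemma P0_of_first_moment:
  fixes \<mu> :: "'a::euclidean_space measure"
  assumes "prob_space \<mu>" and sets: "sets \<mu> = sets borel" and i: "integrable \<mu> (\<lambda>y. y)"
  shows "\<mu> \<in> P0"
proof -
  interpret prob_space \<mu> by fact
  have "integrable \<mu> h" if hG: "h \<in> class_G" for h
  proof -
    obtain A where "A-lipschitz_on UNIV h" using class_G_lipschitz[OF hG] .
    from integrable_lipschitz[OF this i] show ?thesis .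
  qed
  then show ?thesis
    unfolding P0_def by (intro CollectI conjI ballI prob_space_axioms sets) auto
qed

lemma grad_eq:
  assumes "GDERIV f x :> D" shows "grad f x = D"
  unfolding grad_def
proof (rule the_equality[of _ D])
  fix D' assume D': "GDERIV f x :> D'"
  have "(\<lambda>h. h \<bullet> D') = (\<lambda>h. h \<bullet> D)"
    using has_derivative_unique[OF D'[unfolded gderiv_def] assms[unfolded gderiv_def]] .
  then have "(D' - D) \<bullet> D' = (D' - D) \<bullet> D" by metis
  then have "(D' - D) \<bullet> (D' - D) = 0" by (simp only: inner_diff_right[of "D' - D"])
  then show "D' = D" by simp
qed (rule assms)

text \<open>
  For any \<open>v\<close>, comparing \<open>U (y + v)\<close> with the expansions at \<open>x\<close> from above and at \<open>y\<close> from below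
  bounds \<open>(F y - F x) \<bullet> v\<close> by a multiple of \<open>(norm (x - y) + norm v)\<^sup>2\<close>. The choice of \<open>v\<close> parallel to
  \<open>F y - F x\<close> and as long as \<open>x - y\<close> gives the constant \<open>2 * L\<close>.
\<close>

lemma gradient_lipschitz_of_quadratic_bounds:
  fixes U :: "'a::real_inner \<Rightarrow> real"
  assumes lo: "\<And>x y. 0 \<le> U y - U x - F x \<bullet> (y - x)"
    and up: "\<And>x y. U y - U x - F x \<bullet> (y - x) \<le> L / 2 * (norm (x - y))\<^sup>2"
    and L: "0 \<le> L"
  shows "norm (F x - F y) \<le> 2 * L * norm (x - y)"
proof (cases "F x = F y")
  case True
  then show ?thesis using L by simp
next
  case False
  define D where "D = F y - F x"
  define r where "r = norm (x - y)"
  define v where "v = (r / norm D) *\<^sub>R D"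
  have D: "0 < norm D" using False by (simp add: D_def)
  have r: "0 \<le> r" by (simp add: r_def)
  have v: "norm v = r" "D \<bullet> v = r * norm D"
    using D r by (auto simp: v_def dot_square_norm power2_eq_square)
  have "F y \<bullet> v - F x \<bullet> v \<le> L / 2 * (norm (x - (y + v)))\<^sup>2"
    using lo[of "y + v" y] lo[of y x] up[of "y + v" x] by (simp add: inner_diff_right inner_add_right algebra_simps)
  also have "\<dots> \<le> L / 2 * (2 * r)\<^sup>2"
    using norm_triangle_ineq4[of "x - y" v] L v(1)
    by (intro mult_left_mono power_mono) (auto simp: r_def diff_diff_eq)
  finally have "r * norm D \<le> r * (2 * L * r)" using v(2) by (simp add: D_def inner_diff_left power2_eq_square mult_ac)
  show ?thesis
  proof (cases "r = 0")
    case True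
    then show ?thesis using False by (simp add: r_def)
  next
    case False
    then have "norm D \<le> 2 * L * r" using \<open>r * norm D \<le> r * (2 * L * r)\<close> r by simp
    then show ?thesis by (simp add: D_def r_def norm_minus_commute)
  qed
qed

lemma strongly_convex_potential_of_C3:
  fixes U :: "'a::euclidean_space \<Rightarrow> real"
  assumes U: "C3 U" and F0: "grad U 0 = 0" and m: "0 < m" "m \<le> L"
    and lo: "\<And>x y. m / 2 * (norm (x - y))\<^sup>2 \<le> U y - U x - grad U x \<bullet> (y - x)"
    and up: "\<And>x y. U y - U x - grad U x \<bullet> (y - x) \<le> L / 2 * (norm (x - y))\<^sup>2"
    and L': "sup_norm (fderiv (fderiv (fderiv U))) \<le> ereal L'"
  shows "strongly_convex_potential U (grad U) (\<lambda>x v. riesz (blinfun_apply (fderiv (fderiv U) x) v)) m (2 * L) L'"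
proof
  have d: "U differentiable (at x)" "fderiv U differentiable (at x)" "fderiv (fderiv U) differentiable (at x)" for x
    using U by (auto simp: C3_def C2_def C1_def)
  have g: "grad U x = riesz (fderiv U x)" for x by (rule grad_eq[OF GDERIV_riesz[OF d(1)]])
  show "0 < m" "m \<le> 2 * L" "grad U 0 = 0" using m F0 by auto
  show "0 \<le> L'" using order_trans[OF norm_ge_zero sup_norm_le[OF L']] .
  show "GDERIV U x :> grad U x" for x unfolding g by (rule GDERIV_riesz[OF d(1)])
  show "norm (grad U x - grad U y) \<le> 2 * L * norm (x - y)" for x y
  proof (rule gradient_lipschitz_of_quadratic_bounds[OF _ up])
    show "0 \<le> U y - U x - grad U x \<bullet> (y - x)" for x y
      using m(1) by (intro order_trans[OF _ lo]) simp
  qed (use m in simp)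
  show "m * (norm (x - y))\<^sup>2 \<le> (grad U x - grad U y) \<bullet> (x - y)" for x y
  proof -
    have "m / 2 * (norm (x - y))\<^sup>2 + m / 2 * (norm (y - x))\<^sup>2 \<le> - (grad U x \<bullet> (y - x)) - grad U y \<bullet> (x - y)"
      using lo[of x y] lo[of y x] by linarith
    then show ?thesis by (simp add: norm_minus_commute inner_diff_left inner_diff_right)
  qed
  show "(grad U has_derivative (\<lambda>v. riesz (blinfun_apply (fderiv (fderiv U) x) v))) (at x)" for x
    using bounded_linear.has_derivative[OF bounded_linear_riesz differentiable_imp_fderiv[OF d(2)]]
    unfolding g[abs_def] .
  show "norm (riesz (blinfun_apply (fderiv (fderiv U) x) v) - riesz (blinfun_apply (fderiv (fderiv U) y) v))
      \<le> L' * norm (x - y) * norm v" for x y v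
  proof -
    let ?D = "fderiv (fderiv U) x - fderiv (fderiv U) y"
    have "norm (riesz (blinfun_apply (fderiv (fderiv U) x) v) - riesz (blinfun_apply (fderiv (fderiv U) y) v)) \<le> norm (blinfun_apply ?D v)"
      unfolding riesz_diff[symmetric] blinfun.diff_left[symmetric] by (rule norm_riesz_le)
    also have "\<dots> \<le> norm ?D * norm v" by (rule norm_blinfun)
    also have "\<dots> \<le> L' * norm (x - y) * norm v"
      by (intro mult_right_mono fderiv_lipschitz d sup_norm_le[OF L']) simp
    finally show ?thesis .
  qed
  show "U 0 + m / 2 * (norm x)\<^sup>2 \<le> U x" for x using lo[of 0 x] F0 by simp
qed

lemma admissible_steps_decay:
  assumes "admissible_steps m \<gamma>"
  obtains N where "\<And>n. N \<le> n \<Longrightarrow> \<gamma> n \<le> \<gamma> (Suc n) * (1 + m / 2 * \<gamma> (Suc n))"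
proof -
  let ?f = "\<lambda>n. ereal ((\<gamma> n - \<gamma> (Suc n)) / (\<gamma> (Suc n))\<^sup>2)"
  have pos: "0 < \<gamma> (Suc n)" for n using assms by (simp add: admissible_steps_def)
  have "2 * limsup ?f < ereal m" using assms by (simp add: admissible_steps_def step_omega_def)
  then have "limsup ?f < ereal (m / 2)" by (cases "limsup ?f") auto
  then have "\<forall>\<^sub>F n in sequentially. ?f n < ereal (m / 2)" by (rule Limsup_lessD)
  then obtain N where N: "\<And>n. N \<le> n \<Longrightarrow> (\<gamma> n - \<gamma> (Suc n)) / (\<gamma> (Suc n))\<^sup>2 < m / 2"
    unfolding eventually_sequentially by auto
  show ?thesis
  proof (rule that[of N])
    fix n assume "N \<le> n"
    from N[OF this] have "\<gamma> n - \<gamma> (Suc n) < m / 2 * (\<gamma> (Suc n))\<^sup>2" using pos[of n] by (simp add: pos_divide_less_eq)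
    then show "\<gamma> n \<le> \<gamma> (Suc n) * (1 + m / 2 * \<gamma> (Suc n))" by (simp add: power2_eq_square algebra_simps)
  qed
qed

lemma steps_antimono:
  fixes \<gamma> :: "nat \<Rightarrow> real"
  assumes dec: "\<And>n. 1 \<le> n \<Longrightarrow> \<gamma> (Suc n) \<le> \<gamma> n" and "1 \<le> n" "n \<le> k"
  shows "\<gamma> k \<le> \<gamma> n"
  using assms(3)
proof (induction k rule: dec_induct)
  case (step k)
  then show ?case using dec[of k] assms(2) by simp
qed simp

lemma steps_lower_bound:
  assumes pos: "\<And>n. 0 < \<gamma> (Suc n)" and N: "\<And>n. N \<le> n \<Longrightarrow> \<gamma> n \<le> \<gamma> (Suc n) * (1 + c * \<gamma> (Suc n))"
    and n: "N \<le> n"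
  shows "\<gamma> N * exp (- c * (step_time \<gamma> n - step_time \<gamma> N)) \<le> \<gamma> n"
  using n
proof (induction n rule: dec_induct)
  case (step n)
  let ?c = "\<gamma> (Suc n)"
  have t: "step_time \<gamma> (Suc n) = step_time \<gamma> n + ?c" by (simp add: step_time_def)
  have "\<gamma> N * exp (- c * (step_time \<gamma> (Suc n) - step_time \<gamma> N)) = (\<gamma> N * exp (- c * (step_time \<gamma> n - step_time \<gamma> N))) * exp (- (c * ?c))"
    unfolding t by (simp add: mult.assoc algebra_simps flip: exp_add)
  also have "\<dots> \<le> \<gamma> n * exp (- (c * ?c))" by (intro mult_right_mono step(3)) auto
  also have "\<dots> \<le> (?c * (1 + c * ?c)) * exp (- (c * ?c))" by (intro mult_right_mono N step(1)) auto
  also have "\<dots> \<le> (?c * exp (c * ?c)) * exp (- (c * ?c))"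
    using pos[of n] exp_ge_add_one_self[of "c * ?c"] by (intro mult_right_mono mult_left_mono) auto
  also have "\<dots> = ?c" by (simp add: mult.assoc flip: exp_add)
  finally show ?case .
qed simp



section \<open>The error bounds\<close>

context strongly_convex_potential
begin

text \<open>
  A symmetric version of the distance, on the larger class of test functions that the Euler
  kernel preserves.
\<close>

definition G_close :: "'a measure \<Rightarrow> 'a measure \<Rightarrow> real \<Rightarrow> bool" where
  "G_close \<mu> \<nu> b \<longleftrightarrow> \<mu> \<in> P0 \<and> \<nu> \<in> P0 \<and>
     (\<forall>g. C11 1 \<kappa> g \<longrightarrow> \<bar>(\<integral>y. g y \<partial>\<mu>) - (\<integral>y. g y \<partial>\<nu>)\<bar> \<le> b)"

lemma G_close_mono: "G_close \<mu> \<nu> b \<Longrightarrow> b \<le> b' \<Longrightarrow> G_close \<mu> \<nu> b'"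
  unfolding G_close_def by (meson order_trans)

lemma G_close_triangle:
  assumes "G_close \<mu> \<rho> a" "G_close \<nu> \<rho> b"
  shows "G_close \<mu> \<nu> (a + b)"
  unfolding G_close_def
proof (intro conjI allI impI)
  fix g :: "'a \<Rightarrow> real" assume "C11 1 \<kappa> g"
  then have "\<bar>(\<integral>y. g y \<partial>\<mu>) - (\<integral>y. g y \<partial>\<rho>)\<bar> \<le> a" "\<bar>(\<integral>y. g y \<partial>\<nu>) - (\<integral>y. g y \<partial>\<rho>)\<bar> \<le> b"
    using assms by (auto simp: G_close_def)
  then show "\<bar>(\<integral>y. g y \<partial>\<mu>) - (\<integral>y. g y \<partial>\<nu>)\<bar> \<le> a + b" by linarith
qed (use assms in \<open>auto simp: G_close_def\<close>)

lemma d_G_le_of_G_close: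
  assumes "G_close \<mu> \<nu> b"
  shows "d_G \<mu> \<nu> \<le> ereal b"
proof -
  have "(\<integral>y. h y \<partial>\<mu>) - (\<integral>y. h y \<partial>\<nu>) \<le> b"
    if "h \<in> class_G" "sup_norm (fderiv h) \<le> 1" "sup_norm (fderiv (fderiv h)) \<le> 1" for h
  proof -
    have "C11 1 1 h" using that by (intro C11_of_C2) (auto simp: class_G_def one_ereal_def)
    from C11_mono[OF this \<kappa>_ge(1)] have "\<bar>(\<integral>y. h y \<partial>\<mu>) - (\<integral>y. h y \<partial>\<nu>)\<bar> \<le> b"
      using assms unfolding G_close_def by blast
    then show ?thesis by linarith
  qed
  then show ?thesis
    using assms unfolding G_close_def d_G_def by (simp add: SUP_le_iff)
qed

lemma gibbs_P0: "gibbs U \<in> P0"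
  by (rule P0_of_first_moment[OF prob_space_gibbs sets_gibbs gibbs_integrable_id])

lemma langevin_G_close_gibbs:
  fixes M :: "'w measure"
  assumes B: "brownian_motion M B" and X: "langevin_solution M U B x X"
    and gradU: "\<And>y. grad U y = F y" and t: "0 < t"
  shows "G_close (distr M borel (X t)) (gibbs U) (exp (- \<beta> * t) * (norm x + gibbs_moment))"
proof -
  interpret prob_space M using B by (simp add: brownian_motion_def)
  note i = langevin_integrable[OF B X gradU t]
  have [measurable]: "X t \<in> borel_measurable M" using i by (rule borel_measurable_integrable)
  show ?thesis
    unfolding G_close_def
  proof (intro conjI allI impI gibbs_P0)
    show "distr M borel (X t) \<in> P0"
    proof (rule P0_of_first_moment)
      show "integrable (distr M borel (X t)) (\<lambda>y. y)" using i by (subst integrable_distr_eq) auto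
    qed (auto intro: prob_space_distr)
    fix g :: "'a \<Rightarrow> real" assume "C11 1 \<kappa> g"
    then have g: "1-lipschitz_on UNIV g" by (rule C11_lipschitz)
    then have "g \<in> borel_measurable borel" by (rule lipschitz_borel_measurable)
    then have "(\<integral>y. g y \<partial>distr M borel (X t)) = (\<integral>w. g (X t w) \<partial>M)" by (intro integral_distr) auto
    with langevin_gibbs_bound[OF B X gradU t g]
    show "\<bar>(\<integral>y. g y \<partial>distr M borel (X t)) - (\<integral>y. g y \<partial>gibbs U)\<bar> \<le> exp (- \<beta> * t) * (norm x + gibbs_moment)"
      by simp
  qed
qed

end

context prlmc_chain
begin

lemma Y_law_P0: "distr M borel (Y n) \<in> P0"
proof (rule P0_of_first_moment)
  show "integrable (distr M borel (Y n)) (\<lambda>y. y)"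
    using Y_integrable by (subst integrable_distr_eq) auto
qed (auto intro: prob_space_distr)

lemma Y_G_close_gibbs:
  assumes "gap_le n \<delta>"
  shows "G_close (distr M borel (Y n)) (gibbs U) \<delta>"
  unfolding G_close_def
proof (intro conjI allI impI Y_law_P0 gibbs_P0)
  fix g :: "'a \<Rightarrow> real" assume g: "C11 1 \<kappa> g"
  have "g \<in> borel_measurable borel" by (rule lipschitz_borel_measurable[OF C11_lipschitz[OF g]])
  then have "(\<integral>y. g y \<partial>distr M borel (Y n)) = expectation (\<lambda>w. g (Y n w))" by (intro integral_distr) auto
  moreover have "\<bar>expectation (\<lambda>w. g (Y n w)) - (\<integral>y. g y \<partial>gibbs U)\<bar> \<le> 1 * \<delta>"
    using assms g unfolding gap_le_def by (metis mult.right_neutral)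
  ultimately show "\<bar>(\<integral>y. g y \<partial>distr M borel (Y n)) - (\<integral>y. g y \<partial>gibbs U)\<bar> \<le> \<delta>" by simp
qed

lemma Y_G_close_gibbs_crude:
  "G_close (distr M borel (Y n)) (gibbs U) ((1 + gibbs_moment) * crude_factor K \<gamma> n * (1 + (norm x)\<^sup>2))"
proof (rule G_close_mono[OF Y_G_close_gibbs[OF gap_crude]])
  have "1 + second_moment n + gibbs_moment \<le> (1 + gibbs_moment) * (1 + second_moment n)"
    using gibbs_moment_nonneg second_moment_nonneg[of n] by (simp add: algebra_simps)
  also have "\<dots> \<le> (1 + gibbs_moment) * (crude_factor K \<gamma> n * (1 + (norm x)\<^sup>2))"
    using gibbs_moment_nonneg by (intro mult_left_mono second_moment_crude) auto
  finally show "1 + second_moment n + gibbs_moment \<le> (1 + gibbs_moment) * crude_factor K \<gamma> n * (1 + (norm x)\<^sup>2)"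
    by (simp add: mult.assoc)
qed

end

context strongly_convex_potential
begin

text \<open>
  Bounds for laws \<open>Q n x\<close> with a constant \<open>A\<close> that will be chosen before the step sequence, and \<open>B\<close>
  and \<open>n\<^sub>0\<close> that depend on it: late in the sequence the contribution of \<open>B\<close> tends to zero. The last
  clause limits the decay of the steps; it turns an exponential bound in time, such as the one for
  the diffusion, into a multiple of the step.
\<close>

definition bounded_by_steps ::
    "(nat \<Rightarrow> 'a \<Rightarrow> 'a measure) \<Rightarrow> (nat \<Rightarrow> real) \<Rightarrow> real \<Rightarrow> real \<Rightarrow> nat \<Rightarrow> bool" where
  "bounded_by_steps Q \<gamma> A B n\<^sub>0 \<longleftrightarrow> 0 \<le> B \<and> 0 < n\<^sub>0 \<and>
     (\<forall>n\<ge>n\<^sub>0. \<forall>x. G_close (Q n x) (gibbs U)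
        ((A + B * exp (- (m / 8) * (step_time \<gamma> n - step_time \<gamma> n\<^sub>0))) * (1 + (norm x)\<^sup>2) * \<gamma> n)) \<and>
     (\<forall>n x. 1 \<le> n \<longrightarrow> n < n\<^sub>0 \<longrightarrow> G_close (Q n x) (gibbs U) (B * (1 + (norm x)\<^sup>2) * \<gamma> n)) \<and>
     (\<forall>n\<ge>n\<^sub>0. \<gamma> n\<^sub>0 * exp (- (m / 2) * (step_time \<gamma> n - step_time \<gamma> n\<^sub>0)) \<le> \<gamma> n)"

lemma prlmc_gibbs_distance:
  fixes M :: "'w measure"
  assumes noise: "prlmc_noise M K H \<xi> \<zeta>" and gradU: "\<And>y. grad U y = F y"
  obtains A where "0 \<le> A"
    "\<And>\<gamma>. admissible_steps m \<gamma> \<Longrightarrow>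
       \<exists>B n\<^sub>0. bounded_by_steps (\<lambda>n x. distr M borel (prlmc K U \<gamma> H \<xi> \<zeta> x n)) \<gamma> A B n\<^sub>0"
proof -
  obtain C where C: "0 \<le> C"
    "\<And>A g \<eta>. \<lbrakk>A-lipschitz_on UNIV g; 0 < \<eta>; \<eta> \<le> 1\<rbrakk> \<Longrightarrow>
       \<bar>(\<integral>x. euler \<eta> g x \<partial>gibbs U) - (\<integral>x. g x \<partial>gibbs U)\<bar> \<le> C * A * \<eta>\<^sup>2"
    using euler_gibbs_invariance_defect by blast
  define A where "A = 4 * (step_const K * (1 + moment_limit) + C) / m"
  show ?thesis
  proof (rule that[of A])
    show A: "0 \<le> A" using C(1) const_nonneg m_pos by (simp add: A_def)
    fix \<gamma> assume adm: "admissible_steps m \<gamma>"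
    have pos: "0 < \<gamma> (Suc n)" for n using adm by (simp add: admissible_steps_def)
    have dec: "1 \<le> n \<Longrightarrow> \<gamma> (Suc n) \<le> \<gamma> n" for n using adm by (simp add: admissible_steps_def)
    obtain N where N: "\<And>n. N \<le> n \<Longrightarrow> \<gamma> n \<le> \<gamma> (Suc n) * (1 + m / 2 * \<gamma> (Suc n))"
      using admissible_steps_decay[OF adm] by blast
    have "\<gamma> \<longlonglongrightarrow> 0" using adm by (simp add: admissible_steps_def)
    then have "\<forall>\<^sub>F n in sequentially. \<gamma> n < small_step K"
      using const_nonneg(7)[of K] by (rule order_tendstoD)
    then obtain N' where N': "\<And>n. N' \<le> n \<Longrightarrow> \<gamma> n < small_step K" unfolding eventually_sequentially by blast
    define n\<^sub>0 where "n\<^sub>0 = Suc (N + N')"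
    have n\<^sub>0_pos: "0 < n\<^sub>0" by (simp add: n\<^sub>0_def)
    have late: "\<gamma> (Suc n) \<le> small_step K" "\<gamma> n \<le> \<gamma> (Suc n) * (1 + m / 2 * \<gamma> (Suc n))" if "n\<^sub>0 \<le> n" for n
      using that N[of n] less_imp_le[OF N'[of "Suc n"]] by (auto simp: n\<^sub>0_def)
    have chain: "prlmc_chain U F DF m \<Lambda> \<Lambda>' M K H \<xi> \<zeta> \<gamma>" 
      by unfold_locales (use noise pos gradU in auto)
    define e where "e n = exp (- (m / 8) * (step_time \<gamma> n - step_time \<gamma> n\<^sub>0))" for n
    have \<gamma>0: "0 < \<gamma> n\<^sub>0" by (simp add: n\<^sub>0_def pos)
    define P where "P = crude_factor K \<gamma> n\<^sub>0"
    have P: "1 \<le> P" unfolding P_def by (rule crude_factor_ge_1)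
    define c where "c = 1 + gibbs_moment + 8 * step_const K / m"
    have c: "1 + gibbs_moment \<le> c" "0 \<le> c" using gibbs_moment_nonneg const_nonneg(3)[of K] m_pos by (auto simp: c_def)
    define B where "B = c * P / \<gamma> n\<^sub>0"
    have B: "0 \<le> B" using c P \<gamma>0 by (simp add: B_def)
    have low: "\<gamma> n\<^sub>0 * exp (- (m / 2) * (step_time \<gamma> n - step_time \<gamma> n\<^sub>0)) \<le> \<gamma> n" if "n\<^sub>0 \<le> n" for n
      by (rule steps_lower_bound[where \<gamma>=\<gamma> and c="m / 2"]) (use pos late(2) that in auto)
    have bound: "G_close (distr M borel (prlmc K U \<gamma> H \<xi> \<zeta> x n)) (gibbs U)
          ((A + B * e n) * (1 + (norm x)\<^sup>2) * \<gamma> n)"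
      if n: "n\<^sub>0 \<le> n" for n x
    proof -
      interpret prlmc_chain U F DF m \<Lambda> \<Lambda>' M K H \<xi> \<zeta> \<gamma> x by (rule chain)
      let ?E = "exp (- \<beta>' * (step_time \<gamma> n - step_time \<gamma> n\<^sub>0))"
      have \<gamma>n: "0 \<le> \<gamma> n" using n pos[of "n - 1"] by (simp add: n\<^sub>0_def)
      have "?E = e n * exp (- (m / 2) * (step_time \<gamma> n - step_time \<gamma> n\<^sub>0))"
      proof -
        have "- \<beta>' * \<tau> = - (m / 8) * \<tau> + - (m / 2) * \<tau>" for \<tau> by (simp add: \<beta>'_def field_simps)
        then show ?thesis by (simp only: e_def exp_add)
      qed
      also have "\<dots> \<le> e n * (\<gamma> n / \<gamma> n\<^sub>0)"
        using low[OF n] \<gamma>0 by (intro mult_left_mono) (auto simp: e_def field_simps)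
      finally have E: "?E \<le> e n * (\<gamma> n / \<gamma> n\<^sub>0)" .
      have "A * \<gamma> n + c * (1 + second_moment n\<^sub>0) * ?E \<le> (A * \<gamma> n) * (1 + (norm x)\<^sup>2) + c * (P * (1 + (norm x)\<^sup>2)) * (e n * (\<gamma> n / \<gamma> n\<^sub>0))"
      proof (rule add_mono)
        show "A * \<gamma> n \<le> A * \<gamma> n * (1 + (norm x)\<^sup>2)" using A \<gamma>n mult_left_mono[of 1 "1 + (norm x)\<^sup>2" "A * \<gamma> n"] by simp
        have "c * (1 + second_moment n\<^sub>0) \<le> c * (P * (1 + (norm x)\<^sup>2))"
          unfolding P_def using c by (intro mult_left_mono second_moment_crude)
        then show "c * (1 + second_moment n\<^sub>0) * ?E \<le> c * (P * (1 + (norm x)\<^sup>2)) * (e n * (\<gamma> n / \<gamma> n\<^sub>0))"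
          by (rule mult_mono[OF _ E]) (use c P in auto)
      qed
      also have "\<dots> = (A + B * e n) * (1 + (norm x)\<^sup>2) * \<gamma> n" by (simp add: B_def add_divide_distrib algebra_simps)
      finally have "A * \<gamma> n + c * (1 + second_moment n\<^sub>0) * ?E \<le> (A + B * e n) * (1 + (norm x)\<^sup>2) * \<gamma> n" .
      moreover have "gap_le n (A * \<gamma> n + c * (1 + second_moment n\<^sub>0) * ?E)"
        unfolding A_def c_def by (rule gap_long_time[OF C n\<^sub>0_pos late n])
      ultimately show ?thesis using G_close_mono[OF Y_G_close_gibbs] by blast
    qed
    have early: "G_close (distr M borel (prlmc K U \<gamma> H \<xi> \<zeta> x n)) (gibbs U)
          (B * (1 + (norm x)\<^sup>2) * \<gamma> n)"
      if n: "1 \<le> n" "n < n\<^sub>0" for n x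
    proof -
      interpret prlmc_chain U F DF m \<Lambda> \<Lambda>' M K H \<xi> \<zeta> \<gamma> x by (rule chain)
      have "\<gamma> n\<^sub>0 \<le> \<gamma> n"
        by (rule steps_antimono[of \<gamma>, OF dec n(1) less_imp_le[OF n(2)]])
      then have "1 \<le> \<gamma> n / \<gamma> n\<^sub>0" using \<gamma>0 by simp
      have "(1 + gibbs_moment) * crude_factor K \<gamma> n * (1 + (norm x)\<^sup>2) \<le> c * P * (1 + (norm x)\<^sup>2)"
        using c gibbs_moment_nonneg crude_factor_ge_1[of K \<gamma> n] crude_factor_mono[of n n\<^sub>0 K \<gamma>] n
        by (intro mult_right_mono mult_mono) (auto simp: P_def)
      also have "\<dots> \<le> (c * P * (1 + (norm x)\<^sup>2)) * (\<gamma> n / \<gamma> n\<^sub>0)"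
        using \<open>1 \<le> \<gamma> n / \<gamma> n\<^sub>0\<close> c P mult_left_mono[of 1 "\<gamma> n / \<gamma> n\<^sub>0" "c * P * (1 + (norm x)\<^sup>2)"] by simp
      also have "\<dots> = B * (1 + (norm x)\<^sup>2) * \<gamma> n" by (simp add: B_def)
      finally show ?thesis by (rule G_close_mono[OF Y_G_close_gibbs_crude])
    qed
    show "\<exists>B n\<^sub>0. bounded_by_steps (\<lambda>n x. distr M borel (prlmc K U \<gamma> H \<xi> \<zeta> x n)) \<gamma> A B n\<^sub>0"
      unfolding bounded_by_steps_def
      by (intro exI[of _ B] exI[of _ n\<^sub>0] conjI allI impI B bound[unfolded e_def] early low) (simp_all add: n\<^sub>0_def)
  qed
qed

end

lemma step_time_mono:
  assumes "\<And>n. 0 < \<gamma> (Suc n)" "k \<le> n" shows "step_time \<gamma> k \<le> step_time \<gamma> n"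
  using assms(2)
proof (induction n rule: dec_induct)
  case (step n)
  then show ?case using assms(1)[of n] by (simp add: step_time_def)
qed simp

theorem theorem2p8:
  fixes U :: "real ^ 'd \<Rightarrow> real"
    and m L L' :: real
    and K :: nat
    and M :: "'w measure"
    and B :: "real \<Rightarrow> 'w \<Rightarrow> real ^ 'd"
    and X :: "real ^ 'd \<Rightarrow> real \<Rightarrow> 'w \<Rightarrow> real ^ 'd"
    and H :: "nat \<Rightarrow> nat \<Rightarrow> 'w \<Rightarrow> bool"
    and \<xi> :: "nat \<Rightarrow> 'w \<Rightarrow> real ^ 'd"
    and \<zeta> :: "nat \<Rightarrow> nat \<Rightarrow> 'w \<Rightarrow> real ^ 'd"
  assumes "C3 U"
    and "grad U 0 = 0"
    and "0 < m" and "m \<le> L"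
    and "\<And>x y. m / 2 * (norm (x - y))\<^sup>2 \<le> U y - U x - grad U x \<bullet> (y - x)"
    and "\<And>x y. U y - U x - grad U x \<bullet> (y - x) \<le> L / 2 * (norm (x - y))\<^sup>2"
    and "sup_norm (fderiv (fderiv (fderiv U))) \<le> ereal L'"
    and "K \<ge> 1"
    and "prob_space M"
    and "brownian_motion M B"
    and "\<And>x. langevin_solution M U B x (X x)"
    and "prlmc_noise M K H \<xi> \<zeta>"
  shows
    "(\<forall>\<gamma>. admissible_steps m \<gamma> \<longrightarrow>
        (\<exists>C>0. \<forall>n\<ge>1. \<forall>x.
           d_G (distr M borel (X x (step_time \<gamma> n))) (distr M borel (prlmc K U \<gamma> H \<xi> \<zeta> x n))
             \<le> ereal (C * (1 + (norm x)\<^sup>2) * \<gamma> n)) \<and>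
        (\<exists>C>0. \<forall>n\<ge>1. \<forall>x.
           d_G (distr M borel (prlmc K U \<gamma> H \<xi> \<zeta> x n)) (gibbs U)
             \<le> ereal (C * (1 + (norm x)\<^sup>2) * \<gamma> n))) \<and>
     (\<exists>C>0. \<forall>\<gamma>. admissible_steps m \<gamma> \<longrightarrow>
        (\<forall>\<^sub>F n in sequentially. \<forall>x.
           d_G (distr M borel (prlmc K U \<gamma> H \<xi> \<zeta> x n)) (gibbs U)
             \<le> ereal (C * (1 + (norm x)\<^sup>2) * \<gamma> n)))"
proof -
  have gradU: "grad U y = grad U y" for y ..
  interpret strongly_convex_potential U "grad U" "\<lambda>x v. riesz (blinfun_apply (fderiv (fderiv U) x) v)" m "2 * L" L'
    by (rule strongly_convex_potential_of_C3[OF assms(1-7)])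
  obtain A where A: "0 \<le> A"
    "\<And>\<gamma>. admissible_steps m \<gamma> \<Longrightarrow>
       \<exists>B n\<^sub>0. bounded_by_steps (\<lambda>n x. distr M borel (prlmc K U \<gamma> H \<xi> \<zeta> x n)) \<gamma> A B n\<^sub>0"
    using prlmc_gibbs_distance[OF assms(12) gradU] by blast
  have main: "(\<exists>C>0. \<forall>n\<ge>1. \<forall>x. G_close (distr M borel (X x (step_time \<gamma> n))) (distr M borel (prlmc K U \<gamma> H \<xi> \<zeta> x n))
             (C * (1 + (norm x)\<^sup>2) * \<gamma> n)) \<and>
        (\<exists>C>0. \<forall>n\<ge>1. \<forall>x. G_close (distr M borel (prlmc K U \<gamma> H \<xi> \<zeta> x n)) (gibbs U) (C * (1 + (norm x)\<^sup>2) * \<gamma> n)) \<and>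
        (\<forall>\<^sub>F n in sequentially. \<forall>x. G_close (distr M borel (prlmc K U \<gamma> H \<xi> \<zeta> x n)) (gibbs U) ((A + 1) * (1 + (norm x)\<^sup>2) * \<gamma> n))"
    if adm: "admissible_steps m \<gamma>" for \<gamma>
  proof -
    have pos: "0 < \<gamma> (Suc n)" for n using adm by (simp add: admissible_steps_def)
    have pos1: "0 < \<gamma> n" if "1 \<le> n" for n using pos[of "n - 1"] that by simp
    have dec: "1 \<le> n \<Longrightarrow> \<gamma> (Suc n) \<le> \<gamma> n" for n using adm by (simp add: admissible_steps_def)
    have T: "filterlim (step_time \<gamma>) at_top sequentially" using adm by (simp add: admissible_steps_def)
    obtain B n\<^sub>0 where B: "0 \<le> B" "0 < n\<^sub>0"
      and late: "\<And>n x. n\<^sub>0 \<le> n \<Longrightarrow> G_close (distr M borel (prlmc K U \<gamma> H \<xi> \<zeta> x n)) (gibbs U)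
          ((A + B * exp (- (m / 8) * (step_time \<gamma> n - step_time \<gamma> n\<^sub>0))) * (1 + (norm x)\<^sup>2) * \<gamma> n)"
      and early: "\<And>n x. \<lbrakk>1 \<le> n; n < n\<^sub>0\<rbrakk> \<Longrightarrow> G_close (distr M borel (prlmc K U \<gamma> H \<xi> \<zeta> x n)) (gibbs U)
          (B * (1 + (norm x)\<^sup>2) * \<gamma> n)"
      and low: "\<And>n. n\<^sub>0 \<le> n \<Longrightarrow> \<gamma> n\<^sub>0 * exp (- (m / 2) * (step_time \<gamma> n - step_time \<gamma> n\<^sub>0)) \<le> \<gamma> n"
      using A(2)[OF adm] unfolding bounded_by_steps_def by blast
    have scale: "p * (1 + (norm x)\<^sup>2) * \<gamma> n \<le> q * (1 + (norm x)\<^sup>2) * \<gamma> n" if "p \<le> q" "1 \<le> n" for p q n and x :: "real ^ 'd"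
      using that pos1[of n] by (intro mult_right_mono) auto
    have Y: "G_close (distr M borel (prlmc K U \<gamma> H \<xi> \<zeta> x n)) (gibbs U) ((A + B + 1) * (1 + (norm x)\<^sup>2) * \<gamma> n)"
      if n: "1 \<le> n" for n x
    proof (cases "n < n\<^sub>0")
      case True
      show ?thesis by (rule G_close_mono[OF early[OF n True] scale]) (use A B n in auto)
    next
      case False
      then have "step_time \<gamma> n\<^sub>0 \<le> step_time \<gamma> n" by (intro step_time_mono pos) simp
      then have "B * exp (- (m / 8) * (step_time \<gamma> n - step_time \<gamma> n\<^sub>0)) \<le> B * 1"
        using B m_pos by (intro mult_left_mono) (auto simp: mult_nonneg_nonneg)
      then show ?thesis
        using False n by (intro G_close_mono[OF late scale]) auto
    qed
    \<comment> \<open>the diffusion forgets its initial state faster than the steps decay\<close>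
    define t\<^sub>0 where "t\<^sub>0 = step_time \<gamma> n\<^sub>0"
    define D where "D = (1 + gibbs_moment) / \<gamma> n\<^sub>0"
    have g0: "0 < \<gamma> n\<^sub>0" using B(2) by (intro pos1) simp
    have t\<^sub>0: "0 \<le> t\<^sub>0" using step_time_mono[of \<gamma> 0 n\<^sub>0, OF pos] by (simp add: t\<^sub>0_def step_time_def)
    have D: "0 \<le> D" using g0 gibbs_moment_nonneg by (simp add: D_def)
    have X: "G_close (distr M borel (X x (step_time \<gamma> n))) (gibbs U) (D * (1 + (norm x)\<^sup>2) * \<gamma> n)"
      if n: "1 \<le> n" for n x
    proof -
      define t where "t = step_time \<gamma> n"
      have t: "0 < t"
        using step_time_mono[of \<gamma> 1 n, OF pos n] pos[of 0] by (simp add: step_time_def t_def)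
      have "\<gamma> n\<^sub>0 * exp (- \<beta> * t) \<le> \<gamma> n"
      proof (cases "n\<^sub>0 \<le> n")
        case True
        have "\<gamma> n\<^sub>0 * exp (- \<beta> * t) \<le> \<gamma> n\<^sub>0 * exp (- (m / 2) * t)"
          using g0 t m_pos by (intro mult_left_mono) (auto simp: \<beta>_def)
        also have "\<dots> = exp (- (m / 2) * t\<^sub>0) * (\<gamma> n\<^sub>0 * exp (- (m / 2) * (t - t\<^sub>0)))"
        proof -
          have "- (m / 2) * t = - (m / 2) * t\<^sub>0 + - (m / 2) * (t - t\<^sub>0)" by (simp add: field_simps)
          then have "exp (- (m / 2) * t) = exp (- (m / 2) * t\<^sub>0) * exp (- (m / 2) * (t - t\<^sub>0))" by (simp only: exp_add)
          then show ?thesis by (simp only: mult_ac)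
        qed
        also have "\<dots> \<le> 1 * \<gamma> n"
        proof (rule mult_mono)
          show "exp (- (m / 2) * t\<^sub>0) \<le> 1" using t\<^sub>0 m_pos by simp
          show "\<gamma> n\<^sub>0 * exp (- (m / 2) * (t - t\<^sub>0)) \<le> \<gamma> n" unfolding t_def t\<^sub>0_def by (rule low[OF True])
        qed (use g0 in simp_all)
        finally show ?thesis by simp
      next
        case False
        then have "\<gamma> n\<^sub>0 \<le> \<gamma> n" by (intro steps_antimono[of \<gamma> n n\<^sub>0, OF dec n]) simp_all
        moreover have "exp (- \<beta> * t) \<le> 1" using t \<beta>_pos by simp
        ultimately have "\<gamma> n\<^sub>0 * exp (- \<beta> * t) \<le> \<gamma> n * 1"
          using pos1[OF n] by (intro mult_mono) auto
        then show ?thesis by simp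
      qed
      then have e: "exp (- \<beta> * t) \<le> \<gamma> n / \<gamma> n\<^sub>0" using g0 by (simp add: field_simps)
      have "norm x + gibbs_moment \<le> (1 + gibbs_moment) * (1 + (norm x)\<^sup>2)"
        using le_one_plus_square[of "norm x"] mult_nonneg_nonneg[OF gibbs_moment_nonneg zero_le_power2[of "norm x"]] by (simp add: algebra_simps)
      then have "exp (- \<beta> * t) * (norm x + gibbs_moment) \<le> (\<gamma> n / \<gamma> n\<^sub>0) * ((1 + gibbs_moment) * (1 + (norm x)\<^sup>2))"
        using e gibbs_moment_nonneg g0 pos1[OF n] by (intro mult_mono) auto
      also have "\<dots> = D * (1 + (norm x)\<^sup>2) * \<gamma> n" by (simp add: D_def)
      finally show ?thesis
        using langevin_G_close_gibbs[OF assms(10,11) gradU t] unfolding t_def by (rule G_close_mono[rotated])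
    qed
    show ?thesis
    proof (intro conjI)
      show "\<exists>C>0. \<forall>n\<ge>1. \<forall>x. G_close (distr M borel (X x (step_time \<gamma> n))) (distr M borel (prlmc K U \<gamma> H \<xi> \<zeta> x n))
             (C * (1 + (norm x)\<^sup>2) * \<gamma> n)"
      proof (intro exI[of _ "D + (A + B + 1)"] conjI allI impI)
        fix n x assume "1 \<le> (n::nat)"
        from G_close_triangle[OF X[OF this] Y[OF this], of x x]
        show "G_close (distr M borel (X x (step_time \<gamma> n))) (distr M borel (prlmc K U \<gamma> H \<xi> \<zeta> x n))
             ((D + (A + B + 1)) * (1 + (norm x)\<^sup>2) * \<gamma> n)" by (simp only: distrib_right)
      qed (use A B D in auto)
      show "\<exists>C>0. \<forall>n\<ge>1. \<forall>x. G_close (distr M borel (prlmc K U \<gamma> H \<xi> \<zeta> x n)) (gibbs U) (C * (1 + (norm x)\<^sup>2) * \<gamma> n)"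
        using Y A(1) B(1) by (intro exI[of _ "A + B + 1"]) auto
      have "\<forall>\<^sub>F n in sequentially. B * exp (- (m / 8) * (step_time \<gamma> n - step_time \<gamma> n\<^sub>0)) < 1"
      proof (rule order_tendstoD)
        have "filterlim (\<lambda>n. step_time \<gamma> n - step_time \<gamma> n\<^sub>0) at_top sequentially"
          using filterlim_tendsto_add_at_top[OF tendsto_const[of "- step_time \<gamma> n\<^sub>0"] T] by simp
        then have "filterlim (\<lambda>n. - (m / 8) * (step_time \<gamma> n - step_time \<gamma> n\<^sub>0)) at_bot sequentially"
          using m_pos by (intro filterlim_tendsto_neg_mult_at_bot[OF tendsto_const]) auto
        then have "(\<lambda>n. exp (- (m / 8) * (step_time \<gamma> n - step_time \<gamma> n\<^sub>0))) \<longlonglongrightarrow> 0"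
          by (rule filterlim_compose[OF exp_at_bot])
        then show "(\<lambda>n. B * exp (- (m / 8) * (step_time \<gamma> n - step_time \<gamma> n\<^sub>0))) \<longlonglongrightarrow> 0"
          by (rule tendsto_mult_right_zero)
      qed simp
      with eventually_ge_at_top[of n\<^sub>0]
      show "\<forall>\<^sub>F n in sequentially. \<forall>x. G_close (distr M borel (prlmc K U \<gamma> H \<xi> \<zeta> x n)) (gibbs U) ((A + 1) * (1 + (norm x)\<^sup>2) * \<gamma> n)"
      proof eventually_elim
        case (elim n)
        then show ?case using B(2) by (intro allI G_close_mono[OF late scale]) auto
      qed
    qed
  qed
  show ?thesis
  proof (intro conjI allI impI)
    fix \<gamma> assume adm: "admissible_steps m \<gamma>"
    show "\<exists>C>0. \<forall>n\<ge>1. \<forall>x.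
           d_G (distr M borel (X x (step_time \<gamma> n))) (distr M borel (prlmc K U \<gamma> H \<xi> \<zeta> x n))
             \<le> ereal (C * (1 + (norm x)\<^sup>2) * \<gamma> n)"
      using main[OF adm] d_G_le_of_G_close by blast
    show "\<exists>C>0. \<forall>n\<ge>1. \<forall>x.
           d_G (distr M borel (prlmc K U \<gamma> H \<xi> \<zeta> x n)) (gibbs U)
             \<le> ereal (C * (1 + (norm x)\<^sup>2) * \<gamma> n)"
      using main[OF adm] d_G_le_of_G_close by blast
  next
    show "\<exists>C>0. \<forall>\<gamma>. admissible_steps m \<gamma> \<longrightarrow>
        (\<forall>\<^sub>F n in sequentially. \<forall>x.
           d_G (distr M borel (prlmc K U \<gamma> H \<xi> \<zeta> x n)) (gibbs U)
             \<le> ereal (C * (1 + (norm x)\<^sup>2) * \<gamma> n))"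
    proof (intro exI[of _ "A + 1"] conjI allI impI)
      fix \<gamma> assume "admissible_steps m \<gamma>"
      from main[OF this] have "\<forall>\<^sub>F n in sequentially. \<forall>x. G_close (distr M borel (prlmc K U \<gamma> H \<xi> \<zeta> x n)) (gibbs U) ((A + 1) * (1 + (norm x)\<^sup>2) * \<gamma> n)"
        by blast
      then show "\<forall>\<^sub>F n in sequentially. \<forall>x.
           d_G (distr M borel (prlmc K U \<gamma> H \<xi> \<zeta> x n)) (gibbs U) \<le> ereal ((A + 1) * (1 + (norm x)\<^sup>2) * \<gamma> n)"
        by eventually_elim (auto intro: d_G_le_of_G_close)
    qed (use A in simp)
  qed
qed

end
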